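(* Let $C\subseteq\mathbb R^d$ be a proper convex cone, and let $\mathcal C(C)^{\rm lrg}=(\mathcal C_s(C)^{\rm lrg})_{s\geqslant 1}$ be the largest abstract operator system over $C$. (i) If the dual cone $C^\vee$ is a spectrahedron, then the union of all free numerical ranges over $C$ covers the interior of $\mathcal C(C)^{\rm lrg}$; that is, for every $s\geqslant 1$ and every $A$ in the interior of $\mathcal C_s(C)^{\rm lrg}$ there is a free numerical range $\mathcal D=(\mathcal D_s)_{s\geqslant 1}$ with $\mathcal D_1=C$ and $A\in\mathcal D_s$. (ii) If $C$ is a spectrahedral shadow, then the union of all free spectrahedral shadows over $C$ covers the interior of $\mathcal C(C)^{\rm lrg}$; that is, for every $s\geqslant 1$ and every $A$ in the interior of $\mathcal C_s(C)^{\rm lrg}$ there is a free spectrahedral shadow $\mathcal D=(\mathcal D_s)_{s\geqslant 1}$ with $\mathcal D_1=C$ and $A\in\mathcal D_s$.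
   Context: $\mathrm{Her}_s(\mathbb C)$ is the real vector space of Hermitian $s\times s$ matrices; $\geqslant 0$ means positive semidefinite. A convex cone is proper if it is closed, has nonempty interior and contains no full line. The dual cone is $C^\vee=\{b\in\mathbb R^d\mid \sum_i a_ib_i\geqslant 0\ \forall a\in C\}$. An abstract operator system on $\mathbb C^d$ is a family $\mathcal C=(\mathcal C_s)_{s\geqslant1}$ of proper convex cones $\mathcal C_s\subseteq \mathrm{Her}_s(\mathbb C)^d$ such that $A=(A_1,\dots,A_d)\in\mathcal C_s$ and $V\in\mathrm{Mat}_{s,t}(\mathbb C)$ imply $V^*AV=(V^*A_1V,\dots,V^*A_dV)\in\mathcal C_t$. "Over $C$" means that the level-one cone equals $C\subseteq\mathbb R^d=\mathrm{Her}_1(\mathbb C)^d$. The largest operator system over $C$ is $\mathcal C_s(C)^{\rm lrg}=\{(A_1,\dots,A_d)\in\mathrm{Her}_s(\mathbb C)^d\mid \forall v\in\mathbb C^s:\ (v^*A_1v,\dots,v^*A_dv)\in C\}$. For Hermitian matrices $M_1,\dots,M_d\in\mathrm{Her}_r(\mathbb C)$ put $\mathcal S_s(M_1,\dots,M_d)=\{(A_1,\dots,A_d)\in\mathrm{Her}_s(\mathbb C)^d\mid \sum_i A_i\otimes M_i\geqslant0\}$. A free spectrahedron on $\mathbb C^d$ is an abstract operator system of the form $(\mathcal S_s(M_1,\dots,M_d))_{s\geqslant 1}$, where $\sum_iu_iM_i=I_r$ for some interior point $u$ of the level-one cone. A (classical) spectrahedron in $\mathbb R^d$ is a set of the form $\mathcal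 S_1(M_1,\dots,M_d)=\{a\in\mathbb R^d\mid \sum_i a_iM_i\geqslant 0\}$; a spectrahedral shadow in $\mathbb R^d$ is the image of a spectrahedral cone in some $\mathbb R^{d+e}$ under the projection to the first $d$ coordinates. A free numerical range is a finitely generated abstract operator system, i.e. one that is the smallest abstract operator system containing some finite set of its elements; equivalently, it is generated by a single $M=(M_1,\dots,M_d)\in\mathrm{Her}_r(\mathbb C)^d$, and its level $s$ is $\{\sum_{j=1}^n V_j^*MV_j\mid n\geqslant1,\ V_j\in\mathrm{Mat}_{r,s}(\mathbb C)\}$. A free spectrahedral shadow on $\mathbb C^d$ is a family $(\pi_s(\mathcal S_s(M_1,\dots,M_d,N_1,\dots,N_e)))_{s\geqslant1}$, where $\mathcal S(M_1,\dots,M_d,N_1,\dots,N_e)$ is a free spectrahedron on $\mathbb C^{d+e}$ and $\pi_s:\mathrm{Her}_s(\mathbb C)^{d+e}\to\mathrm{Her}_s(\mathbb C)^d$ is the projection to the first $d$ components. *)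

theory Defs
  imports
    "HOL-Analysis.Analysis"
    "Jordan_Normal_Form.Schur_Decomposition"
begin

text \<open>
  Matrices and vectors are those of Jordan\_Normal\_Form, since the size \<open>s\<close> of the matrices, the
  number \<open>d\<close> of components and the number \<open>e\<close> of auxiliary variables are all quantified over.
  A point of \<open>R^d\<close> is a \<open>v \<in> carrier_vec d\<close>, a \<open>d\<close>-tuple of matrices is a list of length \<open>d\<close>,
  and a family \<open>(C_s)\<close>, \<open>s \<ge> 1\<close>, is a function on \<open>nat\<close> whose value at \<open>0\<close> is irrelevant.
\<close>

type_synonym mat_tuple = "complex Matrix.mat list"
type_synonym mat_family = "nat \<Rightarrow> mat_tuple set"


section \<open>Hermitian and positive semidefinite matrices\<close>

definition Her :: "nat \<Rightarrow> complex Matrix.mat set" where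
  "Her s = {A \<in> carrier_mat s s. mat_adjoint A = A}"

text \<open>The number \<open>v^* A v\<close>, which is real for Hermitian \<open>A\<close>; \<open>\<bullet>c\<close> conjugates its second argument.\<close>

definition quad_form :: "complex Matrix.mat \<Rightarrow> complex Matrix.vec \<Rightarrow> real" where
  "quad_form A v = Re ((A *\<^sub>v v) \<bullet>c v)"

definition psd :: "nat \<Rightarrow> complex Matrix.mat \<Rightarrow> bool" where
  "psd n A \<longleftrightarrow> A \<in> Her n \<and> (\<forall>v\<in>carrier_vec n. 0 \<le> quad_form A v)"

definition kron :: "complex Matrix.mat \<Rightarrow> complex Matrix.mat \<Rightarrow> complex Matrix.mat" where
  "kron A B = Matrix.mat (dim_row A * dim_row B) (dim_col A * dim_col B)
     (\<lambda>(i, j). A $$ (i div dim_row B, j div dim_col B) * B $$ (i mod dim_row B, j mod dim_col B))"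

text \<open>The sum of a list of \<open>n \<times> n\<close> matrices; the size is needed for the empty sum.\<close>

definition mat_sum :: "nat \<Rightarrow> complex Matrix.mat list \<Rightarrow> complex Matrix.mat" where
  "mat_sum n Bs = foldr (+) Bs (0\<^sub>m n n)"


section \<open>Tuples of Hermitian matrices, topology, and proper cones\<close>

definition HerT :: "nat \<Rightarrow> nat \<Rightarrow> mat_tuple set" where
  "HerT d s = {A. length A = d \<and> set A \<subseteq> Her s}"

definition tuple_add :: "mat_tuple \<Rightarrow> mat_tuple \<Rightarrow> mat_tuple" where
  "tuple_add A B = map2 (+) A B"

definition tuple_scale :: "real \<Rightarrow> mat_tuple \<Rightarrow> mat_tuple" where
  "tuple_scale c A = map (\<lambda>B. complex_of_real c \<cdot>\<^sub>m B) A"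

text \<open>The tuple \<open>(V^* A_1 V, \<dots>, V^* A_d V)\<close>.\<close>

definition compress :: "complex Matrix.mat \<Rightarrow> mat_tuple \<Rightarrow> mat_tuple" where
  "compress V A = map (\<lambda>B. mat_adjoint V * B * V) A"

text \<open>
  The usual topologies of the finite-dimensional real spaces \<open>R^d\<close> and \<open>Her_s(C)^d\<close>, pulled back
  from the finite product topology along the coordinates (the matrix entries).
\<close>

definition vec_topology :: "nat \<Rightarrow> real Matrix.vec topology" where
  "vec_topology d = pullback_topology (carrier_vec d)
     (\<lambda>v. \<lambda>i\<in>{..<d}. Matrix.vec_index v i)
     (product_topology (\<lambda>_. euclidean) {..<d})"

definition HerT_topology :: "nat \<Rightarrow> nat \<Rightarrow> mat_tuple topology" where
  "HerT_topology d s = pullback_topology (HerT d s)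
     (\<lambda>A. \<lambda>(k, i, j)\<in>{..<d} \<times> {..<s} \<times> {..<s}. (A ! k) $$ (i, j))
     (product_topology (\<lambda>_. euclidean) ({..<d} \<times> {..<s} \<times> {..<s}))"

text \<open>
  Proper convex cones in a real topological vector space given by a topology on its carrier,
  an addition and a scalar multiplication. The condition \<open>plus_op x y \<noteq> x\<close> says that the direction
  \<open>y\<close> of the line \<open>{x + t y | t}\<close> is not zero.
\<close>

definition proper_cone_in ::
  "'v topology \<Rightarrow> ('v \<Rightarrow> 'v \<Rightarrow> 'v) \<Rightarrow> (real \<Rightarrow> 'v \<Rightarrow> 'v) \<Rightarrow> 'v set \<Rightarrow> bool" where
  "proper_cone_in X plus_op scale_op K \<longleftrightarrow>
     closedin X K \<and> X interior_of K \<noteq> {} \<and>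
     (\<forall>x\<in>K. \<forall>y\<in>K. plus_op x y \<in> K) \<and> (\<forall>x\<in>K. \<forall>c\<ge>0. scale_op c x \<in> K) \<and>
     \<not> (\<exists>x\<in>topspace X. \<exists>y\<in>topspace X. plus_op x y \<noteq> x \<and> (\<forall>t. plus_op x (scale_op t y) \<in> K))"

definition proper_cone :: "nat \<Rightarrow> real Matrix.vec set \<Rightarrow> bool" where
  "proper_cone d C \<longleftrightarrow> proper_cone_in (vec_topology d) (+) (\<cdot>\<^sub>v) C"

definition proper_cone_HerT :: "nat \<Rightarrow> nat \<Rightarrow> mat_tuple set \<Rightarrow> bool" where
  "proper_cone_HerT d s K \<longleftrightarrow> proper_cone_in (HerT_topology d s) tuple_add tuple_scale K"

definition dual_cone :: "nat \<Rightarrow> real Matrix.vec set \<Rightarrow> real Matrix.vec set" where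
  "dual_cone d C = {b \<in> carrier_vec d. \<forall>a\<in>C. 0 \<le> scalar_prod a b}"


section \<open>Spectrahedra and their shadows\<close>

text \<open>The matrix \<open>a_1 M_1 + \<dots> + a_d M_d\<close> of size \<open>r\<close>.\<close>

definition pencil :: "nat \<Rightarrow> mat_tuple \<Rightarrow> real Matrix.vec \<Rightarrow> complex Matrix.mat" where
  "pencil r M a = mat_sum r (map2 (\<lambda>c B. complex_of_real c \<cdot>\<^sub>m B) (list_of_vec a) M)"

definition spectrahedron :: "nat \<Rightarrow> real Matrix.vec set \<Rightarrow> bool" where
  "spectrahedron d S \<longleftrightarrow>
     (\<exists>r\<ge>1. \<exists>M\<in>HerT d r. S = {a \<in> carrier_vec d. psd r (pencil r M a)})"

definition spectrahedral_shadow :: "nat \<Rightarrow> real Matrix.vec set \<Rightarrow> bool" where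
  "spectrahedral_shadow d S \<longleftrightarrow>
     (\<exists>e T. spectrahedron (d + e) T \<and> S = (\<lambda>a. vec_first a d) ` T)"


section \<open>Operator systems\<close>

definition abstract_operator_system :: "nat \<Rightarrow> mat_family \<Rightarrow> bool" where
  "abstract_operator_system d \<D> \<longleftrightarrow>
     (\<forall>s\<ge>1. proper_cone_HerT d s (\<D> s)) \<and>
     (\<forall>s\<ge>1. \<forall>t\<ge>1. \<forall>A\<in>\<D> s. \<forall>V\<in>carrier_mat s t. compress V A \<in> \<D> t)"

text \<open>The identification of \<open>R^d\<close> with \<open>Her_1(C)^d\<close>.\<close>

definition embed :: "real Matrix.vec \<Rightarrow> mat_tuple" where
  "embed a = map (\<lambda>c. Matrix.mat 1 1 (\<lambda>_. complex_of_real c)) (list_of_vec a)"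

definition over :: "mat_family \<Rightarrow> real Matrix.vec set \<Rightarrow> bool" where
  "over \<D> C \<longleftrightarrow> \<D> 1 = embed ` C"

definition largest_system :: "nat \<Rightarrow> real Matrix.vec set \<Rightarrow> mat_family" where
  "largest_system d C s =
     {A \<in> HerT d s. \<forall>v\<in>carrier_vec s. vec_of_list (map (\<lambda>B. quad_form B v) A) \<in> C}"

definition free_solution_sets :: "nat \<Rightarrow> nat \<Rightarrow> mat_tuple \<Rightarrow> mat_family" where
  "free_solution_sets d r M s =
     {A \<in> HerT d s. psd (s * r) (mat_sum (s * r) (map2 kron A M))}"

text \<open>
  \<open>free_spectrahedron_by d r M\<close>: the family defined by \<open>M \<in> Her_r(C)^d\<close> is a free spectrahedron.
\<close>

definition free_spectrahedron_by :: "nat \<Rightarrow> nat \<Rightarrow> mat_tuple \<Rightarrow> bool" where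
  "free_spectrahedron_by d r M \<longleftrightarrow>
     1 \<le> r \<and> M \<in> HerT d r \<and>
     abstract_operator_system d (free_solution_sets d r M) \<and>
     (\<exists>u\<in>carrier_vec d.
        embed u \<in> HerT_topology d 1 interior_of (free_solution_sets d r M 1) \<and>
        pencil r M u = 1\<^sub>m r)"

definition free_spectrahedral_shadow :: "nat \<Rightarrow> mat_family \<Rightarrow> bool" where
  "free_spectrahedral_shadow d \<D> \<longleftrightarrow>
     (\<exists>e r M. free_spectrahedron_by (d + e) r M \<and>
        (\<forall>s\<ge>1. \<D> s = take d ` free_solution_sets (d + e) r M s))"

text \<open>
  A free numerical range is the smallest abstract operator system containing some finite set of
  its elements; an element is given together with its level.
\<close>

definition contains_elements :: "mat_family \<Rightarrow> (nat \<times> mat_tuple) set \<Rightarrow> bool" where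
  "contains_elements \<D> F \<longleftrightarrow> (\<forall>(s, A)\<in>F. 1 \<le> s \<and> A \<in> \<D> s)"

definition free_numerical_range :: "nat \<Rightarrow> mat_family \<Rightarrow> bool" where
  "free_numerical_range d \<D> \<longleftrightarrow>
     abstract_operator_system d \<D> \<and>
     (\<exists>F. finite F \<and> contains_elements \<D> F \<and>
        (\<forall>\<E>. abstract_operator_system d \<E> \<and> contains_elements \<E> F \<longrightarrow> (\<forall>s\<ge>1. \<D> s \<subseteq> \<E> s)))"

end

theory Submission
  imports Defs "HOL-Library.Function_Algebras"
begin

text \<open>
  Both parts enlarge a system over \<open>C\<close> by a single element \<open>A\<close> of the largest system. This does not change
  level one, since the largest system puts all vectors \<open>v^* A v\<close> into \<open>C\<close>.

  For part (i), write the dual cone as the set of all \<open>b\<close> with \<open>\<Sum> b_i M_i \<ge> 0\<close>. Biduality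
  places \<open>M\<close> in the largest system (\<open>dual_pencil_in_largest_system\<close>), and conversely any operator
  system that contains \<open>M\<close> has all of \<open>C\<close> in its level one (\<open>dual_pencil_generates_level_one\<close>). The system
  generated by \<open>M\<close> and \<open>A\<close> is defined as the intersection of all operator systems containing them. It is
  closed as an intersection of closed sets, and it contains no line because it lies in the largest
  system; its interior points come from the elementary tensors over \<open>C\<close>, which every operator
  system over \<open>C\<close> contains (\<open>generated_operator_system\<close>).

  For part (ii), a family \<open>\<S>(M_1, \<dots>, M_n)\<close> is a free spectrahedron as soon as the \<open>M_k\<close> are
  linearly independent over the reals and have the identity in their span
  (\<open>free_spectrahedron_of_independent_pencil\<close>). The given description of \<open>C\<close> as a shadow need not have these
  properties. It is therefore replaced by a space of pairs \<open>(a, h)\<close> of a vector and a Hermitian form,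
  with \<open>C\<close> the set of all \<open>a\<close> paired with a positive semidefinite \<open>h\<close>. Restricting to the
  span of the spectrahedral cone and compressing to the support of a relative interior point \<open>U\<close>
  turns \<open>U\<close> into an identity matrix (\<open>spectrahedral_shadow_repr\<close>, \<open>unital_repr\<close>). At the same time a free
  Hermitian block \<open>Z\<close> is added to \<open>h\<close> that contributes the vector of the numbers \<open>tr (A_i Z^T)\<close> to \<open>a\<close>. For \<open>Z \<ge> 0\<close> this vector
  is in \<open>C\<close>, so the cone stays the same, while at level \<open>s\<close> the maximally
  entangled tensor in the new block projects to \<open>A\<close> (\<open>pairing_expansion\<close>, \<open>herm_basis_tensor_form\<close>).
  A basis adapted to the projection finally turns the space of pairs into a pencil
  (\<open>adapted_basis\<close>, \<open>free_shadow_of_unital_repr\<close>); that \<open>C\<close> contains no line makes the vector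
  a function of the form, and that \<open>C\<close> has interior points makes every vector occur.
\<close>

(* Vectors and their components are those of Jordan_Normal_Form, subspaces those of real vector spaces. *)
unbundle no vec_syntax
hide_const (open) VectorSpace.subspace

section \<open>The topologies of R^d and of Her_s(C)^d\<close>

lemma topspace_vec_topology: "topspace (vec_topology d) = carrier_vec d"
  by (auto simp: vec_topology_def topspace_pullback_topology)

lemma topspace_HerT_topology: "topspace (HerT_topology d s) = HerT d s"
  by (auto simp: HerT_topology_def topspace_pullback_topology)

lemma continuous_map_vec_index:
  assumes "i < d"
  shows "continuous_map (vec_topology d) euclideanreal (\<lambda>v. v $ i)"
proof -
  have "continuous_map (vec_topology d) euclideanreal ((\<lambda>x. x i) \<circ> (\<lambda>v. \<lambda>i\<in>{..<d}. v $ i))"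
    unfolding vec_topology_def
    by (rule continuous_map_pullback) (use assms in \<open>intro continuous_map_product_projection, simp\<close>)
  then show ?thesis using assms by (simp add: o_def)
qed

lemma continuous_map_HerT_entry:
  assumes "k < d" "i < s" "j < s"
  shows "continuous_map (HerT_topology d s) euclidean (\<lambda>A. (A ! k) $$ (i, j))"
proof -
  let ?I = "{..<d} \<times> {..<s} \<times> {..<s}"
  let ?e = "\<lambda>A. \<lambda>(k, i, j)\<in>?I. (A ! k) $$ (i, j)"
  have "continuous_map (HerT_topology d s) euclidean ((\<lambda>x. x (k, i, j)) \<circ> ?e)"
    unfolding HerT_topology_def
    by (rule continuous_map_pullback)
      (use assms in \<open>intro continuous_map_product_projection, simp\<close>)
  then show ?thesis using assms by (simp add: o_def)
qed

lemma interior_of_vec_topologyD: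
  assumes "x \<in> vec_topology d interior_of S"
  shows "\<exists>\<epsilon>>0. \<forall>y\<in>carrier_vec d. (\<forall>i<d. \<bar>y $ i - x $ i\<bar> < \<epsilon>) \<longrightarrow> y \<in> S"
proof -
  let ?e = "\<lambda>v::real vec. \<lambda>i\<in>{..<d}. v $ i"
  obtain T where T: "openin (vec_topology d) T" "x \<in> T" "T \<subseteq> S"
    using assms by (auto simp: interior_of_def)
  then obtain U where U: "openin (product_topology (\<lambda>_. euclideanreal) {..<d}) U"
      and TU: "T = ?e -` U \<inter> carrier_vec d"
    by (auto simp: vec_topology_def openin_pullback_topology)
  have "?e x \<in> U" using T(2) TU by auto
  then obtain O' where O: "\<And>i. i < d \<Longrightarrow> open (O' i)" "?e x \<in> PiE {..<d} O'" "PiE {..<d} O' \<subseteq> U"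
    using U unfolding openin_product_topology_alt by (metis lessThan_iff open_openin)
  have "\<forall>i\<in>{..<d}. \<exists>r>0. ball (x $ i) r \<subseteq> O' i"
  proof
    fix i assume i: "i \<in> {..<d}"
    then have "x $ i \<in> O' i" using O(2) by (force simp: PiE_iff)
    then show "\<exists>r>0. ball (x $ i) r \<subseteq> O' i" using O(1) i open_contains_ball by blast
  qed
  then obtain r where r: "\<And>i. i < d \<Longrightarrow> 0 < r i" "\<And>i. i < d \<Longrightarrow> ball (x $ i) (r i) \<subseteq> O' i"
    by (metis lessThan_iff)
  define \<epsilon> where "\<epsilon> = Min (insert 1 (r ` {..<d}))"
  have "0 < \<epsilon>" using r(1) by (auto simp: \<epsilon>_def)
  moreover have "y \<in> S" if y: "y \<in> carrier_vec d" "\<forall>i<d. \<bar>y $ i - x $ i\<bar> < \<epsilon>" for y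
  proof -
    have "y $ i \<in> O' i" if i: "i < d" for i
    proof -
      have "\<epsilon> \<le> r i" using i by (auto simp: \<epsilon>_def)
      then have "y $ i \<in> ball (x $ i) (r i)" using y(2)[rule_format, OF i] by (simp add: dist_real_def abs_minus_commute)
      then show ?thesis using r(2)[OF i] by blast
    qed
    then have "?e y \<in> PiE {..<d} O'" by auto
    then show ?thesis using O(3) y(1) TU T(3) by blast
  qed
  ultimately show ?thesis by blast
qed

lemma interior_of_HerT_topologyI:
  assumes "0 < \<epsilon>" "U \<in> HerT d s"
    and box: "\<And>A. A \<in> HerT d s \<Longrightarrow>
      (\<And>k i j. k < d \<Longrightarrow> i < s \<Longrightarrow> j < s \<Longrightarrow> cmod ((A ! k) $$ (i, j) - (U ! k) $$ (i, j)) < \<epsilon>) \<Longrightarrow> A \<in> S"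
  shows "U \<in> HerT_topology d s interior_of S"
proof -
  let ?I = "{..<d} \<times> {..<s} \<times> {..<s}"
  let ?e = "\<lambda>A. \<lambda>(k, i, j)\<in>?I. (A ! k) $$ (i, j)"
  define P where "P = PiE ?I (\<lambda>(k, i, j). ball ((U ! k) $$ (i, j)) \<epsilon>)"
  define T where "T = ?e -` P \<inter> HerT d s"
  have "openin (product_topology (\<lambda>_. euclidean) ?I) P"
    unfolding P_def by (subst openin_PiE) auto
  then have "openin (HerT_topology d s) T"
    by (auto simp: HerT_topology_def T_def openin_pullback_topology)
  moreover have "U \<in> T" using assms(1,2) by (auto simp: T_def P_def)
  moreover have "T \<subseteq> S"
  proof
    fix A assume "A \<in> T"
    then have A: "A \<in> HerT d s" "?e A \<in> P" by (auto simp: T_def)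
    show "A \<in> S"
    proof (rule box[OF A(1)])
      fix k i j assume "k < d" "i < s" "j < s"
      then have "?e A (k, i, j) \<in> ball ((U ! k) $$ (i, j)) \<epsilon>"
        using A(2) unfolding P_def by (fastforce simp: PiE_iff)
      then show "cmod ((A ! k) $$ (i, j) - (U ! k) $$ (i, j)) < \<epsilon>"
        using \<open>k < d\<close> \<open>i < s\<close> \<open>j < s\<close> by (simp add: dist_norm norm_minus_commute)
    qed
  qed
  ultimately show ?thesis by (auto simp: interior_of_def)
qed

section \<open>Closed convex cones in R^d are determined by their duals\<close>

lemma scalar_prod_sum: "b \<in> carrier_vec d \<Longrightarrow> scalar_prod a b = (\<Sum>i<d. a $ i * b $ i)"
  by (auto simp: scalar_prod_def lessThan_atLeast0)

text \<open>
  The distance from the given point is continuous and the part of \<open>K\<close> no farther away than \<open>k0\<close> lies in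
  a box, which is compact as a finite product of intervals.
\<close>

lemma closest_point_exists:
  assumes K: "closedin (vec_topology d) K" and k0: "k0 \<in> K"
  obtains x where "x \<in> K" "\<And>y. y \<in> K \<Longrightarrow> (\<Sum>i<d. (x $ i - p i)\<^sup>2) \<le> (\<Sum>i<d. (y $ i - p i)\<^sup>2)"
proof -
  let ?e = "\<lambda>v::real vec. \<lambda>i\<in>{..<d}. v $ i"
  let ?X = "product_topology (\<lambda>_. euclideanreal) {..<d}"
  define N where "N = (\<lambda>x. \<Sum>i<d. (x i - p i)\<^sup>2)"
  have Kd: "K \<subseteq> carrier_vec d" using closedin_subset[OF K] topspace_vec_topology by blast
  have "openin (vec_topology d) (carrier_vec d - K)"
    using K by (simp add: closedin_def topspace_vec_topology)
  then obtain U where U: "openin ?X U" "carrier_vec d - K = ?e -` U \<inter> carrier_vec d"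
    by (auto simp: vec_topology_def openin_pullback_topology)
  define L where "L = topspace ?X - U"
  have L: "closedin ?X L" using U(1) unfolding L_def by (intro closedin_diff closedin_topspace)
  have KL: "?e v \<in> L \<longleftrightarrow> v \<in> K" if "v \<in> carrier_vec d" for v
    using U(2) that by (auto simp: L_def)
  \<comment> \<open>The box of radius \<open>R\<close> contains \<open>k0\<close>, and outside of it the squared distance exceeds \<open>R\<^sup>2\<close>,
    hence that of \<open>k0\<close>.\<close>
  define R where "R = 1 + (\<Sum>i<d. (k0 $ i - p i)\<^sup>2)"
  define Q where "Q = PiE {..<d} (\<lambda>i. {p i - R .. p i + R})"
  have "compactin ?X Q" unfolding Q_def by (subst compactin_PiE) auto
  then have comp: "compactin ?X (L \<inter> Q)" using L by (rule closed_Int_compactin[rotated])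
  have "\<bar>k0 $ i - p i\<bar> \<le> R" if "i < d" for i
  proof -
    have "0 \<le> (\<bar>k0 $ i - p i\<bar> - 1)\<^sup>2 + \<bar>k0 $ i - p i\<bar>" by simp
    then have "\<bar>k0 $ i - p i\<bar> \<le> 1 + (k0 $ i - p i)\<^sup>2" by (simp add: power2_diff)
    also have "\<dots> \<le> R" unfolding R_def using that by (intro add_left_mono member_le_sum) auto
    finally show ?thesis .
  qed
  then have "?e k0 \<in> Q" by (force simp: Q_def abs_le_iff)
  then have ne: "?e k0 \<in> L \<inter> Q" using KL k0 Kd by blast
  have "continuous_map ?X euclideanreal N"
    unfolding N_def
    by (intro continuous_map_sum continuous_map_real_pow continuous_map_diff continuous_map_canonical_const)
      (simp_all add: continuous_map_product_projection[of _ "{..<d}" "\<lambda>_. euclideanreal"])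
  then have "compact (N ` (L \<inter> Q))" using image_compactin[OF comp] by (metis compactin_euclidean_iff)
  then obtain x where x: "x \<in> L \<inter> Q" "\<And>y. y \<in> L \<inter> Q \<Longrightarrow> N x \<le> N y"
    using compact_attains_inf[of "N ` (L \<inter> Q)"] ne by blast
  have xe: "?e (vec d x) = x" using x(1) by (auto simp: Q_def PiE_def extensional_def restrict_def)
  have NR: "N (?e k0) \<le> R\<^sup>2"
  proof -
    have "N (?e k0) = R - 1" by (simp add: N_def R_def)
    also have "\<dots> \<le> R\<^sup>2" using self_le_power[of R 2] by (simp add: R_def sum_nonneg)
    finally show ?thesis .
  qed
  show ?thesis
  proof (rule that[of "vec d x"])
    show "vec d x \<in> K" using x(1) xe KL[of "vec d x"] by auto
  next
    fix y assume y: "y \<in> K"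
    then have yL: "?e y \<in> L" using KL Kd by blast
    have Nx: "N x = (\<Sum>i<d. (vec d x $ i - p i)\<^sup>2)" and Ny: "N (?e y) = (\<Sum>i<d. (y $ i - p i)\<^sup>2)"
      by (simp_all add: N_def)
    have "N x \<le> N (?e y)"
    proof (cases "?e y \<in> Q")
      case True then show ?thesis using x(2) yL by blast
    next
      case False
      then obtain i where i: "i < d" "\<not> \<bar>y $ i - p i\<bar> \<le> R"
        by (force simp: Q_def abs_le_iff)
      have "0 \<le> R" by (simp add: R_def sum_nonneg)
      then have "R\<^sup>2 \<le> (y $ i - p i)\<^sup>2" using i(2) by (simp add: abs_le_square_iff[symmetric])
      also have "\<dots> \<le> N (?e y)"
        unfolding Ny using i(1) by (intro member_le_sum) auto
      finally show ?thesis using NR x(2)[OF ne] by linarith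
    qed
    then show "(\<Sum>i<d. (vec d x $ i - p i)\<^sup>2) \<le> (\<Sum>i<d. (y $ i - p i)\<^sup>2)"
      by (simp add: Nx Ny)
  qed
qed

text \<open>
  If \<open>x\<close> is the point of the cone closest to \<open>p\<close>, then \<open>b = x - p\<close> separates: moving from \<open>x\<close> in a direction
  of the cone does not decrease the distance, which makes \<open>b\<close> nonnegative on the cone, and moving
  along the ray through \<open>x\<close> in the direction of \<open>0\<close> shows that \<open>b\<close> is at most \<open>0\<close> at \<open>x\<close>.
\<close>

lemma separating_functional:
  assumes K: "closedin (vec_topology d) K" and z: "0\<^sub>v d \<in> K"
    and add: "\<And>x y. x \<in> K \<Longrightarrow> y \<in> K \<Longrightarrow> x + y \<in> K"
    and scale: "\<And>x c. x \<in> K \<Longrightarrow> 0 \<le> c \<Longrightarrow> c \<cdot>\<^sub>v x \<in> K"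
    and p: "p \<in> carrier_vec d" "p \<notin> K"
  obtains b where "b \<in> dual_cone d K" "scalar_prod p b < 0"
proof -
  have Kd: "K \<subseteq> carrier_vec d" using closedin_subset[OF K] topspace_vec_topology by blast
  obtain x where x: "x \<in> K"
    and min: "\<And>y. y \<in> K \<Longrightarrow> (\<Sum>i<d. (x $ i - p $ i)\<^sup>2) \<le> (\<Sum>i<d. (y $ i - p $ i)\<^sup>2)"
    using closest_point_exists[OF K z, of "\<lambda>i. p $ i"] by blast
  have xd: "x \<in> carrier_vec d" using x Kd by blast
  define b where "b = x - p"
  have b: "b \<in> carrier_vec d" using xd p by (simp add: b_def)
  have bi: "b $ i = x $ i - p $ i" if "i < d" for i using that xd p by (simp add: b_def)
  have expand: "(\<Sum>i<d. (x $ i + t * y $ i - p $ i)\<^sup>2)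
      = (\<Sum>i<d. (x $ i - p $ i)\<^sup>2) + 2 * t * scalar_prod y b + t\<^sup>2 * scalar_prod y y"
    if "y \<in> carrier_vec d" for y t
    unfolding scalar_prod_sum[OF b] scalar_prod_sum[OF that]
    by (simp add: bi sum_distrib_left sum.distrib[symmetric] power2_eq_square algebra_simps)
  have nonneg: "0 \<le> 2 * t * scalar_prod y b + t\<^sup>2 * scalar_prod y y"
    if "y \<in> carrier_vec d" "x + t \<cdot>\<^sub>v y \<in> K" for y t
  proof -
    have "(\<Sum>i<d. ((x + t \<cdot>\<^sub>v y) $ i - p $ i)\<^sup>2) = (\<Sum>i<d. (x $ i + t * y $ i - p $ i)\<^sup>2)"
      using that(1) xd by (intro sum.cong) auto
    then show ?thesis using min[OF that(2)] expand[OF that(1)] by simp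
  qed
  \<comment> \<open>A quadratic \<open>2 t \<beta> + t\<^sup>2 \<gamma>\<close> that is nonnegative for small \<open>t > 0\<close> has \<open>\<beta> \<ge> 0\<close>.\<close>
  have slope: "0 \<le> \<beta>" if "\<And>t. 0 < t \<Longrightarrow> t \<le> 1 \<Longrightarrow> 0 \<le> 2 * t * \<beta> + t\<^sup>2 * \<gamma>" for \<beta> \<gamma> :: real
  proof (rule ccontr)
    assume "\<not> 0 \<le> \<beta>"
    then have neg: "\<beta> < 0" by simp
    define t where "t = min 1 (- \<beta> / (\<bar>\<gamma>\<bar> + 1))"
    have t: "0 < t" "t \<le> 1" using neg by (auto simp: t_def field_simps)
    have "t \<le> - \<beta> / (\<bar>\<gamma>\<bar> + 1)" by (simp add: t_def)
    then have "t * (\<bar>\<gamma>\<bar> + 1) \<le> - \<beta>" by (subst (asm) pos_le_divide_eq) auto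
    moreover have "t * \<gamma> \<le> t * (\<bar>\<gamma>\<bar> + 1)" using t by (intro mult_left_mono) auto
    ultimately have "2 * \<beta> + t * \<gamma> < 0" using neg by linarith
    then have "t * (2 * \<beta> + t * \<gamma>) < 0" using t(1) by (simp add: mult_pos_neg)
    then show False using that[OF t] by (simp add: power2_eq_square algebra_simps)
  qed
  have "0 \<le> scalar_prod y b" if y: "y \<in> K" for y
  proof (rule slope)
    fix t :: real assume "0 < t" "t \<le> 1"
    then show "0 \<le> 2 * t * scalar_prod y b + t\<^sup>2 * scalar_prod y y"
      using y Kd by (intro nonneg add x scale) auto
  qed
  then have bK: "b \<in> dual_cone d K" using b by (simp add: dual_cone_def)
  have "0 \<le> - scalar_prod x b"
  proof (rule slope)
    fix t :: real assume t: "0 < t" "t \<le> 1"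
    have "x + (-t) \<cdot>\<^sub>v x = (1 - t) \<cdot>\<^sub>v x" using xd by (auto simp: algebra_simps)
    then have "x + (-t) \<cdot>\<^sub>v x \<in> K" using scale[OF x, of "1 - t"] t by simp
    from nonneg[OF xd this]
    show "0 \<le> 2 * t * - scalar_prod x b + t\<^sup>2 * scalar_prod x x" by simp
  qed
  moreover have "scalar_prod p b = scalar_prod x b - (\<Sum>i<d. (b $ i)\<^sup>2)"
    unfolding scalar_prod_sum[OF b]
    by (simp add: sum_subtractf[symmetric] bi power2_eq_square algebra_simps)
  moreover have "0 < (\<Sum>i<d. (b $ i)\<^sup>2)"
  proof -
    have "x \<noteq> p" using x p(2) by blast
    then obtain i where "i < d" "x $ i \<noteq> p $ i" using xd p(1) by (auto simp: vec_eq_iff)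
    then show ?thesis by (intro sum_pos2[of _ i]) (auto simp: bi)
  qed
  ultimately have "scalar_prod p b < 0" by linarith
  then show ?thesis using that bK by blast
qed

section \<open>Sesquilinear forms\<close>

definition sesq :: "nat \<Rightarrow> (nat \<Rightarrow> nat \<Rightarrow> complex) \<Rightarrow> (nat \<Rightarrow> complex) \<Rightarrow> (nat \<Rightarrow> complex) \<Rightarrow> complex" where
  "sesq n h f g = (\<Sum>i<n. \<Sum>j<n. h i j * f j * cnj (g i))"

definition hermitian :: "nat \<Rightarrow> (nat \<Rightarrow> nat \<Rightarrow> complex) \<Rightarrow> bool" where
  "hermitian n h \<longleftrightarrow> (\<forall>i<n. \<forall>j<n. h j i = cnj (h i j))"

lemma hermitianI: "(\<And>i j. i < n \<Longrightarrow> j < n \<Longrightarrow> cnj (h i j) = h j i) \<Longrightarrow> hermitian n h"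
  by (simp add: hermitian_def)

lemma hermitianD: "hermitian n h \<Longrightarrow> i < n \<Longrightarrow> j < n \<Longrightarrow> cnj (h i j) = h j i"
  unfolding hermitian_def by (metis complex_cnj_cnj)

definition pos_form :: "nat \<Rightarrow> (nat \<Rightarrow> nat \<Rightarrow> complex) \<Rightarrow> bool" where
  "pos_form n h \<longleftrightarrow> (\<forall>f. 0 \<le> Re (sesq n h f f))"

lemma sesq_cong:
  assumes "\<And>i j. i < n \<Longrightarrow> j < n \<Longrightarrow> h i j = h' i j"
    and "\<And>i. i < n \<Longrightarrow> f i = f' i" "\<And>i. i < n \<Longrightarrow> g i = g' i"
  shows "sesq n h f g = sesq n h' f' g'"
  unfolding sesq_def using assms by (intro sum.cong) auto

lemma sesq_linear:
  "sesq n (\<lambda>i j. \<Sum>k\<in>K. c k * h k i j) f g = (\<Sum>k\<in>K. c k * sesq n (h k) f g)"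
proof -
  have "sesq n (\<lambda>i j. \<Sum>k\<in>K. c k * h k i j) f g
      = (\<Sum>i<n. \<Sum>j<n. \<Sum>k\<in>K. c k * (h k i j * f j * cnj (g i)))"
    by (simp add: sesq_def sum_distrib_left sum_distrib_right mult_ac)
  also have "\<dots> = (\<Sum>i<n. \<Sum>k\<in>K. \<Sum>j<n. c k * (h k i j * f j * cnj (g i)))"
    by (intro sum.cong refl, subst sum.swap) (rule refl)
  also have "\<dots> = (\<Sum>k\<in>K. \<Sum>i<n. \<Sum>j<n. c k * (h k i j * f j * cnj (g i)))"
    by (rule sum.swap)
  also have "\<dots> = (\<Sum>k\<in>K. c k * sesq n (h k) f g)"
    by (simp add: sesq_def sum_distrib_left)
  finally show ?thesis .
qed

lemma sesq_sum_left:
  "sesq n h (\<lambda>i. \<Sum>k\<in>K. c k * f k i) g = (\<Sum>k\<in>K. c k * sesq n h (f k) g)"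
proof -
  have "sesq n h (\<lambda>i. \<Sum>k\<in>K. c k * f k i) g
      = (\<Sum>i<n. \<Sum>j<n. \<Sum>k\<in>K. c k * (h i j * f k j * cnj (g i)))"
    by (simp add: sesq_def sum_distrib_left sum_distrib_right mult_ac)
  also have "\<dots> = (\<Sum>i<n. \<Sum>k\<in>K. \<Sum>j<n. c k * (h i j * f k j * cnj (g i)))"
    by (intro sum.cong refl, subst sum.swap) (rule refl)
  also have "\<dots> = (\<Sum>k\<in>K. \<Sum>i<n. \<Sum>j<n. c k * (h i j * f k j * cnj (g i)))"
    by (rule sum.swap)
  also have "\<dots> = (\<Sum>k\<in>K. c k * sesq n h (f k) g)"
    by (simp add: sesq_def sum_distrib_left)
  finally show ?thesis .
qed

lemma sesq_adjoint:
  assumes "hermitian n h"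
  shows "sesq n h g f = cnj (sesq n h f g)"
proof -
  have "sesq n h g f = (\<Sum>j<n. \<Sum>i<n. h i j * g j * cnj (f i))"
    unfolding sesq_def by (rule sum.swap)
  also have "\<dots> = (\<Sum>j<n. \<Sum>i<n. cnj (h j i * f i * cnj (g j)))"
    by (intro sum.cong refl) (simp add: hermitianD[OF assms])
  finally show ?thesis by (simp add: sesq_def)
qed

lemma sesq_sum_right:
  assumes "hermitian n h"
  shows "sesq n h f (\<lambda>i. \<Sum>k\<in>K. c k * g k i) = (\<Sum>k\<in>K. cnj (c k) * sesq n h f (g k))"
proof -
  have "sesq n h f (\<lambda>i. \<Sum>k\<in>K. c k * g k i) = cnj (\<Sum>k\<in>K. c k * sesq n h (g k) f)"
    unfolding sesq_adjoint[OF assms, of f] sesq_sum_left by (rule refl)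
  also have "\<dots> = (\<Sum>k\<in>K. cnj (c k) * sesq n h f (g k))"
    by (simp flip: sesq_adjoint[OF assms])
  finally show ?thesis .
qed

lemma sesq_add_left: "sesq n h (\<lambda>i. f i + c * f' i) g = sesq n h f g + c * sesq n h f' g"
  by (simp add: sesq_def algebra_simps sum.distrib sum_distrib_left)

lemma sesq_add_right: "sesq n h f (\<lambda>i. g i + c * g' i) = sesq n h f g + cnj c * sesq n h f g'"
  by (simp add: sesq_def algebra_simps sum.distrib sum_distrib_left)

lemma sesq_unit_vectors:
  assumes "i < n" "j < n"
  shows "sesq n h (\<lambda>k. of_bool (k = j)) (\<lambda>k. of_bool (k = i)) = h i j"
proof -
  have "sesq n h (\<lambda>k. of_bool (k = j)) (\<lambda>k. of_bool (k = i))
      = (\<Sum>k<n. if k = i then \<Sum>l<n. if l = j then h k l else 0 else 0)"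
    unfolding sesq_def by (intro sum.cong refl) (auto intro!: sum.cong)
  then show ?thesis using assms by simp
qed

text \<open>
  Degenerate case of the Cauchy-Schwarz inequality: otherwise a large multiple of \<open>f\<close>, rotated by a suitable phase,
  could be added to \<open>g\<close> to make the form negative.
\<close>

lemma sesq_null_vector:
  assumes h: "hermitian n h" "pos_form n h" and f: "Re (sesq n h f f) = 0"
  shows "sesq n h f g = 0"
proof (rule ccontr)
  define z where "z = sesq n h f g"
  assume "sesq n h f g \<noteq> 0"
  then have z: "0 < (cmod z)\<^sup>2" by (simp add: z_def)
  define t where "t = (Re (sesq n h g g) + 1) / (2 * (cmod z)\<^sup>2)"
  define c where "c = - of_real t * cnj z"
  have zz: "z * cnj z = of_real ((cmod z)\<^sup>2)" by (simp add: complex_norm_square del: of_real_power)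
  have "sesq n h (\<lambda>i. g i + c * f i) (\<lambda>i. g i + c * f i)
      = sesq n h g g + cnj c * cnj z + (c * z + c * cnj c * sesq n h f f)"
    by (simp add: sesq_add_left sesq_add_right sesq_adjoint[OF h(1), of g f] z_def algebra_simps)
  moreover have "c * z = of_real (- t * (cmod z)\<^sup>2)" "cnj c * cnj z = of_real (- t * (cmod z)\<^sup>2)"
    using zz by (simp_all add: c_def mult.commute mult.left_commute)
  moreover have "Re (c * cnj c * sesq n h f f) = 0"
    using f by (simp only: complex_mult_cnj Re_complex_of_real) (simp add: complex_mult_cnj)
  ultimately have "Re (sesq n h (\<lambda>i. g i + c * f i) (\<lambda>i. g i + c * f i))
      = Re (sesq n h g g) - 2 * (t * (cmod z)\<^sup>2)"
    by simp
  also have "\<dots> < 0" using z by (simp add: t_def)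
  finally show False using h(2) by (simp add: pos_form_def not_less[symmetric])
qed

text \<open>
  Polarisation: every vector is a null vector of the form, hence orthogonal to all others.
\<close>

lemma hermitian_form_zero:
  assumes "hermitian n h" "\<And>f. Re (sesq n h f f) = 0" "i < n" "j < n"
  shows "h i j = 0"
  using sesq_null_vector[OF assms(1) _ assms(2), of "\<lambda>k. of_bool (k = j)" "\<lambda>k. of_bool (k = i)"]
    sesq_unit_vectors[OF assms(3,4), of h] assms(2) by (simp add: pos_form_def)


section \<open>Matrices through their entries\<close>

abbreviation entries :: "complex mat \<Rightarrow> nat \<Rightarrow> nat \<Rightarrow> complex" where
  "entries A \<equiv> (\<lambda>i j. A $$ (i, j))"

lemma mat_adjoint_index:
  "i < dim_col A \<Longrightarrow> j < dim_row A \<Longrightarrow> mat_adjoint A $$ (i, j) = cnj (A $$ (j, i))"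
  for A :: "complex mat"
  by (simp add: mat_adjoint_def mat_of_rows_index cols_def)

lemma mat_adjoint_carrier: "A \<in> carrier_mat n m \<Longrightarrow> mat_adjoint A \<in> carrier_mat m n"
  for A :: "complex mat"
  by (rule carrier_matI) (auto simp: mat_adjoint_def)

lemma Her_iff: "A \<in> Her n \<longleftrightarrow> A \<in> carrier_mat n n \<and> hermitian n (entries A)"
proof -
  have "mat_adjoint A = A \<longleftrightarrow> hermitian n (entries A)" if A: "A \<in> carrier_mat n n"
  proof
    assume "mat_adjoint A = A"
    then show "hermitian n (entries A)"
      using A by (intro hermitianI) (metis carrier_matD mat_adjoint_index)
  next
    assume "hermitian n (entries A)"
    then show "mat_adjoint A = A"
      using A mat_adjoint_carrier[OF A] by (intro eq_matI) (auto simp: mat_adjoint_index hermitianD[of n "entries A"])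
  qed
  then show ?thesis by (auto simp: Her_def)
qed

lemma quad_form_sesq:
  assumes "A \<in> carrier_mat n n" "v \<in> carrier_vec n"
  shows "quad_form A v = Re (sesq n (entries A) (($) v) (($) v))"
proof -
  have "(A *\<^sub>v v) \<bullet>c v = sesq n (entries A) (($) v) (($) v)"
    using assms by (simp add: sesq_def scalar_prod_def lessThan_atLeast0 sum_distrib_right)
  then show ?thesis by (simp add: quad_form_def)
qed

lemma psd_iff:
  "psd n A \<longleftrightarrow> A \<in> carrier_mat n n \<and> hermitian n (entries A) \<and> pos_form n (entries A)"
proof -
  have "(\<forall>v\<in>carrier_vec n. 0 \<le> quad_form A v) \<longleftrightarrow> pos_form n (entries A)"
    if A: "A \<in> carrier_mat n n"
  proof
    assume L: "\<forall>v\<in>carrier_vec n. 0 \<le> quad_form A v"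
    show "pos_form n (entries A)"
      unfolding pos_form_def
    proof
      fix f
      have "sesq n (entries A) f f = sesq n (entries A) (($) (vec n f)) (($) (vec n f))"
        by (rule sesq_cong) auto
      then show "0 \<le> Re (sesq n (entries A) f f)"
        using L[rule_format, of "vec n f"] quad_form_sesq[OF A, of "vec n f"] by simp
    qed
  qed (use A in \<open>simp add: pos_form_def quad_form_sesq\<close>)
  then show ?thesis by (auto simp: psd_def Her_iff)
qed

lemma mat_sum_carrier:
  "(\<And>B. B \<in> set Bs \<Longrightarrow> B \<in> carrier_mat n n) \<Longrightarrow> mat_sum n Bs \<in> carrier_mat n n"
  by (induction Bs) (auto simp: mat_sum_def)

lemma mat_sum_index:
  assumes "\<And>B. B \<in> set Bs \<Longrightarrow> B \<in> carrier_mat n n" "i < n" "j < n"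
  shows "mat_sum n Bs $$ (i, j) = (\<Sum>k<length Bs. (Bs ! k) $$ (i, j))"
  using assms(1)
proof (induction Bs)
  case (Cons B Bs)
  have "mat_sum n Bs \<in> carrier_mat n n" using Cons.prems by (intro mat_sum_carrier) auto
  then show ?case
    using Cons assms(2,3) by (simp add: mat_sum_def sum.lessThan_Suc_shift del: sum.lessThan_Suc)
qed (use assms(2,3) in \<open>simp add: mat_sum_def\<close>)

lemma HerT_nth: "A \<in> HerT d s \<Longrightarrow> k < d \<Longrightarrow> A ! k \<in> Her s"
  by (auto simp: HerT_def)

lemma HerT_carrier: "A \<in> HerT d s \<Longrightarrow> k < d \<Longrightarrow> A ! k \<in> carrier_mat s s"
  using HerT_nth Her_iff by blast

lemma HerT_hermitian: "A \<in> HerT d s \<Longrightarrow> k < d \<Longrightarrow> hermitian s (entries (A ! k))"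
  using HerT_nth Her_iff by blast

lemma HerT_length: "A \<in> HerT d s \<Longrightarrow> length A = d"
  by (simp add: HerT_def)

lemma HerT_I: "length A = d \<Longrightarrow> (\<And>k. k < d \<Longrightarrow> A ! k \<in> Her s) \<Longrightarrow> A \<in> HerT d s"
  by (auto simp: HerT_def in_set_conv_nth)

lemma pencil_carrier:
  assumes "M \<in> HerT d r" "a \<in> carrier_vec d"
  shows "pencil r M a \<in> carrier_mat r r"
  unfolding pencil_def
  by (rule mat_sum_carrier)
    (use assms HerT_length[OF assms(1)] HerT_carrier[OF assms(1)] in \<open>auto simp: set_zip\<close>)

lemma pencil_index:
  assumes M: "M \<in> HerT d r" and a: "a \<in> carrier_vec d" and ij: "i < r" "j < r"
  shows "pencil r M a $$ (i, j) = (\<Sum>k<d. of_real (a $ k) * (M ! k) $$ (i, j))"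
proof -
  have "pencil r M a $$ (i, j)
      = (\<Sum>k<length (map2 (\<lambda>c B. complex_of_real c \<cdot>\<^sub>m B) (list_of_vec a) M).
          (map2 (\<lambda>c B. complex_of_real c \<cdot>\<^sub>m B) (list_of_vec a) M ! k) $$ (i, j))"
    unfolding pencil_def
    by (rule mat_sum_index)
      (use assms HerT_length[OF M] HerT_carrier[OF M] in \<open>auto simp: set_zip\<close>)
  also have "\<dots> = (\<Sum>k<d. of_real (a $ k) * (M ! k) $$ (i, j))"
  proof (rule sum.cong)
    fix k assume "k \<in> {..<d}"
    then show "(map2 (\<lambda>c B. complex_of_real c \<cdot>\<^sub>m B) (list_of_vec a) M ! k) $$ (i, j)
        = of_real (a $ k) * (M ! k) $$ (i, j)"
      using a ij HerT_carrier[OF M, of k] HerT_length[OF M] by (simp add: list_of_vec_index)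
  qed (use a HerT_length[OF M] in auto)
  finally show ?thesis .
qed

lemma psd_pencil_iff:
  assumes M: "M \<in> HerT d r" and a: "a \<in> carrier_vec d"
  shows "psd r (pencil r M a) \<longleftrightarrow> pos_form r (\<lambda>i j. \<Sum>k<d. of_real (a $ k) * (M ! k) $$ (i, j))"
proof -
  have "hermitian r (entries (pencil r M a))"
    by (intro hermitianI)
      (auto simp: pencil_index[OF M a] hermitianD[OF HerT_hermitian[OF M]] intro!: sum.cong)
  moreover have "sesq r (entries (pencil r M a)) f f
      = sesq r (\<lambda>i j. \<Sum>k<d. of_real (a $ k) * (M ! k) $$ (i, j)) f f" for f
    by (rule sesq_cong) (simp_all add: pencil_index[OF M a])
  ultimately show ?thesis by (simp add: psd_iff pencil_carrier[OF M a] pos_form_def)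
qed

text \<open>
  The value of the form \<open>\<Sum> A_k \<otimes> M_k\<close> at the tensor with components \<open>f p a\<close>. Working with two indices keeps
  the flattened index \<open>p * r + a\<close> of the Kronecker product out of all later arguments.
\<close>

definition tensor_form ::
  "nat \<Rightarrow> nat \<Rightarrow> nat \<Rightarrow> mat_tuple \<Rightarrow> mat_tuple \<Rightarrow> (nat \<Rightarrow> nat \<Rightarrow> complex) \<Rightarrow> complex" where
  "tensor_form n s r A M f =
     (\<Sum>k<n. \<Sum>a<r. \<Sum>b<r. (M ! k) $$ (a, b) * sesq s (entries (A ! k)) (\<lambda>q. f q b) (\<lambda>p. f p a))"

lemma sum_div_mod: "(\<Sum>i<s * r. g (i div r) (i mod r)) = (\<Sum>p<s. \<Sum>a<r. g p a)"
  for g :: "nat \<Rightarrow> nat \<Rightarrow> 'a::comm_monoid_add"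
proof -
  have "(\<Sum>p<s. \<Sum>a<r. g p a) = (\<Sum>p<s. \<Sum>i\<in>{p * r..<p * r + r}. g (i div r) (i mod r))"
  proof (rule sum.cong[OF refl])
    fix p
    show "(\<Sum>a<r. g p a) = (\<Sum>i\<in>{p * r..<p * r + r}. g (i div r) (i mod r))"
      by (rule sum.reindex_bij_witness[of _ "\<lambda>i. i - p * r" "\<lambda>a. p * r + a"]) auto
  qed
  also have "\<dots> = (\<Sum>i<s * r. g (i div r) (i mod r))" by (rule sum.nat_group)
  finally show ?thesis by simp
qed

definition kron_form :: "nat \<Rightarrow> nat \<Rightarrow> mat_tuple \<Rightarrow> mat_tuple \<Rightarrow> nat \<Rightarrow> nat \<Rightarrow> complex" where
  "kron_form n r A M i j = (\<Sum>k<n. (A ! k) $$ (i div r, j div r) * (M ! k) $$ (i mod r, j mod r))"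

lemma div_mod_less: "i < s * r \<Longrightarrow> i div r < s" "i < s * r \<Longrightarrow> i mod r < r" for i s r :: nat
  by (simp_all add: less_mult_imp_div_less) (metis gr0I mod_less_divisor mult_0_right not_less_zero)

lemma kron_form_hermitian:
  assumes A: "A \<in> HerT n s" and M: "M \<in> HerT n r"
  shows "hermitian (s * r) (kron_form n r A M)"
  by (intro hermitianI)
    (auto simp: kron_form_def div_mod_less hermitianD[OF HerT_hermitian[OF A]]
      hermitianD[OF HerT_hermitian[OF M]] intro!: sum.cong)

lemma sesq_kron_form:
  "sesq (s * r) (kron_form n r A M) (\<lambda>i. f (i div r) (i mod r)) (\<lambda>i. f (i div r) (i mod r))
    = tensor_form n s r A M f"
proof -
  define T where "T = (\<lambda>k p a q b. (A ! k) $$ (p, q) * (M ! k) $$ (a, b) * f q b * cnj (f p a))"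
  have "sesq (s * r) (kron_form n r A M) (\<lambda>i. f (i div r) (i mod r)) (\<lambda>i. f (i div r) (i mod r))
      = (\<Sum>i<s * r. \<Sum>j<s * r. \<Sum>k<n. T k (i div r) (i mod r) (j div r) (j mod r))"
    unfolding sesq_def T_def by (intro sum.cong refl) (simp add: kron_form_def sum_distrib_right)
  also have "\<dots> = (\<Sum>p<s. \<Sum>a<r. \<Sum>q<s. \<Sum>b<r. \<Sum>k<n. T k p a q b)"
    by (simp only: sum_div_mod[of "\<lambda>q b. \<Sum>k<n. T k _ _ q b"]
        sum_div_mod[of "\<lambda>p a. \<Sum>q<s. \<Sum>b<r. \<Sum>k<n. T k p a q b"])
  also have "\<dots> = (\<Sum>k<n. \<Sum>p<s. \<Sum>a<r. \<Sum>q<s. \<Sum>b<r. T k p a q b)"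
    by (simp only: sum.swap[of _ "{..<n}"])
  also have "\<dots> = (\<Sum>k<n. \<Sum>a<r. \<Sum>b<r. \<Sum>p<s. \<Sum>q<s. T k p a q b)"
  proof (rule sum.cong[OF refl])
    fix k
    have "(\<Sum>p<s. \<Sum>a<r. \<Sum>q<s. \<Sum>b<r. T k p a q b) = (\<Sum>p<s. \<Sum>a<r. \<Sum>b<r. \<Sum>q<s. T k p a q b)"
      by (rule sum.cong[OF refl], rule sum.cong[OF refl], rule sum.swap)
    also have "\<dots> = (\<Sum>a<r. \<Sum>p<s. \<Sum>b<r. \<Sum>q<s. T k p a q b)" by (rule sum.swap)
    also have "\<dots> = (\<Sum>a<r. \<Sum>b<r. \<Sum>p<s. \<Sum>q<s. T k p a q b)"
      by (rule sum.cong[OF refl], rule sum.swap)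
    finally show "(\<Sum>p<s. \<Sum>a<r. \<Sum>q<s. \<Sum>b<r. T k p a q b) = (\<Sum>a<r. \<Sum>b<r. \<Sum>p<s. \<Sum>q<s. T k p a q b)" .
  qed
  also have "\<dots> = tensor_form n s r A M f"
    by (simp add: tensor_form_def sesq_def T_def sum_distrib_left mult_ac)
  finally show ?thesis .
qed

lemma psd_kron_iff:
  assumes A: "A \<in> HerT n s" and M: "M \<in> HerT n r"
  shows "psd (s * r) (mat_sum (s * r) (map2 kron A M)) \<longleftrightarrow> (\<forall>f. 0 \<le> Re (tensor_form n s r A M f))"
proof -
  let ?K = "mat_sum (s * r) (map2 kron A M)"
  have carr: "B \<in> carrier_mat (s * r) (s * r)" if BK: "B \<in> set (map2 kron A M)" for B
  proof -
    obtain k where k: "k < n" "B = kron (A ! k) (M ! k)"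
      using in_set_conv_nth[THEN iffD1, OF BK] HerT_length[OF A] HerT_length[OF M] by auto
    then show ?thesis
      using HerT_carrier[OF A k(1)] HerT_carrier[OF M k(1)] by (simp add: kron_def)
  qed
  have idx: "?K $$ (i, j) = kron_form n r A M i j" if "i < s * r" "j < s * r" for i j
  proof -
    have "?K $$ (i, j) = (\<Sum>k<length (map2 kron A M). (map2 kron A M ! k) $$ (i, j))"
      by (rule mat_sum_index) (use carr that in auto)
    also have "\<dots> = kron_form n r A M i j"
      unfolding kron_form_def
    proof (rule sum.cong)
      fix k assume "k \<in> {..<n}"
      then show "(map2 kron A M ! k) $$ (i, j) = (A ! k) $$ (i div r, j div r) * (M ! k) $$ (i mod r, j mod r)"
        using that HerT_carrier[OF A, of k] HerT_carrier[OF M, of k] HerT_length[OF A] HerT_length[OF M]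
        by (simp add: kron_def)
    qed (use HerT_length[OF A] HerT_length[OF M] in auto)
    finally show ?thesis .
  qed
  have herm: "hermitian (s * r) (entries ?K)"
    by (intro hermitianI) (simp add: idx hermitianD[OF kron_form_hermitian[OF A M]])
  have form: "sesq (s * r) (entries ?K) f f = sesq (s * r) (kron_form n r A M) f f" for f
    by (rule sesq_cong) (simp_all add: idx)
  have "pos_form (s * r) (entries ?K) \<longleftrightarrow> (\<forall>f. 0 \<le> Re (tensor_form n s r A M f))"
  proof
    assume "pos_form (s * r) (entries ?K)"
    then show "\<forall>f. 0 \<le> Re (tensor_form n s r A M f)"
      unfolding sesq_kron_form[symmetric] by (simp add: pos_form_def form)
  next
    assume R: "\<forall>f. 0 \<le> Re (tensor_form n s r A M f)"
    show "pos_form (s * r) (entries ?K)"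
      unfolding pos_form_def form
    proof
      fix f :: "nat \<Rightarrow> complex"
      have "sesq (s * r) (kron_form n r A M) f f = tensor_form n s r A M (\<lambda>p a. f (p * r + a))"
        using sesq_kron_form[of s r n A M "\<lambda>p a. f (p * r + a)"] by simp
      then show "0 \<le> Re (sesq (s * r) (kron_form n r A M) f f)" using R by simp
    qed
  qed
  moreover have "?K \<in> carrier_mat (s * r) (s * r)"
    by (rule mat_sum_carrier) (rule carr)
  ultimately show ?thesis using herm by (simp add: psd_iff)
qed

lemma compress_index:
  assumes B: "B \<in> carrier_mat s s" and V: "V \<in> carrier_mat s t" and ij: "i < t" "j < t"
  shows "(mat_adjoint V * B * V) $$ (i, j)
    = (\<Sum>p<s. \<Sum>q<s. cnj (V $$ (p, i)) * B $$ (p, q) * V $$ (q, j))"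
proof -
  have V': "mat_adjoint V \<in> carrier_mat t s" by (rule mat_adjoint_carrier[OF V])
  have VB: "mat_adjoint V * B \<in> carrier_mat t s" using V' B by (rule mult_carrier_mat)
  have inner: "(mat_adjoint V * B) $$ (i, q) = (\<Sum>p<s. cnj (V $$ (p, i)) * B $$ (p, q))" if "q < s" for q
    using V' B V ij that by (simp add: scalar_prod_def lessThan_atLeast0 mat_adjoint_index)
  have "(mat_adjoint V * B * V) $$ (i, j) = row (mat_adjoint V * B) i \<bullet> col V j"
    using VB V ij by (intro index_mult_mat) auto
  also have "\<dots> = (\<Sum>q<s. (mat_adjoint V * B) $$ (i, q) * V $$ (q, j))"
    using VB V ij by (simp add: scalar_prod_def lessThan_atLeast0 del: index_mult_mat)
  also have "\<dots> = (\<Sum>q<s. (\<Sum>p<s. cnj (V $$ (p, i)) * B $$ (p, q)) * V $$ (q, j))"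
    by (simp add: inner)
  also have "\<dots> = (\<Sum>q<s. \<Sum>p<s. cnj (V $$ (p, i)) * B $$ (p, q) * V $$ (q, j))"
    by (simp add: sum_distrib_right)
  also have "\<dots> = (\<Sum>p<s. \<Sum>q<s. cnj (V $$ (p, i)) * B $$ (p, q) * V $$ (q, j))"
    by (rule sum.swap)
  finally show ?thesis .
qed

lemma compress_carrier:
  fixes B V :: "complex mat"
  assumes "B \<in> carrier_mat s s" "V \<in> carrier_mat s t"
  shows "mat_adjoint V * B * V \<in> carrier_mat t t"
  using assms mat_adjoint_carrier[OF assms(2)] by simp

lemma sesq_compress:
  assumes B: "B \<in> carrier_mat s s" and V: "V \<in> carrier_mat s t"
  shows "sesq t (entries (mat_adjoint V * B * V)) f g
    = sesq s (entries B) (\<lambda>p. \<Sum>i<t. V $$ (p, i) * f i) (\<lambda>p. \<Sum>i<t. V $$ (p, i) * g i)"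
proof -
  have "sesq t (entries (mat_adjoint V * B * V)) f g
      = (\<Sum>i<t. \<Sum>j<t. \<Sum>p<s. \<Sum>q<s. cnj (V $$ (p, i)) * B $$ (p, q) * V $$ (q, j) * f j * cnj (g i))"
    unfolding sesq_def by (intro sum.cong refl) (simp add: compress_index[OF B V] sum_distrib_right)
  also have "\<dots> = (\<Sum>p<s. \<Sum>q<s. \<Sum>i<t. \<Sum>j<t. cnj (V $$ (p, i)) * B $$ (p, q) * V $$ (q, j) * f j * cnj (g i))"
    by (simp only: sum.swap[of _ "{..<s}" "{..<t}"])
  also have "\<dots> = sesq s (entries B) (\<lambda>p. \<Sum>i<t. V $$ (p, i) * f i) (\<lambda>p. \<Sum>i<t. V $$ (p, i) * g i)"
    unfolding sesq_def
    by (subst sum.swap[of _ "{..<t}" "{..<t}"])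
      (simp add: sum_distrib_left sum_distrib_right mult_ac)
  finally show ?thesis .
qed

lemma compress_hermitian:
  assumes B: "B \<in> Her s" and V: "V \<in> carrier_mat s t"
  shows "mat_adjoint V * B * V \<in> Her t"
proof -
  have Bc: "B \<in> carrier_mat s s" and h: "hermitian s (entries B)" using B by (auto simp: Her_iff)
  have "cnj ((mat_adjoint V * B * V) $$ (i, j)) = (mat_adjoint V * B * V) $$ (j, i)"
    if "i < t" "j < t" for i j
  proof -
    have "(mat_adjoint V * B * V) $$ (j, i) 
       = (\<Sum>q<s. \<Sum>p<s. cnj (V $$ (p, j)) * B $$ (p, q) * V $$ (q, i))"
      unfolding compress_index[OF Bc V that(2,1)] by (rule sum.swap)
    also have "\<dots> = (\<Sum>q<s. \<Sum>p<s. cnj (cnj (V $$ (q, i)) * B $$ (q, p) * V $$ (p, j)))"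
      by (intro sum.cong refl) (simp add: hermitianD[OF h])
    finally show ?thesis by (simp add: compress_index[OF Bc V that])
  qed
  then show ?thesis using compress_carrier[OF Bc V] by (simp add: Her_iff hermitianI)
qed

lemma compress_HerT:
  assumes "A \<in> HerT d s" "V \<in> carrier_mat s t"
  shows "compress V A \<in> HerT d t"
  using assms by (auto simp: HerT_def compress_def compress_hermitian)

lemma tuple_add_nth:
  assumes "A \<in> HerT d s" "B \<in> HerT d s" "k < d" "i < s" "j < s"
  shows "(tuple_add A B ! k) $$ (i, j) = (A ! k) $$ (i, j) + (B ! k) $$ (i, j)"
  using assms HerT_carrier[OF assms(1,3)] HerT_carrier[OF assms(2,3)]
  by (simp add: tuple_add_def HerT_length)

lemma tuple_add_HerT:
  assumes A: "A \<in> HerT d s" and B: "B \<in> HerT d s"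
  shows "tuple_add A B \<in> HerT d s"
proof (rule HerT_I)
  show "length (tuple_add A B) = d" using A B by (simp add: tuple_add_def HerT_length)
  fix k assume k: "k < d"
  have "tuple_add A B ! k = A ! k + B ! k" using A B k by (simp add: tuple_add_def HerT_length)
  then show "tuple_add A B ! k \<in> Her s"
    using HerT_nth[OF A k] HerT_nth[OF B k] by (auto simp: Her_iff hermitianD[of s "entries _"] intro!: hermitianI)
qed

lemma tuple_scale_nth:
  assumes "A \<in> HerT d s" "k < d" "i < s" "j < s"
  shows "(tuple_scale c A ! k) $$ (i, j) = of_real c * (A ! k) $$ (i, j)"
  using assms HerT_carrier[OF assms(1,2)] by (simp add: tuple_scale_def HerT_length)

lemma tuple_scale_HerT:
  assumes A: "A \<in> HerT d s"
  shows "tuple_scale c A \<in> HerT d s"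
proof (rule HerT_I)
  show "length (tuple_scale c A) = d" using A by (simp add: tuple_scale_def HerT_length)
  fix k assume k: "k < d"
  have "tuple_scale c A ! k = of_real c \<cdot>\<^sub>m (A ! k)" using A k by (simp add: tuple_scale_def HerT_length)
  then show "tuple_scale c A ! k \<in> Her s"
    using HerT_nth[OF A k] by (auto simp: Her_iff hermitianD[of s "entries _"] intro!: hermitianI)
qed

lemma HerT_eqI:
  assumes "A \<in> HerT d s" "B \<in> HerT d s"
    and "\<And>k i j. k < d \<Longrightarrow> i < s \<Longrightarrow> j < s \<Longrightarrow> (A ! k) $$ (i, j) = (B ! k) $$ (i, j)"
  shows "A = B"
proof (rule nth_equalityI)
  show "length A = length B" using assms by (simp add: HerT_length)
  fix k assume "k < length A"
  then have k: "k < d" using assms(1) by (simp add: HerT_length)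
  show "A ! k = B ! k"
    using HerT_carrier[OF assms(1) k] HerT_carrier[OF assms(2) k] assms(3)[OF k]
    by (intro eq_matI) auto
qed

section \<open>A real basis of the Hermitian matrices\<close>

text \<open>
  The matrices \<open>F_ab = ((1 + i) E_ab + (1 - i) E_ba) / 2\<close>, one for every pair of indices, form an
  orthonormal basis of the Hermitian matrices for the trace form; the coordinate of \<open>h\<close> at
  \<open>F_ab\<close> is \<open>Re h_ab + Im h_ab\<close>. The uniform formula avoids a distinction between diagonal,
  symmetric and antisymmetric basis elements.
\<close>

definition herm_basis :: "nat \<Rightarrow> nat \<Rightarrow> nat \<Rightarrow> nat \<Rightarrow> complex" where
  "herm_basis a b i j =
     (1 + \<i>) / 2 * (of_bool (i = a) * of_bool (j = b)) + (1 - \<i>) / 2 * (of_bool (i = b) * of_bool (j = a))"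

lemma cnj_of_bool [simp]: "cnj (of_bool P) = of_bool P"
  by (cases P) simp_all

lemma cnj_herm_basis: "cnj (herm_basis a b i j) = herm_basis a b j i"
  by (simp add: herm_basis_def)

lemma sum_of_bool_pair:
  fixes y :: "nat \<Rightarrow> nat \<Rightarrow> complex"
  assumes "i < s" "j < s"
  shows "(\<Sum>a<s. \<Sum>b<s. y a b * (of_bool (i = a) * of_bool (j = b))) = y i j"
proof -
  have "(\<Sum>a<s. \<Sum>b<s. y a b * (of_bool (i = a) * of_bool (j = b)))
      = (\<Sum>a<s. if a = i then \<Sum>b<s. if b = j then y a b else 0 else 0)"
    by (intro sum.cong refl) (auto intro!: sum.cong)
  then show ?thesis using assms by simp
qed

lemma sum_herm_basis:
  fixes y :: "nat \<Rightarrow> nat \<Rightarrow> complex"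
  assumes "i < s" "j < s"
  shows "(\<Sum>a<s. \<Sum>b<s. y a b * herm_basis a b i j) = (1 + \<i>) / 2 * y i j + (1 - \<i>) / 2 * y j i"
proof -
  have "(\<Sum>a<s. \<Sum>b<s. y a b * herm_basis a b i j)
      = (1 + \<i>) / 2 * (\<Sum>a<s. \<Sum>b<s. y a b * (of_bool (i = a) * of_bool (j = b)))
      + (1 - \<i>) / 2 * (\<Sum>a<s. \<Sum>b<s. y a b * (of_bool (j = a) * of_bool (i = b)))"
    unfolding sum_distrib_left sum.distrib[symmetric]
    by (intro sum.cong refl) (simp add: herm_basis_def algebra_simps)
  then show ?thesis by (simp add: sum_of_bool_pair[OF assms] sum_of_bool_pair[OF assms(2,1)])
qed

lemma hermitian_expansion:
  assumes "hermitian s h" "i < s" "j < s"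
  shows "h i j = (\<Sum>a<s. \<Sum>b<s. of_real (Re (h a b) + Im (h a b)) * herm_basis a b i j)"
proof -
  have "h j i = cnj (h i j)" using hermitianD[OF assms] by simp
  then show ?thesis
    unfolding sum_herm_basis[OF assms(2,3)] by (simp add: complex_eq_iff field_simps)
qed

text \<open>
  The form in which \<open>F_ab\<close> enters a cone: it is a difference of positive semidefinite matrices of
  rank one, with \<open>v = e_a + (1 - i)/2 e_b\<close>.
\<close>

definition basis_vec :: "nat \<Rightarrow> nat \<Rightarrow> nat \<Rightarrow> complex" where
  "basis_vec a b i = of_bool (i = a) + (1 - \<i>) / 2 * of_bool (i = b)"

lemma herm_basis_rank_one:
  "herm_basis a b i j = basis_vec a b i * cnj (basis_vec a b j)
     - of_bool (i = a) * of_bool (j = a) - 1 / 2 * (of_bool (i = b) * of_bool (j = b))"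
proof -
  have "(1 - \<i>) / 2 * ((1 + \<i>) / 2) = 1 / 2" by (simp add: field_simps)
  then show ?thesis
    by (simp add: herm_basis_def basis_vec_def algebra_simps)
qed


section \<open>Tuples of matrices given by their entries\<close>

definition tuple_of :: "nat \<Rightarrow> nat \<Rightarrow> (nat \<Rightarrow> nat \<Rightarrow> nat \<Rightarrow> complex) \<Rightarrow> mat_tuple" where
  "tuple_of d s F = map (\<lambda>k. Matrix.mat s s (\<lambda>(i, j). F k i j)) [0..<d]"

lemma tuple_of_nth: "k < d \<Longrightarrow> i < s \<Longrightarrow> j < s \<Longrightarrow> (tuple_of d s F ! k) $$ (i, j) = F k i j"
  by (simp add: tuple_of_def)

lemma tuple_of_HerT:
  assumes "\<And>k. k < d \<Longrightarrow> hermitian s (F k)"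
  shows "tuple_of d s F \<in> HerT d s"
proof (rule HerT_I)
  fix k assume k: "k < d"
  show "tuple_of d s F ! k \<in> Her s"
    using k hermitianD[OF assms[OF k]] by (auto simp: Her_iff tuple_of_def intro!: hermitianI)
qed (simp add: tuple_of_def)

lemma tuple_of_cong:
  "(\<And>k i j. k < d \<Longrightarrow> i < s \<Longrightarrow> j < s \<Longrightarrow> F k i j = G k i j) \<Longrightarrow> tuple_of d s F = tuple_of d s G"
  by (auto simp: tuple_of_def intro!: eq_matI)

lemma tuple_add_of: "tuple_add (tuple_of d s F) (tuple_of d s G) = tuple_of d s (\<lambda>k i j. F k i j + G k i j)"
  by (rule nth_equalityI) (auto simp: tuple_add_def tuple_of_def intro!: eq_matI)

lemma tuple_of_sum:
  assumes add: "\<And>A B. A \<in> S \<Longrightarrow> B \<in> S \<Longrightarrow> tuple_add A B \<in> S"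
    and zero: "tuple_of d s (\<lambda>_ _ _. 0) \<in> S"
    and "finite I" "\<And>x. x \<in> I \<Longrightarrow> tuple_of d s (F x) \<in> S"
  shows "tuple_of d s (\<lambda>k i j. \<Sum>x\<in>I. F x k i j) \<in> S"
  using assms(3,4)
proof (induction I rule: finite_induct)
  case (insert x I)
  then show ?case using add[of "tuple_of d s (F x)" "tuple_of d s (\<lambda>k i j. \<Sum>x\<in>I. F x k i j)"]
    by (simp add: tuple_add_of)
qed (use zero in simp)

lemma embed_nth: "a \<in> carrier_vec d \<Longrightarrow> k < d \<Longrightarrow> (embed a ! k) $$ (0, 0) = of_real (a $ k)"
  by (simp add: embed_def list_of_vec_index)

lemma embed_tuple_of:
  assumes "a \<in> carrier_vec d"
  shows "embed a = tuple_of d 1 (\<lambda>k _ _. of_real (a $ k))"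
  by (rule nth_equalityI)
    (use assms in \<open>auto simp: embed_def tuple_of_def list_of_vec_index intro!: eq_matI\<close>)

lemma embed_HerT: "a \<in> carrier_vec d \<Longrightarrow> embed a \<in> HerT d 1"
  by (subst embed_tuple_of, assumption) (intro tuple_of_HerT hermitianI, simp)

lemma tuple_add_embed:
  "a \<in> carrier_vec d \<Longrightarrow> b \<in> carrier_vec d \<Longrightarrow> tuple_add (embed a) (embed b) = embed (a + b)"
  by (rule HerT_eqI[of _ d 1])
    (simp_all add: tuple_add_HerT embed_HerT tuple_add_nth[of _ d 1] embed_nth[of _ d] del: One_nat_def)

lemma tuple_scale_embed: "a \<in> carrier_vec d \<Longrightarrow> tuple_scale c (embed a) = embed (c \<cdot>\<^sub>v a)"
  by (rule HerT_eqI[of _ d 1])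
    (simp_all add: tuple_scale_HerT embed_HerT tuple_scale_nth[of _ d 1] embed_nth[of _ d] del: One_nat_def)

lemma continuous_map_embed: "continuous_map (vec_topology d) (HerT_topology d 1) embed"
proof -
  let ?I = "{..<d} \<times> {..<1::nat} \<times> {..<1::nat}"
  let ?e = "\<lambda>A. \<lambda>(k, i, j)\<in>?I. ((A::mat_tuple) ! k) $$ (i, j)"
  have "continuous_map (vec_topology d) (product_topology (\<lambda>_. euclidean) ?I) (?e \<circ> embed)"
    unfolding continuous_map_componentwise
  proof (intro conjI ballI)
    fix x assume x: "x \<in> ?I"
    obtain k where k: "x = (k, 0, 0)" "k < d" using x by auto
    have "continuous_map (vec_topology d) euclidean (\<lambda>a. complex_of_real (a $ k))"
      using continuous_map_vec_index[OF k(2)]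
      by (auto simp: continuous_map_atin intro!: tendsto_of_real)
    then show "continuous_map (vec_topology d) euclidean (\<lambda>a. (?e \<circ> embed) a x)"
      by (rule continuous_map_eq) (use k in \<open>simp add: topspace_vec_topology embed_nth\<close>)
  qed auto
  then show ?thesis
    unfolding HerT_topology_def
    by (rule continuous_map_pullback') (auto simp: topspace_vec_topology embed_HerT simp del: One_nat_def)
qed

definition form_values :: "nat \<Rightarrow> nat \<Rightarrow> mat_tuple \<Rightarrow> (nat \<Rightarrow> complex) \<Rightarrow> real vec" where
  "form_values d s A f = vec d (\<lambda>k. Re (sesq s (entries (A ! k)) f f))"

lemma form_values_carrier [simp]: "form_values d s A f \<in> carrier_vec d"
  by (simp add: form_values_def)

lemma form_values_dim [simp]: "dim_vec (form_values d s A f) = d"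
  by (simp add: form_values_def)

lemma form_values_index: "k < d \<Longrightarrow> form_values d s A f $ k = Re (sesq s (entries (A ! k)) f f)"
  by (simp add: form_values_def)

lemma form_values_add:
  assumes "A \<in> HerT d s" "B \<in> HerT d s"
  shows "form_values d s (tuple_add A B) f = form_values d s A f + form_values d s B f"
proof (rule eq_vecI)
  fix k assume "k < dim_vec (form_values d s A f + form_values d s B f)"
  then have k: "k < d" by simp
  have "sesq s (entries (tuple_add A B ! k)) f f
      = sesq s (\<lambda>i j. entries (A ! k) i j + entries (B ! k) i j) f f"
    by (rule sesq_cong) (simp_all add: tuple_add_nth[OF assms k])
  also have "\<dots> = sesq s (entries (A ! k)) f f + sesq s (entries (B ! k)) f f"
    by (simp add: sesq_def algebra_simps sum.distrib)
  finally show "form_values d s (tuple_add A B) f $ k = (form_values d s A f + form_values d s B f) $ k"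
    using k by (simp add: form_values_index)
qed simp

lemma form_values_scale:
  assumes "A \<in> HerT d s"
  shows "form_values d s (tuple_scale c A) f = c \<cdot>\<^sub>v form_values d s A f"
proof (rule eq_vecI)
  fix k assume "k < dim_vec (c \<cdot>\<^sub>v form_values d s A f)"
  then have k: "k < d" by simp
  have "sesq s (entries (tuple_scale c A ! k)) f f
      = sesq s (\<lambda>i j. of_real c * entries (A ! k) i j) f f"
    by (rule sesq_cong) (simp_all add: tuple_scale_nth[OF assms k])
  also have "\<dots> = of_real c * sesq s (entries (A ! k)) f f"
    by (simp add: sesq_def algebra_simps sum_distrib_left)
  finally show "form_values d s (tuple_scale c A) f $ k = (c \<cdot>\<^sub>v form_values d s A f) $ k"
    using k by (simp add: form_values_index)
qed simp

lemma form_values_compress: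
  assumes "A \<in> HerT d s" "V \<in> carrier_mat s t"
  shows "form_values d t (compress V A) f = form_values d s A (\<lambda>p. \<Sum>i<t. V $$ (p, i) * f i)"
proof (rule eq_vecI)
  fix k assume "k < dim_vec (form_values d s A (\<lambda>p. \<Sum>i<t. V $$ (p, i) * f i))"
  then have k: "k < d" by simp
  then have "compress V A ! k = mat_adjoint V * A ! k * V"
    using assms(1) by (simp add: compress_def HerT_length)
  then show "form_values d t (compress V A) f $ k
      = form_values d s A (\<lambda>p. \<Sum>i<t. V $$ (p, i) * f i) $ k"
    using k by (simp add: form_values_index sesq_compress[OF HerT_carrier[OF assms(1) k] assms(2)])
qed simp

lemma largest_system_iff:
  "A \<in> largest_system d C s \<longleftrightarrow> A \<in> HerT d s \<and> (\<forall>f. form_values d s A f \<in> C)"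
proof -
  have eq: "vec_of_list (map (\<lambda>B. quad_form B v) A) = form_values d s A (($) v)"
    if "A \<in> HerT d s" "v \<in> carrier_vec s" for v
    using that HerT_length[OF that(1)] HerT_carrier[OF that(1)]
    by (intro eq_vecI) (auto simp: form_values_index quad_form_sesq vec_of_list_index simp del: vec_of_list_map)
  have vec: "form_values d s A f = form_values d s A (($) (vec s f))" for f
    unfolding form_values_def by (intro eq_vecI) (auto intro!: arg_cong[of _ _ Re] sesq_cong)
  show ?thesis
  proof
    assume A: "A \<in> largest_system d C s"
    then have H: "A \<in> HerT d s" by (simp add: largest_system_def)
    have "form_values d s A (($) v) \<in> C" if "v \<in> carrier_vec s" for v
      using A that unfolding largest_system_def eq[OF H that, symmetric] by blast
    then have "form_values d s A f \<in> C" for f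
      by (subst vec) simp
    then show "A \<in> HerT d s \<and> (\<forall>f. form_values d s A f \<in> C)" using H by blast
  next
    assume "A \<in> HerT d s \<and> (\<forall>f. form_values d s A f \<in> C)"
    then show "A \<in> largest_system d C s"
      unfolding largest_system_def by (simp add: eq del: vec_of_list_map)
  qed
qed

lemma compress_to_level_one:
  assumes A: "A \<in> HerT d s"
  shows "compress (Matrix.mat s 1 (\<lambda>(i, _). f i)) A = embed (form_values d s A f)"
proof (rule HerT_eqI[of _ d 1])
  let ?V = "Matrix.mat s 1 (\<lambda>(i, _). f i)"
  have V: "?V \<in> carrier_mat s 1" by simp
  show "compress ?V A \<in> HerT d 1" by (rule compress_HerT[OF A V])
  show "embed (form_values d s A f) \<in> HerT d 1" by (rule embed_HerT) simp
  fix k i j :: nat assume k: "k < d" and "i < 1" "j < 1"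
  then have ij: "i = 0" "j = 0" by auto
  have "(compress ?V A ! k) $$ (0, 0) = sesq s (entries (A ! k)) f f"
    using compress_index[OF HerT_carrier[OF A k] V, of 0 0] k A
    by (simp add: compress_def HerT_length sesq_def mult_ac)
  moreover have "Im (sesq s (entries (A ! k)) f f) = 0"
    using sesq_adjoint[OF HerT_hermitian[OF A k], of f f] by (metis cnj.simps(2) neg_equal_zero)
  ultimately show "(compress ?V A ! k) $$ (i, j) = (embed (form_values d s A f) ! k) $$ (i, j)"
    using k by (simp add: ij embed_nth[of _ d] form_values_index complex_eq_iff)
qed

lemma compress_from_level_one:
  assumes a: "a \<in> carrier_vec d"
  shows "compress (Matrix.mat 1 s (\<lambda>(_, i). cnj (f i))) (embed a)
    = tuple_of d s (\<lambda>k i j. of_real (a $ k) * (f i * cnj (f j)))"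
proof (rule HerT_eqI[of _ d s])
  let ?V = "Matrix.mat 1 s (\<lambda>(_, i). cnj (f i))"
  have V: "?V \<in> carrier_mat 1 s" by simp
  show "compress ?V (embed a) \<in> HerT d s" by (rule compress_HerT[OF embed_HerT[OF a] V])
  show "tuple_of d s (\<lambda>k i j. of_real (a $ k) * (f i * cnj (f j))) \<in> HerT d s"
    by (intro tuple_of_HerT hermitianI) (simp add: mult_ac)
  fix k i j assume k: "k < d" and ij: "i < s" "j < s"
  show "(compress ?V (embed a) ! k) $$ (i, j)
      = (tuple_of d s (\<lambda>k i j. of_real (a $ k) * (f i * cnj (f j))) ! k) $$ (i, j)"
    using compress_index[OF HerT_carrier[OF embed_HerT[OF a] k] V ij] k a ij
    by (simp add: compress_def HerT_length[OF embed_HerT[OF a]] embed_nth tuple_of_nth mult_ac)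
qed


section \<open>The largest operator system\<close>

lemma proper_coneD:
  assumes "proper_cone d C"
  shows proper_cone_closed: "closedin (vec_topology d) C"
    and proper_cone_carrier: "C \<subseteq> carrier_vec d"
    and proper_cone_add: "\<And>x y. x \<in> C \<Longrightarrow> y \<in> C \<Longrightarrow> x + y \<in> C"
    and proper_cone_scale: "\<And>x c. x \<in> C \<Longrightarrow> 0 \<le> c \<Longrightarrow> c \<cdot>\<^sub>v x \<in> C"
    and proper_cone_zero: "0\<^sub>v d \<in> C"
proof -
  note P = assms[unfolded proper_cone_def proper_cone_in_def]
  show "closedin (vec_topology d) C" using P by blast
  then show sub: "C \<subseteq> carrier_vec d" using closedin_subset topspace_vec_topology by blast
  show "\<And>x y. x \<in> C \<Longrightarrow> y \<in> C \<Longrightarrow> x + y \<in> C" using P by blast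
  show scale: "\<And>x c. x \<in> C \<Longrightarrow> 0 \<le> c \<Longrightarrow> c \<cdot>\<^sub>v x \<in> C" using P by blast
  obtain x where x: "x \<in> C" using P interior_of_subset by fastforce
  then have "0 \<cdot>\<^sub>v x = 0\<^sub>v d" using sub by (intro eq_vecI) auto
  then show "0\<^sub>v d \<in> C" using scale[OF x, of 0] by simp
qed

lemma proper_cone_no_line:
  assumes C: "proper_cone d C" and xy: "x \<in> carrier_vec d" "y \<in> carrier_vec d"
    and line: "\<And>t. x + t \<cdot>\<^sub>v y \<in> C"
  shows "y = 0\<^sub>v d"
proof -
  have "x + y = x"
    using C xy line unfolding proper_cone_def proper_cone_in_def topspace_vec_topology by blast
  show ?thesis
  proof (rule eq_vecI)
    fix i assume "i < dim_vec (0\<^sub>v d :: real vec)"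
    then have i: "i < d" by simp
    have "(x + y) $ i = x $ i" using \<open>x + y = x\<close> by simp
    then show "y $ i = 0\<^sub>v d $ i" using i xy by simp
  qed (use xy in simp)
qed

lemma proper_cone_bidual:
  assumes C: "proper_cone d C" and a: "a \<in> carrier_vec d"
    and "\<And>b. b \<in> dual_cone d C \<Longrightarrow> 0 \<le> scalar_prod a b"
  shows "a \<in> C"
proof (rule ccontr)
  assume "a \<notin> C"
  then obtain b where "b \<in> dual_cone d C" "scalar_prod a b < 0"
    using separating_functional[OF proper_coneD(1,5,3,4)[OF C] a] by metis
  then show False using assms(3) by fastforce
qed

lemma closedin_inequalities:
  assumes "\<And>i. i \<in> I \<Longrightarrow> continuous_map X euclideanreal (g i)"
  shows "closedin X {x \<in> topspace X. \<forall>i\<in>I. 0 \<le> g i x}"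
proof -
  have half: "closedin X {x \<in> topspace X. g i x \<in> {0..}}" if "i \<in> I" for i
    by (rule closedin_continuous_map_preimage[OF assms[OF that]]) simp
  have "closedin X (topspace X \<inter> \<Inter> ((\<lambda>i. {x \<in> topspace X. g i x \<in> {0..}}) ` I))"
  proof (cases "I = {}")
    case False
    then show ?thesis
      by (intro closedin_Int closedin_topspace closedin_Inter) (use half in blast)+
  qed simp
  also have "topspace X \<inter> \<Inter> ((\<lambda>i. {x \<in> topspace X. g i x \<in> {0..}}) ` I)
      = {x \<in> topspace X. \<forall>i\<in>I. 0 \<le> g i x}"
    by auto
  finally show ?thesis .
qed

lemma continuous_map_sesq:
  assumes "k < d"
  shows "continuous_map (HerT_topology d s) euclidean (\<lambda>A. sesq s (entries (A ! k)) f g)"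
proof -
  have "continuous_map (HerT_topology d s) euclidean (\<lambda>A. (A ! k) $$ (i, j))" if "i < s" "j < s" for i j
    using continuous_map_HerT_entry[OF assms that] .
  then show ?thesis
    unfolding sesq_def continuous_map_atin limitin_canonical_iff
    by (intro ballI tendsto_sum tendsto_mult tendsto_const) auto
qed

text \<open>
  By biduality, membership in the largest system is a family of linear inequalities, which makes
  the system closed.
\<close>

lemma closedin_largest_system:
  assumes C: "proper_cone d C"
  shows "closedin (HerT_topology d s) (largest_system d C s)"
proof -
  define g where "g = (\<lambda>(b, f) A. scalar_prod (form_values d s A f) (b :: real vec))"
  have dual: "b \<in> carrier_vec d" if "b \<in> dual_cone d C" for b
    using that by (simp add: dual_cone_def)
  have "largest_system d C s
      = {A \<in> topspace (HerT_topology d s). \<forall>x\<in>dual_cone d C \<times> UNIV. 0 \<le> g x A}"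
    (is "_ = ?R")
  proof (intro equalityI subsetI)
    fix A assume A: "A \<in> largest_system d C s"
    then have "0 \<le> g (b, f) A" if "b \<in> dual_cone d C" for b f
      using that by (simp add: g_def largest_system_iff dual_cone_def)
    then show "A \<in> ?R" using A by (auto simp: topspace_HerT_topology largest_system_iff)
  next
    fix A assume A: "A \<in> ?R"
    have "form_values d s A f \<in> C" for f
    proof (rule proper_cone_bidual[OF C form_values_carrier])
      fix b assume b: "b \<in> dual_cone d C"
      then have "0 \<le> g (b, f) A" using A by blast
      then show "0 \<le> scalar_prod (form_values d s A f) b" by (simp add: g_def)
    qed
    then show "A \<in> largest_system d C s"
      using A by (simp add: topspace_HerT_topology largest_system_iff)
  qed
  also have "closedin (HerT_topology d s) \<dots>"
  proof (rule closedin_inequalities)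
    fix x :: "real vec \<times> (nat \<Rightarrow> complex)"
    assume "x \<in> dual_cone d C \<times> UNIV"
    then obtain b f where x: "x = (b, f)" and b: "b \<in> carrier_vec d" using dual by blast
    have "g x = (\<lambda>A. \<Sum>k<d. Re (sesq s (entries (A ! k)) f f) * b $ k)"
      by (rule ext) (simp add: x g_def scalar_prod_sum[OF b] form_values_index)
    moreover have "continuous_map (HerT_topology d s) euclideanreal \<dots>"
      using continuous_map_sesq unfolding continuous_map_atin limitin_canonical_iff
      by (intro ballI tendsto_sum tendsto_mult tendsto_const tendsto_Re) auto
    ultimately show "continuous_map (HerT_topology d s) euclideanreal (g x)" by simp
  qed
  finally show ?thesis .
qed

text \<open>
  A small perturbation \<open>\<Sum> y_ab \<otimes> F_ab\<close> of \<open>\<Sum> c \<otimes> v_ab v_ab^* + \<Sum> c \<otimes> E_aa\<close>, with \<open>c\<close> interior to \<open>C\<close>, only perturbs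
  the coefficients \<open>c\<close>, because \<open>F_ab\<close> is a combination of \<open>v_ab v_ab^*\<close>, \<open>E_aa\<close> and \<open>E_bb\<close>. This yields
  interior points for every convex cone of matrix tuples that contains the elementary tensors over \<open>C\<close>.
\<close>

lemma interior_of_cone_over:
  assumes C: "proper_cone d C" and SH: "S \<subseteq> HerT d s"
    and add: "\<And>A B. A \<in> S \<Longrightarrow> B \<in> S \<Longrightarrow> tuple_add A B \<in> S"
    and rank_one: "\<And>a f. a \<in> C \<Longrightarrow> tuple_of d s (\<lambda>k i j. of_real (a $ k) * (f i * cnj (f j))) \<in> S"
  shows "HerT_topology d s interior_of S \<noteq> {}"
proof -
  obtain c where c: "c \<in> vec_topology d interior_of C"
    using C unfolding proper_cone_def proper_cone_in_def by blast
  then obtain \<epsilon> where \<epsilon>: "0 < \<epsilon>"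
    and ball: "\<forall>y\<in>carrier_vec d. (\<forall>i<d. \<bar>y $ i - c $ i\<bar> < \<epsilon>) \<longrightarrow> y \<in> C"
    using interior_of_vec_topologyD[OF c] by blast
  have cC: "c \<in> C" by (rule subsetD[OF interior_of_subset c])
  then have cd: "c \<in> carrier_vec d" using proper_cone_carrier[OF C] by blast
  have zero: "tuple_of d s (\<lambda>_ _ _. 0) \<in> S"
    using rank_one[OF proper_cone_zero[OF C], of "\<lambda>_. 0"] by simp
  define comb where "comb = (\<lambda>(z :: nat \<Rightarrow> nat \<Rightarrow> nat \<Rightarrow> real) (w :: nat \<Rightarrow> nat \<Rightarrow> real).
    tuple_of d s (\<lambda>k i j. (\<Sum>x\<in>{..<s} \<times> {..<s}. of_real (z (fst x) (snd x) k) *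
        (basis_vec (fst x) (snd x) i * cnj (basis_vec (fst x) (snd x) j)))
      + (\<Sum>a<s. of_real (w a k) * (of_bool (i = a) * of_bool (j = a)))))"
  have comb: "comb z w \<in> S"
    if "\<And>a b. a < s \<Longrightarrow> b < s \<Longrightarrow> vec d (z a b) \<in> C" "\<And>a. a < s \<Longrightarrow> vec d (w a) \<in> C" for z w
  proof -
    have 1: "tuple_of d s (\<lambda>k i j. of_real (z a b k) * (basis_vec a b i * cnj (basis_vec a b j))) \<in> S"
      if "a < s" "b < s" for a b
    proof -
      have "tuple_of d s (\<lambda>k i j. of_real (z a b k) * (basis_vec a b i * cnj (basis_vec a b j)))
        = tuple_of d s (\<lambda>k i j. of_real (vec d (z a b) $ k) * (basis_vec a b i * cnj (basis_vec a b j)))"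
        by (rule tuple_of_cong) simp
      then show ?thesis using rank_one \<open>\<And>a b. a < s \<Longrightarrow> b < s \<Longrightarrow> vec d (z a b) \<in> C\<close>[OF that] by simp
    qed
    have 2: "tuple_of d s (\<lambda>k i j. of_real (w a k) * (of_bool (i = a) * of_bool (j = a))) \<in> S"
      if "a < s" for a
    proof -
      have "tuple_of d s (\<lambda>k i j. of_real (w a k) * (of_bool (i = a) * of_bool (j = a)))
        = tuple_of d s (\<lambda>k i j. of_real (vec d (w a) $ k) * (of_bool (i = a) * cnj (of_bool (j = a))))"
        by (rule tuple_of_cong) simp
      then show ?thesis
        using rank_one[of _ "\<lambda>i. of_bool (i = a)"] \<open>\<And>a. a < s \<Longrightarrow> vec d (w a) \<in> C\<close>[OF that] by simp
    qed
    show ?thesis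
      unfolding comb_def tuple_add_of[symmetric]
      using 1 2 by (intro add tuple_of_sum zero) auto
  qed
  define U where "U = comb (\<lambda>_ _ k. c $ k) (\<lambda>_ k. c $ k)"
  have "vec d (($) c) = c" using cd by auto
  then have US: "U \<in> S" unfolding U_def using cC by (intro comb) simp_all
  then have UH: "U \<in> HerT d s" using SH by blast
  \<comment> \<open>The coefficients \<open>y_ab\<close> are below \<open>2 \<delta>\<close>, and at most \<open>s\<close> sums \<open>y_ab + y_ba / 2\<close> accumulate at one \<open>E_aa\<close>.\<close>
  define \<delta> where "\<delta> = \<epsilon> / (4 * (real s + 1))"
  have \<delta>: "0 < \<delta>" using \<epsilon> by (simp add: \<delta>_def)
  have \<delta>1: "2 * \<delta> < \<epsilon>" and \<delta>s: "real s * (3 * \<delta>) < \<epsilon>"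
    using \<epsilon> by (simp_all add: \<delta>_def field_simps add_pos_nonneg add_nonneg_pos)
  have "U \<in> HerT_topology d s interior_of S"
  proof (rule interior_of_HerT_topologyI[OF \<delta> UH])
    fix A assume A: "A \<in> HerT d s"
      and near: "\<And>k i j. k < d \<Longrightarrow> i < s \<Longrightarrow> j < s \<Longrightarrow> cmod ((A ! k) $$ (i, j) - (U ! k) $$ (i, j)) < \<delta>"
    define D where "D = (\<lambda>k i j. (A ! k) $$ (i, j) - (U ! k) $$ (i, j))"
    define y where "y = (\<lambda>a b k. Re (D k a b) + Im (D k a b))"
    have D: "hermitian s (D k)" if "k < d" for k
      using hermitianD[OF HerT_hermitian[OF A that]] hermitianD[OF HerT_hermitian[OF UH that]]
      by (intro hermitianI) (simp add: D_def)
    have y: "\<bar>y a b k\<bar> < 2 * \<delta>" if "k < d" "a < s" "b < s" for a b k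
      using near[OF that] abs_Re_le_cmod[of "D k a b"] abs_Im_le_cmod[of "D k a b"]
      unfolding y_def D_def by linarith
    define w where "w = (\<lambda>a k. c $ k - (\<Sum>b<s. y a b k + y b a k / 2))"
    have "A = comb (\<lambda>a b k. c $ k + y a b k) w"
    proof -
      have "(A ! k) $$ (i, j) = (comb (\<lambda>a b k. c $ k + y a b k) w ! k) $$ (i, j)"
        if k: "k < d" and ij: "i < s" "j < s" for k i j
      proof -
        let ?v = "\<lambda>a b. basis_vec a b i * cnj (basis_vec a b j)"
        let ?E = "\<lambda>a. of_bool (i = a) * of_bool (j = a) :: complex"
        have "D k i j = (\<Sum>a<s. \<Sum>b<s. of_real (y a b k) * herm_basis a b i j)"
          unfolding y_def by (rule hermitian_expansion[OF D[OF k] ij])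
        also have "\<dots> = (\<Sum>a<s. \<Sum>b<s. of_real (y a b k) * ?v a b)
            - ((\<Sum>a<s. \<Sum>b<s. of_real (y a b k) * ?E a) + (\<Sum>a<s. \<Sum>b<s. of_real (y a b k) / 2 * ?E b))"
          unfolding herm_basis_rank_one
          by (simp add: algebra_simps sum.distrib sum_subtractf)
        also have "(\<Sum>a<s. \<Sum>b<s. of_real (y a b k) / 2 * ?E b) = (\<Sum>a<s. \<Sum>b<s. of_real (y b a k) / 2 * ?E a)"
          by (rule sum.swap)
        also have "(\<Sum>a<s. \<Sum>b<s. of_real (y a b k) * ?E a) + (\<Sum>a<s. \<Sum>b<s. of_real (y b a k) / 2 * ?E a)
            = (\<Sum>a<s. of_real (\<Sum>b<s. y a b k + y b a k / 2) * ?E a)"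
          unfolding sum.distrib[symmetric] of_real_sum sum_distrib_right
          by (intro sum.cong refl) (simp add: algebra_simps)
        finally have "D k i j = (\<Sum>a<s. \<Sum>b<s. of_real (y a b k) * ?v a b)
            - (\<Sum>a<s. of_real (\<Sum>b<s. y a b k + y b a k / 2) * ?E a)" .
        moreover have entry: "(comb z w ! k) $$ (i, j)
            = (\<Sum>a<s. \<Sum>b<s. of_real (z a b k) * ?v a b) + (\<Sum>a<s. of_real (w a k) * ?E a)" for z w
          using k ij by (simp add: comb_def tuple_of_nth sum.cartesian_product')
        moreover have "(A ! k) $$ (i, j) = (U ! k) $$ (i, j) + D k i j" by (simp add: D_def)
        ultimately show ?thesis
          unfolding entry U_def w_def of_real_add[of "c $ k"] of_real_diff[of "c $ k"] distrib_right
            left_diff_distrib sum.distrib sum_subtractf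
          by simp
      qed
      moreover have "comb (\<lambda>a b k. c $ k + y a b k) w \<in> HerT d s"
        unfolding comb_def
        by (intro tuple_of_HerT hermitianI) (simp add: mult_ac)
      ultimately show ?thesis using A by (intro HerT_eqI) auto
    qed
    also have "\<dots> \<in> S"
    proof (rule comb)
      fix a b assume ab: "a < s" "b < s"
      show "vec d (\<lambda>k. c $ k + y a b k) \<in> C"
        by (rule ball[rule_format]) (use y[OF _ ab] \<delta>1 in \<open>auto intro: order_less_trans\<close>)
    next
      fix a assume a: "a < s"
      show "vec d (w a) \<in> C"
      proof (rule ball[rule_format])
        fix k assume k: "k < d"
        have "\<bar>\<Sum>b<s. y a b k + y b a k / 2\<bar> \<le> (\<Sum>b<s. 3 * \<delta>)"
        proof (rule order_trans[OF sum_abs sum_mono])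
          fix b assume "b \<in> {..<s}"
          then show "\<bar>y a b k + y b a k / 2\<bar> \<le> 3 * \<delta>"
            using y[OF k a, of b] y[OF k _ a, of b] by simp
        qed
        also have "\<dots> < \<epsilon>" using \<delta>s by simp
        finally show "\<bar>vec d (w a) $ k - c $ k\<bar> < \<epsilon>" using k by (simp add: w_def)
      qed simp
    qed
    finally show "A \<in> S" .
  qed
  then show ?thesis by blast
qed

lemma largest_system_add:
  assumes "proper_cone d C" "A \<in> largest_system d C s" "B \<in> largest_system d C s"
  shows "tuple_add A B \<in> largest_system d C s"
  using assms by (simp add: largest_system_iff tuple_add_HerT form_values_add proper_cone_add)

text \<open>
  A line in the largest system is mapped by every vector \<open>f\<close> to a line in \<open>C\<close>, so its direction has only
  vanishing quadratic forms.
\<close>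

lemma largest_system_no_line:
  assumes C: "proper_cone d C" and X: "X \<in> HerT d s" and Y: "Y \<in> HerT d s"
    and line: "\<And>t. tuple_add X (tuple_scale t Y) \<in> largest_system d C s"
  shows "tuple_add X Y = X"
proof (rule HerT_eqI[OF tuple_add_HerT[OF X Y] X])
  fix k i j assume k: "k < d" and ij: "i < s" "j < s"
  have "form_values d s Y f = 0\<^sub>v d" for f
  proof (rule proper_cone_no_line[OF C])
    show "form_values d s X f + t \<cdot>\<^sub>v form_values d s Y f \<in> C" for t
      using line[of t] by (simp add: largest_system_iff form_values_add[OF X tuple_scale_HerT[OF Y]] form_values_scale[OF Y])
  qed simp_all
  then have "Re (sesq s (entries (Y ! k)) f f) = 0" for f
    using k by (metis form_values_index index_zero_vec(1))
  then have "(Y ! k) $$ (i, j) = 0"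
    by (rule hermitian_form_zero[OF HerT_hermitian[OF Y k] _ ij])
  then show "(tuple_add X Y ! k) $$ (i, j) = (X ! k) $$ (i, j)"
    by (simp add: tuple_add_nth[OF X Y k ij])
qed

lemma rank_one_in_largest_system:
  assumes C: "proper_cone d C" and a: "a \<in> C"
  shows "tuple_of d s (\<lambda>k i j. of_real (a $ k) * (f i * cnj (f j))) \<in> largest_system d C s"
proof -
  let ?T = "tuple_of d s (\<lambda>k i j. of_real (a $ k) * (f i * cnj (f j)))"
  have ad: "a \<in> carrier_vec d" using proper_cone_carrier[OF C] a by blast
  have H: "?T \<in> HerT d s" by (intro tuple_of_HerT hermitianI) (simp add: mult_ac)
  have "form_values d s ?T g \<in> C" for g
  proof -
    define z where "z = (\<Sum>i<s. f i * cnj (g i))"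
    have "form_values d s ?T g = (cmod z)\<^sup>2 \<cdot>\<^sub>v a"
    proof (rule eq_vecI)
      fix k assume "k < dim_vec ((cmod z)\<^sup>2 \<cdot>\<^sub>v a)"
      then have k: "k < d" using ad by simp
      have "sesq s (entries (?T ! k)) g g
          = sesq s (\<lambda>i j. of_real (a $ k) * (f i * cnj (f j))) g g"
        by (rule sesq_cong) (simp_all add: tuple_of_nth k)
      also have "\<dots> = of_real (a $ k) * (z * cnj z)"
        by (simp add: sesq_def z_def sum_distrib_left sum_distrib_right mult_ac) (rule sum.swap)
      also have "\<dots> = of_real (a $ k * (cmod z)\<^sup>2)" by (simp add: complex_norm_square[symmetric] del: of_real_power)
      finally show "form_values d s ?T g $ k = ((cmod z)\<^sup>2 \<cdot>\<^sub>v a) $ k"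
        using k ad by (simp add: form_values_index)
    qed (use ad in simp)
    then show ?thesis using proper_cone_scale[OF C a] by simp
  qed
  then show ?thesis using H by (simp add: largest_system_iff)
qed

lemma largest_system_operator_system:
  assumes C: "proper_cone d C"
  shows "abstract_operator_system d (largest_system d C)"
  unfolding abstract_operator_system_def proper_cone_HerT_def proper_cone_in_def topspace_HerT_topology
proof (intro conjI allI impI ballI)
  fix s :: nat
  show "closedin (HerT_topology d s) (largest_system d C s)" by (rule closedin_largest_system[OF C])
  show "HerT_topology d s interior_of largest_system d C s \<noteq> {}"
    by (rule interior_of_cone_over[OF C _ largest_system_add[OF C] rank_one_in_largest_system[OF C]])
      (auto simp: largest_system_iff)
  show "tuple_add A B \<in> largest_system d C s"
    if "A \<in> largest_system d C s" "B \<in> largest_system d C s" for A B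
    by (rule largest_system_add[OF C that])
  show "tuple_scale c A \<in> largest_system d C s" if "A \<in> largest_system d C s" "0 \<le> c" for A c
    using that by (simp add: largest_system_iff tuple_scale_HerT form_values_scale proper_cone_scale[OF C])
  show "\<not> (\<exists>X\<in>HerT d s. \<exists>Y\<in>HerT d s. tuple_add X Y \<noteq> X \<and> (\<forall>t. tuple_add X (tuple_scale t Y) \<in> largest_system d C s))"
    using largest_system_no_line[OF C] by blast
next
  fix s t A and V :: "complex mat" assume "A \<in> largest_system d C s" "V \<in> carrier_mat s t"
  then show "compress V A \<in> largest_system d C t"
    by (simp add: largest_system_iff compress_HerT[of A d s V t] form_values_compress[of A d s V t])
qed

lemma HerT_level_one:
  assumes H: "A \<in> HerT d 1"
  shows "A = embed (form_values d 1 A (\<lambda>_. 1))"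
proof (rule HerT_eqI[OF H embed_HerT])
  fix k i j :: nat assume k: "k < d" and "i < 1" "j < 1"
  then have ij: "i = 0" "j = 0" by auto
  have "cnj ((A ! k) $$ (0, 0)) = (A ! k) $$ (0, 0)"
    using hermitianD[OF HerT_hermitian[OF H k], of 0 0] by simp
  then have "Im ((A ! k) $$ (0, 0)) = 0" by (simp add: complex_eq_iff)
  then show "(A ! k) $$ (i, j) = (embed (form_values d 1 A (\<lambda>_. 1)) ! k) $$ (i, j)"
    using k by (simp add: ij embed_nth[of _ d] form_values_index sesq_def complex_eq_iff)
qed simp

lemma largest_system_level_one:
  assumes "A \<in> largest_system d C 1"
  shows "A \<in> embed ` C"
  using assms HerT_level_one[of A d] by (metis imageI largest_system_iff)

section \<open>Free numerical ranges over a cone with spectrahedral dual\<close>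

lemma operator_systemD:
  assumes "abstract_operator_system d \<E>" "1 \<le> s"
  shows operator_system_closed: "closedin (HerT_topology d s) (\<E> s)"
    and operator_system_HerT: "\<E> s \<subseteq> HerT d s"
    and operator_system_add: "\<And>A B. A \<in> \<E> s \<Longrightarrow> B \<in> \<E> s \<Longrightarrow> tuple_add A B \<in> \<E> s"
    and operator_system_scale: "\<And>A c. A \<in> \<E> s \<Longrightarrow> 0 \<le> c \<Longrightarrow> tuple_scale c A \<in> \<E> s"
    and operator_system_compress:
      "\<And>A t V. A \<in> \<E> s \<Longrightarrow> 1 \<le> t \<Longrightarrow> V \<in> carrier_mat s t \<Longrightarrow> compress V A \<in> \<E> t"
proof -
  note P = assms(1)[unfolded abstract_operator_system_def]
  have K: "proper_cone_HerT d s (\<E> s)" using P assms(2) by blast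
  note Q = K[unfolded proper_cone_HerT_def proper_cone_in_def]
  show "closedin (HerT_topology d s) (\<E> s)" using Q by blast
  then show "\<E> s \<subseteq> HerT d s" using closedin_subset topspace_HerT_topology by blast
  show "\<And>A B. A \<in> \<E> s \<Longrightarrow> B \<in> \<E> s \<Longrightarrow> tuple_add A B \<in> \<E> s" using Q by blast
  show "\<And>A c. A \<in> \<E> s \<Longrightarrow> 0 \<le> c \<Longrightarrow> tuple_scale c A \<in> \<E> s" using Q by blast
  show "\<And>A t V. A \<in> \<E> s \<Longrightarrow> 1 \<le> t \<Longrightarrow> V \<in> carrier_mat s t \<Longrightarrow> compress V A \<in> \<E> t"
    using P assms(2) by blast
qed

lemma pos_form_pencil_iff:
  assumes b: "b \<in> carrier_vec d"
  shows "pos_form r (\<lambda>i j. \<Sum>k<d. of_real (b $ k) * (M ! k) $$ (i, j))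
    \<longleftrightarrow> (\<forall>f. 0 \<le> scalar_prod (form_values d r M f) b)"
proof -
  have "Re (sesq r (\<lambda>i j. \<Sum>k<d. of_real (b $ k) * (M ! k) $$ (i, j)) f f)
      = scalar_prod (form_values d r M f) b" for f
    using b by (simp add: sesq_linear scalar_prod_sum form_values_index mult.commute)
  then show ?thesis by (simp add: pos_form_def)
qed

text \<open>
  For \<open>b\<close> in the dual cone the pencil at \<open>b\<close> is positive semidefinite, which says that \<open>b\<close> is nonnegative at all
  \<open>f^* M f\<close>; biduality turns this into membership in \<open>C\<close>.
\<close>

lemma dual_pencil_in_largest_system:
  assumes C: "proper_cone d C" and M: "M \<in> HerT d r"
    and dual: "dual_cone d C = {a \<in> carrier_vec d. psd r (pencil r M a)}"
  shows "M \<in> largest_system d C r"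
proof -
  have "form_values d r M f \<in> C" for f
  proof (rule proper_cone_bidual[OF C form_values_carrier])
    fix b assume "b \<in> dual_cone d C"
    then have b: "b \<in> carrier_vec d" and "psd r (pencil r M b)" using dual by auto
    then show "0 \<le> scalar_prod (form_values d r M f) b"
      by (simp add: psd_pencil_iff[OF M b] pos_form_pencil_iff[OF b])
  qed
  then show ?thesis using M by (simp add: largest_system_iff)
qed

lemma operator_system_form_values:
  assumes E: "abstract_operator_system d \<E>" and s: "1 \<le> s" and A: "A \<in> \<E> s"
  shows "embed (form_values d s A f) \<in> \<E> 1"
proof -
  have H: "A \<in> HerT d s" using operator_system_HerT[OF E s] A by blast
  have "compress (Matrix.mat s 1 (\<lambda>(i, _). f i)) A \<in> \<E> 1"
    by (rule operator_system_compress[OF E s A]) simp_all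
  then show ?thesis by (simp only: compress_to_level_one[OF H])
qed

text \<open>
  The level-one cone of an operator system containing \<open>M\<close> contains all \<open>f^* M f\<close>, so every functional
  that is nonnegative on it makes the pencil of \<open>M\<close> positive semidefinite and hence lies in the dual
  of \<open>C\<close>. Separation therefore leaves no point of \<open>C\<close> outside that cone.
\<close>

lemma dual_pencil_generates_level_one:
  assumes C: "proper_cone d C" and M: "M \<in> HerT d r" and r: "1 \<le> r"
    and dual: "dual_cone d C = {a \<in> carrier_vec d. psd r (pencil r M a)}"
    and E: "abstract_operator_system d \<E>" and ME: "M \<in> \<E> r" and a: "a \<in> C"
  shows "embed a \<in> \<E> 1"
proof (rule ccontr)
  assume not: "embed a \<notin> \<E> 1"
  define K where "K = {x \<in> topspace (vec_topology d). embed x \<in> \<E> 1}"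
  have K_iff: "x \<in> K \<longleftrightarrow> x \<in> carrier_vec d \<and> embed x \<in> \<E> 1" for x
    by (simp add: K_def topspace_vec_topology)
  have ad: "a \<in> carrier_vec d" using proper_cone_carrier[OF C] a by blast
  have fv: "form_values d r M f \<in> K" for f
    using operator_system_form_values[OF E r ME] by (simp add: K_iff)
  have scale: "c \<cdot>\<^sub>v x \<in> K" if "x \<in> K" "0 \<le> c" for x c
    using operator_system_scale[OF E order_refl, of "embed x" c] that
    by (simp add: K_iff tuple_scale_embed[of x d])
  have zero: "0\<^sub>v d \<in> K"
  proof -
    have "0 \<cdot>\<^sub>v form_values d r M (\<lambda>_. 0) = 0\<^sub>v d" by (intro eq_vecI) auto
    then show ?thesis using scale[OF fv[of "\<lambda>_. 0"], of 0] by simp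
  qed
  have "closedin (vec_topology d) K"
    unfolding K_def
    by (rule closedin_continuous_map_preimage[OF continuous_map_embed operator_system_closed[OF E order_refl]])
  moreover have "x + y \<in> K" if "x \<in> K" "y \<in> K" for x y
    using operator_system_add[OF E order_refl, of "embed x" "embed y"] that
    by (simp add: K_iff tuple_add_embed[of x d])
  moreover have "a \<notin> K" using not by (simp add: K_iff)
  ultimately obtain b where b: "b \<in> dual_cone d K" "scalar_prod a b < 0"
    using separating_functional[OF _ zero _ scale ad] by metis
  have bd: "b \<in> carrier_vec d" using b(1) by (simp add: dual_cone_def)
  have "0 \<le> scalar_prod (form_values d r M f) b" for f
    using b(1) fv by (simp add: dual_cone_def)
  then have "b \<in> dual_cone d C"
    using bd by (simp add: dual psd_pencil_iff[OF M bd] pos_form_pencil_iff[OF bd])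
  then show False using b(2) a by (fastforce simp: dual_cone_def)
qed

text \<open>
  The intersection of all operator systems containing a set of elements of the largest system is the
  operator system that they generate. Closedness is automatic for an intersection, and the largest
  system excludes lines; only the interior needs an argument, namely that every member of the
  intersection lies over a cone that contains \<open>C\<close>.
\<close>

lemma generated_operator_system:
  assumes C: "proper_cone d C" and F: "contains_elements (largest_system d C) F"
    and level_one: "\<And>\<E> a. abstract_operator_system d \<E> \<Longrightarrow> contains_elements \<E> F \<Longrightarrow> a \<in> C \<Longrightarrow> embed a \<in> \<E> 1"
  shows "\<exists>\<D>. abstract_operator_system d \<D> \<and> contains_elements \<D> F \<and> over \<D> C \<and>
    (\<forall>\<E>. abstract_operator_system d \<E> \<and> contains_elements \<E> F \<longrightarrow> (\<forall>s\<ge>1. \<D> s \<subseteq> \<E> s))"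
proof -
  let ?L = "largest_system d C"
  define \<D> where "\<D> = (\<lambda>s. \<Inter>{\<E> s |\<E>. abstract_operator_system d \<E> \<and> contains_elements \<E> F})"
  have D_iff: "A \<in> \<D> s \<longleftrightarrow> (\<forall>\<E>. abstract_operator_system d \<E> \<and> contains_elements \<E> F \<longrightarrow> A \<in> \<E> s)" for A s
    by (auto simp: \<D>_def)
  have DL: "\<D> s \<subseteq> ?L s" for s
    using largest_system_operator_system[OF C] F by (auto simp: D_iff)
  have DH: "\<D> s \<subseteq> HerT d s" for s using DL by (fastforce simp: largest_system_iff)
  have add: "tuple_add A B \<in> \<D> s" if "1 \<le> s" "A \<in> \<D> s" "B \<in> \<D> s" for s A B
    using that operator_system_add unfolding D_iff by blast
  have compress: "compress V A \<in> \<D> t" if "1 \<le> s" "1 \<le> t" "A \<in> \<D> s" "V \<in> carrier_mat s t" for s t A V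
    using that operator_system_compress unfolding D_iff by blast
  have C1: "embed a \<in> \<D> 1" if "a \<in> C" for a using level_one that by (simp add: D_iff)
  have "abstract_operator_system d \<D>"
    unfolding abstract_operator_system_def proper_cone_HerT_def proper_cone_in_def topspace_HerT_topology
  proof (intro conjI allI impI ballI)
    fix s :: nat assume s: "1 \<le> s"
    show "closedin (HerT_topology d s) (\<D> s)"
      unfolding \<D>_def
    proof (rule closedin_Inter)
      show "{\<E> s |\<E>. abstract_operator_system d \<E> \<and> contains_elements \<E> F} \<noteq> {}"
        using largest_system_operator_system[OF C] F by blast
    qed (use operator_system_closed[OF _ s] in blast)
    show "HerT_topology d s interior_of \<D> s \<noteq> {}"
    proof (rule interior_of_cone_over[OF C DH add[OF s]])
      fix a f assume a: "a \<in> C"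
      have V: "Matrix.mat 1 s (\<lambda>(_, i). cnj (f i)) \<in> carrier_mat 1 s" by simp
      have ad: "a \<in> carrier_vec d" using proper_cone_carrier[OF C] a by blast
      show "tuple_of d s (\<lambda>k i j. of_real (a $ k) * (f i * cnj (f j))) \<in> \<D> s"
        unfolding compress_from_level_one[OF ad, symmetric]
        by (rule compress[OF order_refl s C1[OF a] V])
    qed
    show "tuple_add A B \<in> \<D> s" if "A \<in> \<D> s" "B \<in> \<D> s" for A B
      by (rule add[OF s that])
    show "tuple_scale c A \<in> \<D> s" if "A \<in> \<D> s" "0 \<le> c" for A c
      using that operator_system_scale[OF _ s] unfolding D_iff by blast
    show "\<not> (\<exists>X\<in>HerT d s. \<exists>Y\<in>HerT d s. tuple_add X Y \<noteq> X \<and> (\<forall>t. tuple_add X (tuple_scale t Y) \<in> \<D> s))"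
      using largest_system_no_line[OF C] DL by blast
  next
    fix s t A and V :: "complex mat" assume "1 \<le> s" "1 \<le> t" "A \<in> \<D> s" "V \<in> carrier_mat s t"
    then show "compress V A \<in> \<D> t" by (rule compress)
  qed
  moreover have "contains_elements \<D> F"
    using F by (auto simp: contains_elements_def D_iff)
  moreover have "over \<D> C"
    unfolding over_def using C1 DL largest_system_level_one by blast
  moreover have "\<forall>\<E>. abstract_operator_system d \<E> \<and> contains_elements \<E> F \<longrightarrow> (\<forall>s\<ge>1. \<D> s \<subseteq> \<E> s)"
    by (auto simp: D_iff)
  ultimately show ?thesis by blast
qed

lemma free_numerical_range_through:
  assumes C: "proper_cone d C" and dual: "spectrahedron d (dual_cone d C)"
    and s: "1 \<le> s" and A: "A \<in> largest_system d C s"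
  shows "\<exists>\<D>. free_numerical_range d \<D> \<and> over \<D> C \<and> A \<in> \<D> s"
proof -
  obtain r M where r: "1 \<le> r" and M: "M \<in> HerT d r"
    and dual: "dual_cone d C = {a \<in> carrier_vec d. psd r (pencil r M a)}"
    using dual unfolding spectrahedron_def by blast
  define F where "F = {(r, M), (s, A)}"
  have "contains_elements (largest_system d C) F"
    using r s A dual_pencil_in_largest_system[OF C M dual] by (simp add: F_def contains_elements_def)
  moreover have "embed a \<in> \<E> 1"
    if "abstract_operator_system d \<E>" "contains_elements \<E> F" "a \<in> C" for \<E> a
    using dual_pencil_generates_level_one[OF C M r dual that(1) _ that(3)] that(2)
    by (simp add: F_def contains_elements_def)
  ultimately obtain \<D> where D: "abstract_operator_system d \<D>" "contains_elements \<D> F" "over \<D> C"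
      "\<forall>\<E>. abstract_operator_system d \<E> \<and> contains_elements \<E> F \<longrightarrow> (\<forall>s\<ge>1. \<D> s \<subseteq> \<E> s)"
    using generated_operator_system[OF C] by blast
  have "finite F" by (simp add: F_def)
  then have "free_numerical_range d \<D>" using D by (auto simp: free_numerical_range_def)
  moreover have "A \<in> \<D> s" using D(2) by (simp add: F_def contains_elements_def)
  ultimately show ?thesis using D(3) by blast
qed

section \<open>Free spectrahedra of linearly independent pencils\<close>

lemma free_solution_sets_iff:
  assumes "M \<in> HerT n r"
  shows "A \<in> free_solution_sets n r M s \<longleftrightarrow> A \<in> HerT n s \<and> (\<forall>f. 0 \<le> Re (tensor_form n s r A M f))"
  using psd_kron_iff[OF _ assms, of A s] by (auto simp: free_solution_sets_def)

lemma tensor_form_add: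
  assumes "A \<in> HerT n s" "B \<in> HerT n s"
  shows "tensor_form n s r (tuple_add A B) M f = tensor_form n s r A M f + tensor_form n s r B M f"
proof -
  have "sesq s (entries (tuple_add A B ! k)) g h = sesq s (entries (A ! k)) g h + sesq s (entries (B ! k)) g h"
    if k: "k < n" for k g h
  proof -
    have "sesq s (entries (tuple_add A B ! k)) g h
        = sesq s (\<lambda>i j. entries (A ! k) i j + entries (B ! k) i j) g h"
      by (rule sesq_cong) (simp_all add: tuple_add_nth[OF assms k])
    then show ?thesis by (simp add: sesq_def algebra_simps sum.distrib)
  qed
  then show ?thesis by (simp add: tensor_form_def algebra_simps sum.distrib)
qed

lemma tensor_form_scale:
  assumes "A \<in> HerT n s"
  shows "tensor_form n s r (tuple_scale c A) M f = of_real c * tensor_form n s r A M f"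
proof -
  have "sesq s (entries (tuple_scale c A ! k)) g h = of_real c * sesq s (entries (A ! k)) g h"
    if k: "k < n" for k g h
  proof -
    have "sesq s (entries (tuple_scale c A ! k)) g h = sesq s (\<lambda>i j. of_real c * entries (A ! k) i j) g h"
      by (rule sesq_cong) (simp_all add: tuple_scale_nth[OF assms k])
    then show ?thesis by (simp add: sesq_def algebra_simps sum_distrib_left)
  qed
  then show ?thesis by (simp add: tensor_form_def sum_distrib_left mult_ac)
qed

lemma tensor_form_compress:
  assumes A: "A \<in> HerT n s" and V: "V \<in> carrier_mat s t"
  shows "tensor_form n t r (compress V A) M f
    = tensor_form n s r A M (\<lambda>p b. \<Sum>i<t. V $$ (p, i) * f i b)"
proof -
  have "compress V A ! k = mat_adjoint V * A ! k * V" if "k < n" for k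
    using that A by (simp add: compress_def HerT_length)
  then show ?thesis
    unfolding tensor_form_def
    by (intro sum.cong refl) (simp add: sesq_compress[OF HerT_carrier[OF A] V])
qed

lemma closedin_free_solution_sets:
  assumes M: "M \<in> HerT n r"
  shows "closedin (HerT_topology n s) (free_solution_sets n r M s)"
proof -
  have "free_solution_sets n r M s
      = {A \<in> topspace (HerT_topology n s). \<forall>f\<in>UNIV. 0 \<le> Re (tensor_form n s r A M f)}"
    by (auto simp: free_solution_sets_iff[OF M] topspace_HerT_topology)
  also have "closedin (HerT_topology n s) \<dots>"
  proof (rule closedin_inequalities)
    fix f
    show "continuous_map (HerT_topology n s) euclideanreal (\<lambda>A. Re (tensor_form n s r A M f))"
      using continuous_map_sesq
      unfolding tensor_form_def continuous_map_atin limitin_canonical_iff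
      by (intro ballI tendsto_sum tendsto_mult tendsto_const tendsto_Re) auto
  qed
  finally show ?thesis .
qed

text \<open>
  If \<open>\<Sum> u_k M_k = I\<close>, then \<open>(u_1 I_s, \<dots>, u_n I_s)\<close> is an interior point at every level: there the
  form of \<open>\<Sum> A_k \<otimes> M_k\<close> is the squared norm, which dominates the change caused by a small
  perturbation of the entries of \<open>A\<close>.
\<close>

lemma interior_of_free_solution_sets:
  assumes M: "M \<in> HerT n r" and u: "u \<in> carrier_vec n" and unit: "pencil r M u = 1\<^sub>m r"
  shows "tuple_of n s (\<lambda>k i j. of_real (u $ k) * of_bool (i = j))
    \<in> HerT_topology n s interior_of free_solution_sets n r M s"
proof -
  define U where "U = tuple_of n s (\<lambda>k i j. of_real (u $ k) * of_bool (i = j))"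
  have UH: "U \<in> HerT n s" unfolding U_def by (intro tuple_of_HerT hermitianI) auto
  define N where "N = (\<lambda>f :: nat \<Rightarrow> nat \<Rightarrow> complex. \<Sum>p<s. \<Sum>a<r. (cmod (f p a))\<^sup>2)"
  have N0: "0 \<le> N f" for f by (simp add: N_def sum_nonneg)
  have formU: "tensor_form n s r U M f = of_real (N f)" for f
  proof -
    have id: "(\<Sum>k<n. of_real (u $ k) * (M ! k) $$ (a, b)) = of_bool (a = b)" if "a < r" "b < r" for a b
      unfolding pencil_index[OF M u that, symmetric] by (simp add: unit that)
    have sesqU: "sesq s (entries (U ! k)) g h = of_real (u $ k) * (\<Sum>p<s. g p * cnj (h p))" if "k < n" for k g h
    proof -
      have "sesq s (entries (U ! k)) g h = sesq s (\<lambda>i j. of_real (u $ k) * of_bool (i = j)) g h"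
        by (rule sesq_cong) (simp_all add: U_def tuple_of_nth that)
      also have "\<dots> = (\<Sum>i<s. \<Sum>j<s. if j = i then of_real (u $ k) * g j * cnj (h i) else 0)"
        unfolding sesq_def by (intro sum.cong refl) auto
      finally show ?thesis by (simp add: sum_distrib_left mult_ac)
    qed
    have "tensor_form n s r U M f
        = (\<Sum>k<n. \<Sum>a<r. \<Sum>b<r. of_real (u $ k) * (M ! k) $$ (a, b) * (\<Sum>p<s. f p b * cnj (f p a)))"
      unfolding tensor_form_def by (intro sum.cong refl) (simp add: sesqU)
    also have "\<dots> = (\<Sum>a<r. \<Sum>k<n. \<Sum>b<r. of_real (u $ k) * (M ! k) $$ (a, b) * (\<Sum>p<s. f p b * cnj (f p a)))"
      by (rule sum.swap)
    also have "\<dots> = (\<Sum>a<r. \<Sum>b<r. \<Sum>k<n. of_real (u $ k) * (M ! k) $$ (a, b) * (\<Sum>p<s. f p b * cnj (f p a)))"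
      by (rule sum.cong[OF refl], rule sum.swap)
    also have "\<dots> = (\<Sum>a<r. \<Sum>b<r. of_bool (a = b) * (\<Sum>p<s. f p b * cnj (f p a)))"
      by (intro sum.cong refl) (simp add: id flip: sum_distrib_right)
    also have "\<dots> = (\<Sum>a<r. \<Sum>b<r. if b = a then \<Sum>p<s. f p b * cnj (f p a) else 0)"
      by (intro sum.cong refl) auto
    also have "\<dots> = (\<Sum>a<r. \<Sum>p<s. f p a * cnj (f p a))" by simp
    also have "\<dots> = (\<Sum>p<s. \<Sum>a<r. f p a * cnj (f p a))" by (rule sum.swap)
    also have "\<dots> = of_real (N f)"
      unfolding N_def of_real_sum by (intro sum.cong refl) (rule complex_norm_square[symmetric])
    finally show ?thesis .
  qed
  \<comment> \<open>If the entries of \<open>A\<close> change by at most \<open>\<epsilon>\<close>, the form at \<open>f\<close> changes by at most \<open>m * \<epsilon> * N f\<close>.\<close>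
  define m where "m = (\<Sum>k<n. \<Sum>a<r. \<Sum>b<r. cmod ((M ! k) $$ (a, b)) * (real s * real s))"
  have m: "0 \<le> m" by (simp add: m_def sum_nonneg)
  define \<epsilon> where "\<epsilon> = 1 / (m + 1)"
  have \<epsilon>: "0 < \<epsilon>" "m * \<epsilon> \<le> 1" using m by (simp_all add: \<epsilon>_def field_simps)
  have "U \<in> HerT_topology n s interior_of free_solution_sets n r M s"
  proof (rule interior_of_HerT_topologyI[OF \<epsilon>(1) UH])
    fix A assume A: "A \<in> HerT n s"
      and near: "\<And>k i j. k < n \<Longrightarrow> i < s \<Longrightarrow> j < s \<Longrightarrow> cmod ((A ! k) $$ (i, j) - (U ! k) $$ (i, j)) < \<epsilon>"
    have "0 \<le> Re (tensor_form n s r A M f)" for f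
    proof -
      define T where "T = (\<lambda>k a b. sesq s (entries (A ! k)) (\<lambda>q. f q b) (\<lambda>p. f p a)
          - sesq s (entries (U ! k)) (\<lambda>q. f q b) (\<lambda>p. f p a))"
      have le_N: "(cmod (f p a))\<^sup>2 \<le> N f" if "p < s" "a < r" for p a
      proof -
        have "(cmod (f p a))\<^sup>2 \<le> (\<Sum>a<r. (cmod (f p a))\<^sup>2)" using that by (intro member_le_sum) auto
        also have "\<dots> \<le> N f" unfolding N_def using that by (intro member_le_sum) (auto simp: sum_nonneg)
        finally show ?thesis .
      qed
      have prod_le: "cmod (f q b) * cmod (f p a) \<le> N f" if "p < s" "q < s" "a < r" "b < r" for p q a b
      proof -
        have "2 * (cmod (f q b) * cmod (f p a)) \<le> (cmod (f q b))\<^sup>2 + (cmod (f p a))\<^sup>2"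
          using sum_squares_bound[of "cmod (f q b)" "cmod (f p a)"] by simp
        then show ?thesis using le_N[OF that(2,4)] le_N[OF that(1,3)] by linarith
      qed
      have T: "cmod (T k a b) \<le> real s * real s * (\<epsilon> * N f)" if "k < n" "a < r" "b < r" for k a b
      proof -
        have "T k a b = (\<Sum>p<s. \<Sum>q<s. ((A ! k) $$ (p, q) - (U ! k) $$ (p, q)) * f q b * cnj (f p a))"
          by (simp add: T_def sesq_def sum_subtractf algebra_simps)
        also have "cmod \<dots> \<le> (\<Sum>p<s. \<Sum>q<s. \<epsilon> * N f)"
        proof (intro order_trans[OF norm_sum sum_mono] order_trans[OF norm_sum[of _ "{..<s}"] sum_mono])
          fix p q assume "p \<in> {..<s}" "q \<in> {..<s}"
          then have pq: "p < s" "q < s" by auto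
          have "cmod (((A ! k) $$ (p, q) - (U ! k) $$ (p, q)) * f q b * cnj (f p a))
              = cmod ((A ! k) $$ (p, q) - (U ! k) $$ (p, q)) * (cmod (f q b) * cmod (f p a))"
            by (simp add: norm_mult)
          also have "\<dots> \<le> \<epsilon> * N f"
            using near[OF that(1) pq] prod_le[OF pq that(2,3)] \<epsilon>(1) by (intro mult_mono) auto
          finally show "cmod (((A ! k) $$ (p, q) - (U ! k) $$ (p, q)) * f q b * cnj (f p a)) \<le> \<epsilon> * N f" .
        qed
        finally show ?thesis by simp
      qed
      have "tensor_form n s r A M f - tensor_form n s r U M f
          = (\<Sum>k<n. \<Sum>a<r. \<Sum>b<r. (M ! k) $$ (a, b) * T k a b)"
        by (simp add: tensor_form_def T_def sum_subtractf algebra_simps)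
      also have "cmod \<dots> \<le> (\<Sum>k<n. \<Sum>a<r. \<Sum>b<r. cmod ((M ! k) $$ (a, b)) * (real s * real s * (\<epsilon> * N f)))"
      proof (intro order_trans[OF norm_sum sum_mono] order_trans[OF norm_sum[of _ "{..<r}"] sum_mono])
        fix k a b assume "k \<in> {..<n}" "a \<in> {..<r}" "b \<in> {..<r}"
        then show "cmod ((M ! k) $$ (a, b) * T k a b)
            \<le> cmod ((M ! k) $$ (a, b)) * (real s * real s * (\<epsilon> * N f))"
          using T by (simp add: norm_mult mult_left_mono)
      qed
      also have "\<dots> = m * \<epsilon> * N f" by (simp add: m_def sum_distrib_left sum_distrib_right mult_ac)
      also have "\<dots> \<le> N f" using mult_right_mono[OF \<epsilon>(2) N0[of f]] by simp
      finally have "cmod (tensor_form n s r A M f - of_real (N f)) \<le> N f" by (simp add: formU)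
      then have "\<bar>Re (tensor_form n s r A M f) - N f\<bar> \<le> N f"
        using abs_Re_le_cmod[of "tensor_form n s r A M f - of_real (N f)"] by simp
      then show ?thesis by linarith
    qed
    then show "A \<in> free_solution_sets n r M s" using A by (simp add: free_solution_sets_iff[OF M])
  qed
  then show ?thesis by (simp add: U_def)
qed

definition independent_pencil :: "nat \<Rightarrow> nat \<Rightarrow> mat_tuple \<Rightarrow> bool" where
  "independent_pencil n r M \<longleftrightarrow> (\<forall>x :: nat \<Rightarrow> real.
     (\<forall>i<r. \<forall>j<r. (\<Sum>k<n. of_real (x k) * (M ! k) $$ (i, j)) = 0) \<longrightarrow> (\<forall>k<n. x k = 0))"

lemma independent_pencilD:
  assumes "independent_pencil n r M"
    and "\<And>i j. i < r \<Longrightarrow> j < r \<Longrightarrow> (\<Sum>k<n. complex_of_real (x k) * (M ! k) $$ (i, j)) = 0" "k < n"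
  shows "x k = 0"
  using assms unfolding independent_pencil_def by blast

text \<open>
  Real independence of Hermitian matrices is complex independence: conjugation turns a complex
  relation for the entry \<open>(i, j)\<close> into one for \<open>(j, i)\<close>, so the real and the imaginary parts
  of the coefficients satisfy a relation of their own.
\<close>

lemma independent_pencil_complex:
  fixes z :: "nat \<Rightarrow> complex"
  assumes M: "M \<in> HerT n r" and ind: "independent_pencil n r M"
    and rel: "\<And>i j. i < r \<Longrightarrow> j < r \<Longrightarrow> (\<Sum>k<n. z k * (M ! k) $$ (i, j)) = 0" and k: "k < n"
  shows "z k = 0"
proof -
  have conj: "(\<Sum>k<n. cnj (z k) * (M ! k) $$ (i, j)) = 0" if "i < r" "j < r" for i j
  proof -
    have "(\<Sum>k<n. cnj (z k) * (M ! k) $$ (i, j)) = cnj (\<Sum>k<n. z k * (M ! k) $$ (j, i))"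
      using that by (simp add: hermitianD[OF HerT_hermitian[OF M]])
    then show ?thesis using rel[OF that(2,1)] by simp
  qed
  have "(\<Sum>k<n. of_real (Re (z k)) * (M ! k) $$ (i, j)) = 0" if "i < r" "j < r" for i j
  proof -
    have "(\<Sum>k<n. of_real (Re (z k)) * (M ! k) $$ (i, j))
        = (\<Sum>k<n. z k * (M ! k) $$ (i, j)) / 2 + (\<Sum>k<n. cnj (z k) * (M ! k) $$ (i, j)) / 2"
      unfolding sum_divide_distrib sum.distrib[symmetric]
      by (intro sum.cong refl) (simp add: complex_eq_iff field_simps)
    then show ?thesis using rel conj that by simp
  qed
  then have "Re (z k) = 0"
    by (rule independent_pencilD[OF ind _ k, of "\<lambda>k. Re (z k)"])
  have "(\<Sum>k<n. of_real (Im (z k)) * (M ! k) $$ (i, j)) = 0" if "i < r" "j < r" for i j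
  proof -
    have "(\<Sum>k<n. of_real (Im (z k)) * (M ! k) $$ (i, j))
        = (\<Sum>k<n. cnj (z k) * (M ! k) $$ (i, j)) * (\<i> / 2) - (\<Sum>k<n. z k * (M ! k) $$ (i, j)) * (\<i> / 2)"
      unfolding sum_distrib_right sum_subtractf[symmetric]
      by (intro sum.cong refl) (simp add: complex_eq_iff field_simps)
    then show ?thesis using rel conj that by simp
  qed
  then have "Im (z k) = 0"
    by (rule independent_pencilD[OF ind _ k, of "\<lambda>k. Im (z k)"])
  with \<open>Re (z k) = 0\<close> show ?thesis by (simp add: complex_eq_iff)
qed

text \<open>
  Along a line the tensor form of the direction \<open>Y\<close> vanishes, so \<open>\<Sum> Y_k \<otimes> M_k = 0\<close>. Every entry of \<open>Y\<close> then gives a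
  linear relation between the \<open>M_k\<close>.
\<close>

lemma free_solution_sets_no_line:
  assumes M: "M \<in> HerT n r" and ind: "independent_pencil n r M"
    and X: "X \<in> HerT n s" and Y: "Y \<in> HerT n s"
    and line: "\<And>t. tuple_add X (tuple_scale t Y) \<in> free_solution_sets n r M s"
  shows "tuple_add X Y = X"
proof -
  have zero: "Re (tensor_form n s r Y M f) = 0" for f
  proof (rule ccontr)
    define x y where "x = Re (tensor_form n s r X M f)" and "y = Re (tensor_form n s r Y M f)"
    assume "Re (tensor_form n s r Y M f) \<noteq> 0"
    then have y: "y \<noteq> 0" by (simp add: y_def)
    have "0 \<le> Re (tensor_form n s r (tuple_add X (tuple_scale (- (x + 1) / y) Y)) M f)"
      using line free_solution_sets_iff[OF M] by blast
    then have "0 \<le> x + (- (x + 1) / y) * y"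
      by (simp only: tensor_form_add[OF X tuple_scale_HerT[OF Y]] tensor_form_scale[OF Y]
          plus_complex.sel Re_complex_of_real times_complex.sel Im_complex_of_real x_def y_def mult_zero_left diff_zero)
    then show False using y by simp
  qed
  have "kron_form n r Y M i j = 0" if "i < s * r" "j < s * r" for i j
  proof (rule hermitian_form_zero[OF kron_form_hermitian[OF Y M] _ that])
    fix f
    show "Re (sesq (s * r) (kron_form n r Y M) f f) = 0"
      using sesq_kron_form[of s r n Y M "\<lambda>p a. f (p * r + a)"] zero by simp
  qed
  then have rel: "(\<Sum>k<n. (Y ! k) $$ (p, q) * (M ! k) $$ (a, b)) = 0"
    if "p < s" "q < s" "a < r" "b < r" for p q a b
  proof -
    have "p * r + a < s * r" if "p < s" "a < r" for p a
    proof -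
      have "p * r + a < (p + 1) * r" using that by simp
      also have "\<dots> \<le> s * r" using that by (intro mult_right_mono) auto
      finally show ?thesis .
    qed
    then have "kron_form n r Y M (p * r + a) (q * r + b) = 0"
      using that \<open>\<And>j i. i < s * r \<Longrightarrow> j < s * r \<Longrightarrow> kron_form n r Y M i j = 0\<close> by blast
    then show ?thesis using that by (simp add: kron_form_def)
  qed
  show ?thesis
  proof (rule HerT_eqI[OF tuple_add_HerT[OF X Y] X])
    fix k i j assume k: "k < n" and ij: "i < s" "j < s"
    have "(Y ! k) $$ (i, j) = 0"
      by (rule independent_pencil_complex[OF M ind _ k]) (rule rel[OF ij])
    then show "(tuple_add X Y ! k) $$ (i, j) = (X ! k) $$ (i, j)"
      by (simp add: tuple_add_nth[OF X Y k ij])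
  qed
qed

text \<open>
  Being a free spectrahedron is thus a matter of linear algebra: independence excludes lines, and the identity in
  the span provides the interior.
\<close>

lemma free_spectrahedron_of_independent_pencil:
  assumes r: "1 \<le> r" and M: "M \<in> HerT n r" and ind: "independent_pencil n r M"
    and u: "u \<in> carrier_vec n" and unit: "pencil r M u = 1\<^sub>m r"
  shows "free_spectrahedron_by n r M"
proof -
  have "abstract_operator_system n (free_solution_sets n r M)"
    unfolding abstract_operator_system_def proper_cone_HerT_def proper_cone_in_def topspace_HerT_topology
  proof (intro conjI allI impI ballI)
    fix s :: nat
    show "closedin (HerT_topology n s) (free_solution_sets n r M s)"
      by (rule closedin_free_solution_sets[OF M])
    show "HerT_topology n s interior_of free_solution_sets n r M s \<noteq> {}"
      using interior_of_free_solution_sets[OF M u unit] by blast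
    show "tuple_add A B \<in> free_solution_sets n r M s"
      if "A \<in> free_solution_sets n r M s" "B \<in> free_solution_sets n r M s" for A B
      using that by (simp add: free_solution_sets_iff[OF M] tuple_add_HerT tensor_form_add)
    show "tuple_scale c A \<in> free_solution_sets n r M s"
      if "A \<in> free_solution_sets n r M s" "0 \<le> c" for A c
      using that by (simp add: free_solution_sets_iff[OF M] tuple_scale_HerT tensor_form_scale)
    show "\<not> (\<exists>X\<in>HerT n s. \<exists>Y\<in>HerT n s. tuple_add X Y \<noteq> X \<and> (\<forall>t. tuple_add X (tuple_scale t Y) \<in> free_solution_sets n r M s))"
      using free_solution_sets_no_line[OF M ind] by blast
  next
    fix s t A and V :: "complex mat" assume "A \<in> free_solution_sets n r M s" "V \<in> carrier_mat s t"
    then show "compress V A \<in> free_solution_sets n r M t"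
      by (simp add: free_solution_sets_iff[OF M] compress_HerT[of A n s V t] tensor_form_compress[of A n s V t])
  qed
  moreover have "embed u \<in> HerT_topology n 1 interior_of (free_solution_sets n r M 1)"
  proof -
    have "tuple_of n 1 (\<lambda>k i j. of_real (u $ k) * of_bool (i = j)) = embed u"
      unfolding embed_tuple_of[OF u] by (rule tuple_of_cong) simp
    then show ?thesis using interior_of_free_solution_sets[OF M u unit, of 1] by simp
  qed
  ultimately show ?thesis unfolding free_spectrahedron_by_def using r M u unit by blast
qed


section \<open>Orthonormal frames of positive semidefinite forms\<close>

text \<open>
  The Gram-Schmidt process for the degenerate inner product \<open>U\<close>: run through the unit vectors and
  keep the remainder of the next one unless it is a null vector, in which case it is orthogonal
  to everything. The frame that results satisfies Parseval's identity even though it spans only a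
  complement of the null space.
\<close>

lemma orthonormal_frame:
  assumes U: "hermitian n U" "pos_form n U"
  shows "\<exists>(m :: nat) w. (\<forall>i<m. \<forall>j<m. sesq n U (w i) (w j) = of_bool (i = j)) \<and>
    (\<forall>f g. sesq n U f g = (\<Sum>l<m. sesq n U f (w l) * sesq n U (w l) g))"
proof -
  let ?B = "sesq n U"
  let ?e = "\<lambda>i k. of_bool (k = i) :: complex"
  let ?P = "\<lambda>k (m :: nat) (w :: nat \<Rightarrow> nat \<Rightarrow> complex). (\<forall>i<m. \<forall>j<m. ?B (w i) (w j) = of_bool (i = j)) \<and>
    (\<forall>i<k. \<forall>g. ?B (?e i) g = (\<Sum>l<m. ?B (?e i) (w l) * ?B (w l) g))"
  have ex: "\<exists>m w. ?P k m w" for k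
  proof (induction k)
    case 0
    show ?case by (rule exI[of _ 0], rule exI) simp
  next
    case (Suc k)
    then obtain m w where mw: "?P k m w" by (elim exE) (rule that)
    have on: "?B (w i) (w j) = of_bool (i = j)" if "i < m" "j < m" for i j using mw that by simp
    have pars: "?B (?e i) g = (\<Sum>l<m. ?B (?e i) (w l) * ?B (w l) g)" if "i < k" for i g
      by (rule mw[THEN conjunct2, rule_format, OF that])
    define x where "x = (\<lambda>p. ?e k p + (-1) * (\<Sum>l<m. ?B (?e k) (w l) * w l p))"
    have Bx: "?B x g = ?B (?e k) g - (\<Sum>l<m. ?B (?e k) (w l) * ?B (w l) g)" for g
      unfolding x_def sesq_add_left sesq_sum_left by simp
    have xw: "?B x (w j) = 0" if "j < m" for j
    proof -
      have "(\<Sum>l<m. ?B (?e k) (w l) * ?B (w l) (w j)) = (\<Sum>l<m. if l = j then ?B (?e k) (w l) else 0)"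
        using that by (intro sum.cong refl) (simp add: on)
      then show ?thesis using that by (simp add: Bx)
    qed
    then have wx: "?B (w j) x = 0" if "j < m" for j
      using that sesq_adjoint[OF U(1), of "w j" x] by simp
    show ?case
    proof (cases "Re (?B x x) = 0")
      case True
      then have "?B x g = 0" for g by (rule sesq_null_vector[OF U])
      then have k: "?B (?e k) g = (\<Sum>l<m. ?B (?e k) (w l) * ?B (w l) g)" for g
        using Bx[of g] by (metis eq_iff_diff_eq_0)
      have "?B (?e i) g = (\<Sum>l<m. ?B (?e i) (w l) * ?B (w l) g)" if "i < Suc k" for i g
        using that pars[of i g] k[of g] by (metis less_antisym)
      then have "?P (Suc k) m w" using mw by blast
      then show ?thesis by (intro exI)
    next
      case False
      define t where "t = Re (?B x x)"
      have t: "0 < t" using False U(2) by (simp add: t_def pos_form_def less_le)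
      have Bxx: "?B x x = of_real t"
      proof -
        have "Im (?B x x) = 0"
          using sesq_adjoint[OF U(1), of x x] by (metis cnj.simps(2) neg_equal_zero)
        then show ?thesis by (simp add: t_def complex_eq_iff)
      qed
      define c where "c = complex_of_real (1 / sqrt t)"
      have cc: "c * c * of_real t = 1"
      proof -
        have "1 / sqrt t * (1 / sqrt t) * t = 1" using t by (simp add: field_simps)
        then show ?thesis unfolding c_def by (metis of_real_1 of_real_mult)
      qed
      have ccnj: "cnj c = c" by (simp add: c_def)
      \<comment> \<open>The summand \<open>0\<close> gives the shape in which the form is additive.\<close>
      define y where "y = (\<lambda>p. 0 + c * x p)"
      have By: "?B y g = c * ?B x g" "?B g y = c * ?B g x" for g
        unfolding y_def sesq_add_left sesq_add_right by (simp_all add: ccnj sesq_def)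
      define w' where "w' = w(m := y)"
      have sum': "(\<Sum>l<Suc m. ?B f (w' l) * ?B (w' l) g)
          = (\<Sum>l<m. ?B f (w l) * ?B (w l) g) + c * c * ?B f x * ?B x g" for f g
        by (simp add: w'_def By)
      have "?B (w' i) (w' j) = of_bool (i = j)" if "i < Suc m" "j < Suc m" for i j
        using that on xw wx cc by (auto simp: w'_def less_Suc_eq By Bxx mult_ac)
      moreover have "?B (?e i) g = (\<Sum>l<Suc m. ?B (?e i) (w' l) * ?B (w' l) g)" if "i < Suc k" for i g
      proof (cases "i = k")
        case True
        have "?B (?e k) x = ?B x x" using Bx[of x] by (simp add: wx)
        then have *: "c * c * ?B (?e k) x * ?B x g = ?B x g" using cc by (simp add: Bxx)
        show ?thesis unfolding sum' True unfolding * unfolding Bx by simp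
      next
        case False
        then have i: "i < k" using that by simp
        have "?B (?e i) x = 0" by (subst pars[OF i]) (simp add: wx)
        then show ?thesis unfolding sum' using pars[OF i, of g] by simp
      qed
      ultimately have "?P (Suc k) (Suc m) w'" by blast
      then show ?thesis by (intro exI)
    qed
  qed
  obtain m w where mw: "?P n m w" using ex[of n] by (elim exE) (rule that)
  have pars: "?B (?e i) g = (\<Sum>l<m. ?B (?e i) (w l) * ?B (w l) g)" if "i < n" for i g
    by (rule mw[THEN conjunct2, rule_format, OF that])
  have "?B f g = (\<Sum>l<m. ?B f (w l) * ?B (w l) g)" for f g
  proof -
    have expand: "?B f h = (\<Sum>i<n. f i * ?B (?e i) h)" for h
    proof -
      have "?B f h = ?B (\<lambda>k. \<Sum>i<n. f i * ?e i k) h"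
      proof (rule sesq_cong)
        fix k assume "k < n"
        have "(\<Sum>i<n. f i * ?e i k) = (\<Sum>i<n. if i = k then f i else 0)"
          by (intro sum.cong refl) auto
        then show "f k = (\<Sum>i<n. f i * ?e i k)" using \<open>k < n\<close> by simp
      qed simp_all
      then show ?thesis by (simp only: sesq_sum_left)
    qed
    have "?B f g = (\<Sum>i<n. \<Sum>l<m. f i * ?B (?e i) (w l) * ?B (w l) g)"
      unfolding expand[of g] by (intro sum.cong refl) (simp add: pars[of _ g] sum_distrib_left mult_ac)
    also have "\<dots> = (\<Sum>l<m. \<Sum>i<n. f i * ?B (?e i) (w l) * ?B (w l) g)" by (rule sum.swap)
    also have "\<dots> = (\<Sum>l<m. ?B f (w l) * ?B (w l) g)"
      unfolding expand[of "w _"] by (simp add: sum_distrib_right)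
    finally show ?thesis .
  qed
  then show ?thesis using mw by blast
qed

text \<open>
  Parseval's identity for pairs of unit vectors.
\<close>

lemma pos_form_sum_rank_one:
  assumes U: "hermitian n U" "pos_form n U"
  shows "\<exists>(m :: nat) y. \<forall>i<n. \<forall>j<n. U i j = (\<Sum>l<m. y l i * cnj (y l j))"
proof -
  let ?e = "\<lambda>i k. of_bool (k = i) :: complex"
  obtain m :: nat and w where mw: "\<forall>f g. sesq n U f g = (\<Sum>l<m. sesq n U f (w l) * sesq n U (w l) g)"
    using orthonormal_frame[OF U] by (elim exE conjE) (rule that)
  have pars: "sesq n U f g = (\<Sum>l<m. sesq n U f (w l) * sesq n U (w l) g)" for f g
    by (rule mw[rule_format])
  have adj: "sesq n U (?e j) (w l) = cnj (sesq n U (w l) (?e j))" for j l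
    by (rule sesq_adjoint[OF U(1)])
  have "U i j = (\<Sum>l<m. sesq n U (w l) (?e i) * cnj (sesq n U (w l) (?e j)))" if "i < n" "j < n" for i j
  proof -
    have "U i j = sesq n U (?e j) (?e i)" by (rule sesq_unit_vectors[OF that, symmetric])
    also have "\<dots> = (\<Sum>l<m. sesq n U (?e j) (w l) * sesq n U (w l) (?e i))" by (rule pars)
    also have "\<dots> = (\<Sum>l<m. sesq n U (w l) (?e i) * cnj (sesq n U (w l) (?e j)))"
      by (intro sum.cong refl) (simp only: adj mult.commute)
    finally show ?thesis .
  qed
  then show ?thesis by (intro exI[of _ m] exI[of _ "\<lambda>l i. sesq n U (w l) (?e i)"]) simp
qed

section \<open>The real vector space of Hermitian forms\<close>

instantiation "fun" :: (type, real_vector) real_vector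
begin

definition scaleR_fun :: "real \<Rightarrow> ('a \<Rightarrow> 'b) \<Rightarrow> 'a \<Rightarrow> 'b" where
  "scaleR_fun c f = (\<lambda>x. c *\<^sub>R f x)"

instance
  by standard (simp_all add: scaleR_fun_def fun_eq_iff scaleR_add_right scaleR_add_left)

end

lemma scaleR_apply: "(c *\<^sub>R f) x = c *\<^sub>R f x"
  by (simp add: scaleR_fun_def)

lemma sum_apply: "(\<Sum>x\<in>S. F x) i = (\<Sum>x\<in>S. F x i)"
  for F :: "'a \<Rightarrow> 'b \<Rightarrow> 'c::comm_monoid_add"
  by (induction S rule: infinite_finite_induct) simp_all

text \<open>
  Entries outside the matrix are required to vanish, so that two forms are equal as functions exactly
  if they are equal as matrices.
\<close>

definition herm_forms :: "nat \<Rightarrow> (nat \<Rightarrow> nat \<Rightarrow> complex) set" where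
  "herm_forms r = {h. (\<forall>i j. cnj (h i j) = h j i) \<and> (\<forall>i j. r \<le> i \<or> r \<le> j \<longrightarrow> h i j = 0)}"

lemma herm_forms_hermitian: "h \<in> herm_forms r \<Longrightarrow> hermitian r h"
  by (intro hermitianI) (simp add: herm_forms_def)

lemma herm_forms_outside: "h \<in> herm_forms r \<Longrightarrow> r \<le> i \<or> r \<le> j \<Longrightarrow> h i j = 0"
  by (auto simp: herm_forms_def)

lemma subspace_herm_forms: "subspace (herm_forms r)"
  by (auto simp: real_vector.subspace_def herm_forms_def scaleR_apply)

lemma herm_basis_in_herm_forms: "a < r \<Longrightarrow> b < r \<Longrightarrow> herm_basis a b \<in> herm_forms r"
  by (auto simp: herm_forms_def cnj_herm_basis) (auto simp: herm_basis_def)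

lemma finite_independent_herm_forms:
  assumes "independent B" "B \<subseteq> herm_forms r"
  shows "finite B"
proof -
  define S where "S = (\<lambda>(a, b). herm_basis a b) ` ({..<r} \<times> {..<r})"
  have "h \<in> span S" if h: "h \<in> herm_forms r" for h
  proof -
    have "h = (\<Sum>a<r. \<Sum>b<r. (Re (h a b) + Im (h a b)) *\<^sub>R herm_basis a b)" (is "h = ?e")
    proof (intro ext)
      fix i j
      have e: "?e i j = (\<Sum>a<r. \<Sum>b<r. of_real (Re (h a b) + Im (h a b)) * herm_basis a b i j)"
        by (simp add: sum_apply scaleR_apply scaleR_conv_of_real)
      show "h i j = ?e i j"
      proof (cases "i < r \<and> j < r")
        case True
        then show ?thesis unfolding e using hermitian_expansion[OF herm_forms_hermitian[OF h]] by blast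
      next
        case False
        then have out: "r \<le> i \<or> r \<le> j" by auto
        have "?e i j = (\<Sum>a<r. \<Sum>b<r. 0)"
          unfolding e
          by (intro sum.cong refl) (simp add: herm_forms_outside[OF herm_basis_in_herm_forms out])
        then show ?thesis using herm_forms_outside[OF h out] by simp
      qed
    qed
    also have "\<dots> \<in> span S"
      by (intro real_vector.span_sum real_vector.span_scale real_vector.span_base) (auto simp: S_def)
    finally show ?thesis .
  qed
  then have "B \<subseteq> span S" using assms(2) by blast
  moreover have "finite S" by (simp add: S_def)
  ultimately show ?thesis using real_vector.independent_span_bound[OF _ assms(1)] by blast
qed

lemma sesq_add_form: "sesq n (h + h') f g = sesq n h f g + sesq n h' f g"
  by (simp add: sesq_def algebra_simps sum.distrib)

lemma sesq_scaleR_form: "sesq n (c *\<^sub>R h) f g = of_real c * sesq n h f g"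
  by (simp add: sesq_def scaleR_apply scaleR_conv_of_real sum_distrib_left mult_ac)

lemma sesq_zero_form [simp]: "sesq n 0 f g = 0"
  by (simp add: sesq_def)

lemma sesq_sum_form: "sesq n (\<Sum>x\<in>S. h x) f g = (\<Sum>x\<in>S. sesq n (h x) f g)"
proof -
  have eq: "(\<Sum>x\<in>S. h x) = (\<lambda>i j. \<Sum>x\<in>S. 1 * h x i j)" by (intro ext) (simp add: sum_apply)
  show ?thesis unfolding eq sesq_linear by simp
qed


section \<open>Representations of a cone by a space of Hermitian forms\<close>

text \<open>
  A subspace \<open>G\<close> of pairs \<open>(a, h)\<close> plays the role of a lifted linear matrix inequality: \<open>a\<close> belongs to
  the cone if it is paired with a positive semidefinite \<open>h\<close>. This form needs no choice of
  coordinates for the auxiliary variables. Only the first \<open>d\<close> components of \<open>a\<close> matter.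
\<close>

definition cone_repr ::
  "nat \<Rightarrow> nat \<Rightarrow> ((nat \<Rightarrow> real) \<times> (nat \<Rightarrow> nat \<Rightarrow> complex)) set \<Rightarrow> real vec set \<Rightarrow> bool" where
  "cone_repr d r G C \<longleftrightarrow> subspace G \<and> snd ` G \<subseteq> herm_forms r \<and>
     C = (\<lambda>x. vec d (fst x)) ` {x \<in> G. pos_form r (snd x)}"

lemma proper_cone_sum:
  assumes C: "proper_cone d C" and "finite I" "\<And>l. l \<in> I \<Longrightarrow> vec d (g l) \<in> C"
  shows "vec d (\<lambda>k. \<Sum>l\<in>I. g l k) \<in> C"
  using assms(2,3)
proof (induction I rule: finite_induct)
  case empty
  have "vec d (\<lambda>k. 0 :: real) = 0\<^sub>v d" by auto
  then show ?case using proper_cone_zero[OF C] by simp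
next
  case (insert l I)
  have "vec d (\<lambda>k. \<Sum>l\<in>insert l I. g l k) = vec d (g l) + vec d (\<lambda>k. \<Sum>l\<in>I. g l k)"
    using insert by auto
  then show ?case using insert proper_cone_add[OF C] by simp
qed

text \<open>
  Facial reduction. The forms in a spectrahedral cone may all be singular; the sum \<open>U\<close> of a
  basis chosen from the cone then dominates every form in their span up to a factor, and so serves
  as an order unit.
\<close>

lemma spectrahedral_shadow_repr:
  assumes S: "spectrahedral_shadow d C"
  shows "\<exists>r G w U. cone_repr d r G C \<and> (w, U) \<in> G \<and> pos_form r U \<and>
    (\<forall>x\<in>G. \<exists>c. pos_form r (c *\<^sub>R U - snd x))"
proof -
  obtain e r M where M: "M \<in> HerT (d + e) r"
    and C: "C = (\<lambda>a. vec_first a d) ` {a \<in> carrier_vec (d + e). psd r (pencil r M a)}"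
    using S unfolding spectrahedral_shadow_def spectrahedron_def by blast
  define P where "P = (\<lambda>(x :: nat \<Rightarrow> real) i j. if i < r \<and> j < r
    then \<Sum>k<d + e. complex_of_real (x k) * (M ! k) $$ (i, j) else 0)"
  have linP: "linear P"
    by (rule linearI)
      (auto simp: P_def fun_eq_iff scaleR_apply scaleR_conv_of_real algebra_simps sum.distrib sum_distrib_left)
  have PH: "P x \<in> herm_forms r" for x
    using hermitianD[OF HerT_hermitian[OF M]] by (auto simp: herm_forms_def P_def intro!: sum.cong)
  have psd_P: "psd r (pencil r M a) \<longleftrightarrow> pos_form r (P x)"
    if "a \<in> carrier_vec (d + e)" "\<And>k. k < d + e \<Longrightarrow> a $ k = x k" for a x
  proof -
    have "sesq r (\<lambda>i j. \<Sum>k<d + e. of_real (a $ k) * (M ! k) $$ (i, j)) f f = sesq r (P x) f f" for f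
      by (rule sesq_cong) (simp_all add: P_def that(2))
    then show ?thesis unfolding psd_pencil_iff[OF M that(1)] by (simp add: pos_form_def)
  qed
  define K where "K = {x. pos_form r (P x)}"
  define G where "G = (\<lambda>x. (x, P x)) ` span K"
  have "linear (\<lambda>x. (x, P x))"
    by (rule linearI) (simp_all add: linear_add[OF linP] linear_scale[OF linP])
  then have "subspace G" unfolding G_def by (intro linear_subspace_image real_vector.subspace_span)
  moreover have "C = (\<lambda>x. vec d (fst x)) ` {x \<in> G. pos_form r (snd x)}"
  proof (intro equalityI subsetI)
    fix c assume "c \<in> C"
    then obtain a where a: "a \<in> carrier_vec (d + e)" "psd r (pencil r M a)" "c = vec_first a d"
      using C by blast
    then have "(($) a) \<in> K" using psd_P[OF a(1), of "($) a"] by (simp add: K_def)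
    then have "(($) a, P (($) a)) \<in> {x \<in> G. pos_form r (snd x)}"
      by (auto simp: G_def K_def real_vector.span_base)
    moreover have "c = vec d (fst (($) a, P (($) a)))"
      using a by (auto simp: vec_first_def)
    ultimately show "c \<in> (\<lambda>x. vec d (fst x)) ` {x \<in> G. pos_form r (snd x)}" by blast
  next
    fix c assume "c \<in> (\<lambda>x. vec d (fst x)) ` {x \<in> G. pos_form r (snd x)}"
    then obtain x where x: "pos_form r (P x)" "c = vec d x" by (auto simp: G_def)
    have "vec (d + e) x \<in> {a \<in> carrier_vec (d + e). psd r (pencil r M a)}"
      using psd_P[of "vec (d + e) x" x] x(1) by simp
    moreover have "c = vec_first (vec (d + e) x) d"
      using x(2) by (auto simp: vec_first_def)
    ultimately show "c \<in> C" unfolding C by blast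
  qed
  ultimately have repr: "cone_repr d r G C" using PH by (auto simp: cone_repr_def G_def)
  obtain B where B: "B \<subseteq> P ` K" "independent B" "P ` K \<subseteq> span B"
    by (rule real_vector.maximal_independent_subset)
  have finB: "finite B" using B(1) PH by (intro finite_independent_herm_forms[OF B(2)]) blast
  have posB: "pos_form r b" if "b \<in> B" for b using that B(1) by (auto simp: K_def)
  define U where "U = \<Sum>B"
  have "\<forall>b\<in>B. \<exists>x\<in>K. P x = b" using B(1) by blast
  then obtain pre where pre: "\<And>b. b \<in> B \<Longrightarrow> pre b \<in> K" "\<And>b. b \<in> B \<Longrightarrow> P (pre b) = b" by metis
  have PU: "P (\<Sum>b\<in>B. pre b) = U" using pre(2) by (simp add: linear_sum[OF linP] U_def)
  have UG: "(\<Sum>b\<in>B. pre b, U) \<in> G"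
    unfolding G_def
  proof (rule image_eqI[rotated])
    show "(\<Sum>b\<in>B. pre b) \<in> span K"
      by (intro real_vector.span_sum real_vector.span_base pre(1))
  qed (simp add: PU)
  have "pos_form r U"
    using posB by (simp add: pos_form_def U_def sesq_sum_form sum_nonneg)
  moreover have "\<exists>c. pos_form r (c *\<^sub>R U - snd x)" if "x \<in> G" for x
  proof -
    have "snd x \<in> P ` span K" using that by (auto simp: G_def)
    also have "P ` span K = span (P ` K)" by (rule linear_span_image[OF linP, symmetric])
    also have "\<dots> \<subseteq> span B" by (rule real_vector.span_minimal[OF B(3) real_vector.subspace_span])
    finally obtain u where u: "snd x = (\<Sum>b\<in>B. u b *\<^sub>R b)"
      using real_vector.span_finite[OF finB] by auto
    define c where "c = (\<Sum>b\<in>B. \<bar>u b\<bar>)"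
    have "pos_form r (c *\<^sub>R U - snd x)"
      unfolding pos_form_def
    proof
      fix f
      have "c *\<^sub>R U - snd x = (\<Sum>b\<in>B. (c - u b) *\<^sub>R b)"
        by (simp add: U_def u scaleR_sum_right sum_subtractf scaleR_diff_left)
      then have "Re (sesq r (c *\<^sub>R U - snd x) f f) = (\<Sum>b\<in>B. (c - u b) * Re (sesq r b f f))"
        by (simp add: sesq_sum_form sesq_scaleR_form)
      also have "\<dots> \<ge> 0"
      proof (intro sum_nonneg mult_nonneg_nonneg)
        fix b assume b: "b \<in> B"
        have "u b \<le> \<bar>u b\<bar>" by simp
        also have "\<dots> \<le> c" unfolding c_def using finB b by (intro member_le_sum) auto
        finally show "0 \<le> c - u b" by simp
        show "0 \<le> Re (sesq r b f f)" using posB[OF b] by (simp add: pos_form_def)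
      qed
      finally show "0 \<le> Re (sesq r (c *\<^sub>R U - snd x) f f)" .
    qed
    then show ?thesis by blast
  qed
  ultimately show ?thesis using repr UG by blast
qed

text \<open>
  The components of \<open>pairing s A Z\<close> are the traces of \<open>A_k\<close> times the transpose of \<open>Z\<close>.
\<close>

definition pairing :: "nat \<Rightarrow> mat_tuple \<Rightarrow> (nat \<Rightarrow> nat \<Rightarrow> complex) \<Rightarrow> nat \<Rightarrow> real" where
  "pairing s A Z k = Re (\<Sum>p<s. \<Sum>q<s. (A ! k) $$ (p, q) * Z p q)"

lemma pairing_add: "pairing s A (Z + Z') = pairing s A Z + pairing s A Z'"
  by (simp add: pairing_def fun_eq_iff algebra_simps sum.distrib)

lemma pairing_scaleR: "pairing s A (c *\<^sub>R Z) = c *\<^sub>R pairing s A Z"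
  by (simp add: pairing_def fun_eq_iff scaleR_apply sum_distrib_left algebra_simps)

lemma pairing_zero [simp]: "pairing s A 0 = 0"
  by (simp add: pairing_def fun_eq_iff)

text \<open>
  A positive semidefinite \<open>Z\<close> is a sum of matrices \<open>y y^*\<close>, and the pairing with such a matrix is a vector of values of
  the quadratic forms of \<open>A\<close>, at the complex conjugate of \<open>y\<close>.
\<close>

lemma pairing_in_cone:
  assumes C: "proper_cone d C" and A: "A \<in> largest_system d C s"
    and Z: "hermitian s Z" "pos_form s Z"
  shows "vec d (pairing s A Z) \<in> C"
proof -
  obtain m :: nat and y where y: "\<forall>i<s. \<forall>j<s. Z i j = (\<Sum>l<m. y l i * cnj (y l j))"
    using pos_form_sum_rank_one[OF Z] by blast
  define g where "g = (\<lambda>l k. Re (sesq s (entries (A ! k)) (\<lambda>q. cnj (y l q)) (\<lambda>q. cnj (y l q))))"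
  have "(\<Sum>p<s. \<Sum>q<s. (A ! k) $$ (p, q) * Z p q)
      = (\<Sum>l<m. sesq s (entries (A ! k)) (\<lambda>q. cnj (y l q)) (\<lambda>q. cnj (y l q)))" for k
  proof -
    have "(\<Sum>p<s. \<Sum>q<s. (A ! k) $$ (p, q) * Z p q)
        = (\<Sum>p<s. \<Sum>q<s. \<Sum>l<m. (A ! k) $$ (p, q) * cnj (y l q) * y l p)"
      by (intro sum.cong refl) (simp add: y sum_distrib_left mult_ac)
    also have "\<dots> = (\<Sum>l<m. \<Sum>p<s. \<Sum>q<s. (A ! k) $$ (p, q) * cnj (y l q) * y l p)"
      by (simp only: sum.swap[of _ "{..<m}"])
    finally show ?thesis by (simp add: sesq_def)
  qed
  then have "pairing s A Z = (\<lambda>k. \<Sum>l<m. g l k)" by (simp add: pairing_def g_def fun_eq_iff)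
  moreover have "vec d (g l) \<in> C" for l
    using A by (simp add: largest_system_iff form_values_def g_def)
  ultimately show ?thesis using proper_cone_sum[OF C, of "{..<m}" g] by simp
qed

definition block_diag ::
  "nat \<Rightarrow> (nat \<Rightarrow> nat \<Rightarrow> complex) \<Rightarrow> (nat \<Rightarrow> nat \<Rightarrow> complex) \<Rightarrow> nat \<Rightarrow> nat \<Rightarrow> complex" where
  "block_diag m g Z i j = (if i < m \<and> j < m then g i j
     else if m \<le> i \<and> m \<le> j then Z (i - m) (j - m) else 0)"

lemma sum_lessThan_add: "(\<Sum>i<m + s. f i) = (\<Sum>i<m. f i) + (\<Sum>i<s. f (m + i))"
  for f :: "nat \<Rightarrow> 'a::comm_monoid_add" and m s :: nat
  by (induction s) (simp_all add: add.assoc)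

lemma sum_block_diag:
  "(\<Sum>i<m + s. \<Sum>j<m + s. block_diag m g Z i j * F i j)
    = (\<Sum>i<m. \<Sum>j<m. g i j * F i j) + (\<Sum>i<s. \<Sum>j<s. Z i j * F (m + i) (m + j))"
  by (simp add: sum_lessThan_add block_diag_def)

lemma sesq_block_diag:
  "sesq (m + s) (block_diag m g Z) f f' = sesq m g f f' + sesq s Z (\<lambda>i. f (m + i)) (\<lambda>i. f' (m + i))"
  using sum_block_diag[where m = m and s = s and g = g and Z = Z and F = "\<lambda>i j. f j * cnj (f' i)"] by (simp add: sesq_def mult.assoc)

lemma pos_form_block_diag: "pos_form (m + s) (block_diag m g Z) \<longleftrightarrow> pos_form m g \<and> pos_form s Z"
proof
  assume L: "pos_form (m + s) (block_diag m g Z)"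
  have "0 \<le> Re (sesq m g f f)" for f
  proof -
    let ?f = "\<lambda>i. if i < m then f i else 0"
    have "sesq m g ?f ?f = sesq m g f f" by (rule sesq_cong) simp_all
    moreover have "sesq s Z (\<lambda>i. ?f (m + i)) (\<lambda>i. ?f (m + i)) = 0" by (simp add: sesq_def)
    ultimately show ?thesis
      using L[unfolded pos_form_def, THEN spec, of ?f] by (simp only: sesq_block_diag add_0_right)
  qed
  moreover have "0 \<le> Re (sesq s Z f f)" for f
  proof -
    let ?f = "\<lambda>i. if i < m then 0 else f (i - m)"
    have "sesq m g ?f ?f = 0" by (simp add: sesq_def)
    moreover have "sesq s Z (\<lambda>i. ?f (m + i)) (\<lambda>i. ?f (m + i)) = sesq s Z f f" by simp
    ultimately show ?thesis
      using L[unfolded pos_form_def, THEN spec, of ?f] by (simp only: sesq_block_diag add_0_left)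
  qed
  ultimately show "pos_form m g \<and> pos_form s Z" by (simp add: pos_form_def)
next
  assume "pos_form m g \<and> pos_form s Z"
  then show "pos_form (m + s) (block_diag m g Z)" by (simp add: pos_form_def sesq_block_diag)
qed

definition unit_form :: "nat \<Rightarrow> nat \<Rightarrow> nat \<Rightarrow> complex" where
  "unit_form r i j = of_bool (i = j \<and> i < r)"

text \<open>
  Compression to the support of the order unit turns it into an identity matrix without changing
  the represented cone, because the other forms vanish where the order unit does. Adding a free
  Hermitian block \<open>Z\<close> that contributes \<open>pairing s A Z\<close> enlarges the free shadow by the free numerical
  range of \<open>A\<close>; level one stays the same since these contributions lie in \<open>C\<close> already.
\<close>

lemma unital_repr:
  assumes C: "proper_cone d C" and repr: "cone_repr d r G C"
    and UG: "(w0, U) \<in> G" and Upos: "pos_form r U"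
    and unit: "\<And>x. x \<in> G \<Longrightarrow> \<exists>c. pos_form r (c *\<^sub>R U - snd x)"
    and A: "A \<in> largest_system d C s"
  shows "\<exists>m G'. cone_repr d (m + s) G' C \<and> (\<exists>w. (w, unit_form (m + s)) \<in> G') \<and>
    (\<forall>Z\<in>herm_forms s. (pairing s A Z, block_diag m 0 Z) \<in> G')"
proof -
  have G: "subspace G" and GH: "\<And>x. x \<in> G \<Longrightarrow> snd x \<in> herm_forms r"
    and CG: "C = (\<lambda>x. vec d (fst x)) ` {x \<in> G. pos_form r (snd x)}"
    using repr by (auto simp: cone_repr_def)
  have Uh: "hermitian r U" using GH[OF UG] herm_forms_hermitian by simp
  obtain m :: nat and w where mw: "(\<forall>i<m. \<forall>j<m. sesq r U (w i) (w j) = of_bool (i = j)) \<and>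
      (\<forall>f g. sesq r U f g = (\<Sum>l<m. sesq r U f (w l) * sesq r U (w l) g))"
    using orthonormal_frame[OF Uh Upos] by (elim exE) (rule that)
  have on: "sesq r U (w i) (w j) = of_bool (i = j)" if "i < m" "j < m" for i j
    using mw that by blast
  have pars: "sesq r U f g = (\<Sum>l<m. sesq r U f (w l) * sesq r U (w l) g)" for f g
    using mw by blast
  define pull where "pull = (\<lambda>h i j. sesq r h (w j) (w i))"
  define W where "W = (\<lambda>f p. \<Sum>l<m. f l * w l p)"
  have sesq_pull: "sesq m (pull h) f g = sesq r h (W f) (W g)" if "hermitian r h" for h f g
    unfolding W_def sesq_sum_left sesq_sum_right[OF that]
    by (subst sesq_def, subst sum.swap) (simp add: pull_def sum_distrib_left mult_ac)
  have pos_pull: "pos_form m (pull h) \<longleftrightarrow> pos_form r h" if ah: "(a, h) \<in> G" for a h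
  proof
    have hh: "hermitian r h" using GH[OF ah] herm_forms_hermitian by simp
    show "pos_form m (pull h)" if "pos_form r h"
      using that by (simp add: pos_form_def sesq_pull[OF hh])
    assume pos: "pos_form m (pull h)"
    obtain c where c: "pos_form r (c *\<^sub>R U - h)" using unit[OF ah] by auto
    have "- (a, h) \<in> G" by (rule real_vector.subspace_neg[OF G ah])
    then obtain c' where c': "pos_form r (c' *\<^sub>R U + h)" using unit[of "- (a, h)"] by auto
    have ch: "hermitian r (c *\<^sub>R U - h)"
      by (intro hermitianI)
        (simp add: scaleR_apply hermitianD[OF Uh] hermitianD[OF hh])
    show "pos_form r h"
      unfolding pos_form_def
    proof
      fix f
      define g where "g = (\<lambda>l. sesq r U f (w l))"
      \<comment> \<open>\<open>f - W g\<close> is orthogonal to the frame, so \<open>U\<close> vanishes on it. Bounded from both sides by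
        multiples of \<open>U\<close>, the form \<open>h\<close> vanishes there as well.\<close>
      define f' where "f' = (\<lambda>p. f p + (-1) * W g p)"
      have left: "sesq r k f' x = sesq r k f x - sesq r k (W g) x" for k x
        unfolding f'_def sesq_add_left by simp
      have U0: "sesq r U f' x = 0" for x
        unfolding left W_def sesq_sum_left using pars[of f x] by (simp add: g_def)
      have diff: "sesq r (c *\<^sub>R U - h) f' x = - sesq r h f' x"
        "sesq r (c' *\<^sub>R U + h) f' x = sesq r h f' x" for x
        using U0[of x] sesq_add_form[of r "c *\<^sub>R U" "- h" f' x] sesq_scaleR_form[of r "-1" h f' x]
        by (simp_all add: sesq_add_form sesq_scaleR_form)
      have "0 \<le> Re (sesq r (c *\<^sub>R U - h) f' f')" "0 \<le> Re (sesq r (c' *\<^sub>R U + h) f' f')"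
        using c c' by (simp_all add: pos_form_def)
      then have "Re (sesq r (c *\<^sub>R U - h) f' f') = 0" by (simp add: diff)
      then have "sesq r (c *\<^sub>R U - h) f' x = 0" for x by (rule sesq_null_vector[OF ch c])
      then have eq: "sesq r h f x = sesq r h (W g) x" for x
        using left[of h x] by (simp add: diff)
      have "sesq r h f f = sesq r h (W g) f" by (rule eq)
      also have "\<dots> = cnj (sesq r h f (W g))" by (rule sesq_adjoint[OF hh])
      also have "sesq r h f (W g) = sesq m (pull h) g g" by (simp only: eq sesq_pull[OF hh])
      finally show "0 \<le> Re (sesq r h f f)" using pos by (simp add: pos_form_def)
    qed
  qed
  define \<Phi> where "\<Phi> = (\<lambda>(x :: (nat \<Rightarrow> real) \<times> (nat \<Rightarrow> nat \<Rightarrow> complex), Z).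
    (fst x + pairing s A Z, block_diag m (pull (snd x)) Z))"
  define G' where "G' = \<Phi> ` (G \<times> herm_forms s)"
  have "linear \<Phi>"
    by (rule linearI)
      (auto simp: \<Phi>_def pairing_add pairing_scaleR scaleR_add_right fun_eq_iff block_diag_def pull_def
        sesq_add_form sesq_scaleR_form scaleR_apply scaleR_conv_of_real)
  then have "subspace G'"
    unfolding G'_def by (intro linear_subspace_image subspace_Times G subspace_herm_forms)
  moreover have "snd ` G' \<subseteq> herm_forms (m + s)"
  proof -
    have "block_diag m (pull h) Z \<in> herm_forms (m + s)" if "h \<in> herm_forms r" "Z \<in> herm_forms s" for h Z
    proof -
      have "cnj (pull h i j) = pull h j i" for i j
        unfolding pull_def by (rule sesq_adjoint[OF herm_forms_hermitian[OF that(1)], symmetric])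
      then show ?thesis using that(2) by (auto simp: herm_forms_def block_diag_def)
    qed
    then show ?thesis using GH by (auto simp: G'_def \<Phi>_def)
  qed
  moreover have "C = (\<lambda>x. vec d (fst x)) ` {x \<in> G'. pos_form (m + s) (snd x)}"
  proof (intro equalityI subsetI)
    fix c assume "c \<in> C"
    then obtain a h where ah: "(a, h) \<in> G" "pos_form r h" "c = vec d a" using CG by auto
    have "((a, h), 0) \<in> G \<times> herm_forms s" using ah(1) real_vector.subspace_0[OF subspace_herm_forms] by simp
    then have "\<Phi> ((a, h), 0) \<in> G'" unfolding G'_def by (rule imageI)
    moreover have "pos_form (m + s) (snd (\<Phi> ((a, h), 0)))"
      using ah(2) pos_pull[OF ah(1)] by (simp add: \<Phi>_def pos_form_block_diag) (simp add: pos_form_def)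
    moreover have "c = vec d (fst (\<Phi> ((a, h), 0)))" by (simp add: \<Phi>_def ah(3))
    ultimately show "c \<in> (\<lambda>x. vec d (fst x)) ` {x \<in> G'. pos_form (m + s) (snd x)}" by blast
  next
    fix c assume "c \<in> (\<lambda>x. vec d (fst x)) ` {x \<in> G'. pos_form (m + s) (snd x)}"
    then obtain a h Z where ah: "(a, h) \<in> G" and Z: "Z \<in> herm_forms s"
      and pos: "pos_form (m + s) (block_diag m (pull h) Z)" and c: "c = vec d (a + pairing s A Z)"
      by (auto simp: G'_def \<Phi>_def)
    have "pos_form r h" "pos_form s Z" using pos pos_pull[OF ah] by (simp_all add: pos_form_block_diag)
    then have "vec d a \<in> C" "vec d (pairing s A Z) \<in> C"
      using CG ah pairing_in_cone[OF C A herm_forms_hermitian[OF Z]] by force+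
    moreover have "c = vec d a + vec d (pairing s A Z)" using c by auto
    ultimately show "c \<in> C" using proper_cone_add[OF C] by simp
  qed
  ultimately have "cone_repr d (m + s) G' C" by (simp add: cone_repr_def)
  moreover have "\<exists>w. (w, unit_form (m + s)) \<in> G'"
  proof -
    have "unit_form s \<in> herm_forms s" by (auto simp: unit_form_def herm_forms_def)
    then have "\<Phi> ((w0, U), unit_form s) \<in> G'" unfolding G'_def using UG by blast
    moreover have "block_diag m (pull U) (unit_form s) = unit_form (m + s)"
      by (intro ext) (auto simp: block_diag_def pull_def on unit_form_def)
    ultimately show ?thesis by (auto simp: \<Phi>_def)
  qed
  moreover have "(pairing s A Z, block_diag m 0 Z) \<in> G'" if "Z \<in> herm_forms s" for Z
  proof -
    have "\<Phi> ((0, 0), Z) \<in> G'"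
      unfolding G'_def using that real_vector.subspace_0[OF G] by (auto simp: zero_prod_def)
    moreover have "pull 0 = 0" by (simp add: pull_def fun_eq_iff)
    ultimately show ?thesis by (simp add: \<Phi>_def)
  qed
  ultimately show ?thesis by blast
qed

section \<open>Free spectrahedral shadows over a spectrahedral shadow\<close>

text \<open>
  The multiples of such a pair represent a line in \<open>C\<close> unless the vector vanishes. By linearity, the
  vector of a pair is therefore a function of its form.
\<close>

lemma cone_repr_zero:
  assumes C: "proper_cone d C" and repr: "cone_repr d r G C" and a: "(a, 0) \<in> G" and k: "k < d"
  shows "a k = 0"
proof -
  have G: "subspace G"
    and CG: "C = (\<lambda>x. vec d (fst x)) ` {x \<in> G. pos_form r (snd x)}"
    using repr by (auto simp: cone_repr_def)
  have "vec d a = 0\<^sub>v d"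
  proof (rule proper_cone_no_line[OF C zero_carrier_vec])
    fix t :: real
    have "t *\<^sub>R (a, 0) \<in> G" by (rule real_vector.subspace_scale[OF G a])
    then have "(t *\<^sub>R a, 0) \<in> {x \<in> G. pos_form r (snd x)}" by (simp add: pos_form_def)
    then have "vec d (t *\<^sub>R a) \<in> C" unfolding CG by force
    moreover have "0\<^sub>v d + t \<cdot>\<^sub>v vec d a = vec d (t *\<^sub>R a)" by (auto simp: scaleR_apply)
    ultimately show "0\<^sub>v d + t \<cdot>\<^sub>v vec d a \<in> C" by simp
  qed simp
  then have "vec d a $ k = 0" using k by simp
  then show ?thesis using k by simp
qed

text \<open>Interior points of the cone come in all directions, so every coordinate vector is represented.\<close>

lemma cone_repr_coordinates:
  assumes C: "proper_cone d C" and repr: "cone_repr d r G C" and i: "i < d"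
  shows "\<exists>a h. (a, h) \<in> G \<and> (\<forall>k<d. a k = of_bool (k = i))"
proof -
  have G: "subspace G"
    and CG: "C = (\<lambda>x. vec d (fst x)) ` {x \<in> G. pos_form r (snd x)}"
    using repr by (auto simp: cone_repr_def)
  obtain c where c: "c \<in> vec_topology d interior_of C"
    using C unfolding proper_cone_def proper_cone_in_def by blast
  then obtain \<epsilon> where \<epsilon>: "0 < \<epsilon>"
    and ball: "\<forall>y\<in>carrier_vec d. (\<forall>i<d. \<bar>y $ i - c $ i\<bar> < \<epsilon>) \<longrightarrow> y \<in> C"
    using interior_of_vec_topologyD[OF c] by blast
  have cC: "c \<in> C" by (rule subsetD[OF interior_of_subset c])
  have "vec d (\<lambda>k. c $ k + \<epsilon> / 2 * of_bool (k = i)) \<in> C"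
    by (rule ball[rule_format]) (use \<epsilon> in auto)
  then obtain a h where ah: "(a, h) \<in> G" "vec d (\<lambda>k. c $ k + \<epsilon> / 2 * of_bool (k = i)) = vec d a"
    using CG by auto
  obtain a' h' where ah': "(a', h') \<in> G" "c = vec d a'" using cC CG by auto
  have "(2 / \<epsilon>) *\<^sub>R ((a, h) - (a', h')) \<in> G"
    by (intro real_vector.subspace_scale[OF G] real_vector.subspace_diff[OF G] ah(1) ah'(1))
  moreover have "((2 / \<epsilon>) *\<^sub>R (a - a')) k = of_bool (k = i)" if "k < d" for k
  proof -
    have "a k = c $ k + \<epsilon> / 2 * of_bool (k = i)"
      using arg_cong[OF ah(2), of "\<lambda>v. v $ k"] that by simp
    moreover have "a' k = c $ k" using ah'(2) that by simp
    ultimately show ?thesis using \<epsilon> by (simp add: scaleR_apply)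
  qed
  ultimately show ?thesis by (intro exI[of _ "(2 / \<epsilon>) *\<^sub>R (a - a')"] exI[of _ "(2 / \<epsilon>) *\<^sub>R (h - h')"]) simp
qed

text \<open>
  Coordinates in which the parametrisation becomes the projection to the first \<open>d\<close> components:
  \<open>H 0, \<dots>, H (d - 1)\<close> lie over the unit vectors, the remaining forms are a basis of the fibre over \<open>0\<close>.
\<close>

lemma adapted_basis:
  assumes C: "proper_cone d C" and repr: "cone_repr d r G C"
  shows "\<exists>e H \<beta>. (\<forall>k<d + e. (\<beta> k, H k) \<in> G \<and> (\<forall>i<d. \<beta> k i = of_bool (i = k))) \<and>
    (\<forall>x\<in>G. \<exists>\<xi>. (\<forall>i<d. \<xi> i = fst x i) \<and> snd x = (\<Sum>k<d + e. \<xi> k *\<^sub>R H k)) \<and>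
    (\<forall>\<xi>. (\<Sum>k<d + e. \<xi> k *\<^sub>R H k) = 0 \<longrightarrow> (\<forall>k<d + e. \<xi> k = 0))"
proof -
  have G: "subspace G" and GH: "snd ` G \<subseteq> herm_forms r"
    using repr by (auto simp: cone_repr_def)
  have "\<forall>i\<in>{..<d}. \<exists>x. x \<in> G \<and> (\<forall>k<d. fst x k = of_bool (k = i))"
    using cone_repr_coordinates[OF C repr] by fastforce
  then obtain E where E: "\<And>i. i < d \<Longrightarrow> E i \<in> G" "\<And>i k. i < d \<Longrightarrow> k < d \<Longrightarrow> fst (E i) k = of_bool (k = i)"
    by (metis lessThan_iff)
  define N where "N = snd ` {x \<in> G. \<forall>k<d. fst x k = 0}"
  have "subspace {x \<in> G. \<forall>k<d. fst x k = 0}"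
    using G by (auto simp: real_vector.subspace_def scaleR_apply)
  moreover have "linear (snd :: (nat \<Rightarrow> real) \<times> (nat \<Rightarrow> nat \<Rightarrow> complex) \<Rightarrow> _)"
    by (rule linearI) simp_all
  ultimately have N: "subspace N"
    unfolding N_def by (intro linear_subspace_image)
  obtain B where B: "B \<subseteq> N" "independent B" "N \<subseteq> span B"
    by (rule real_vector.maximal_independent_subset)
  have "B \<subseteq> herm_forms r" using B(1) GH by (auto simp: N_def)
  then have finB: "finite B" by (rule finite_independent_herm_forms[OF B(2)])
  then obtain bs where bs: "set bs = B" "distinct bs" using finite_distinct_list by blast
  define e where "e = length bs"
  have bij: "bij_betw ((!) bs) {..<e} B"
    using bij_betw_nth[OF bs(2)] bs(1) by (simp add: e_def)
  have "\<forall>b\<in>B. \<exists>x. x \<in> G \<and> (\<forall>k<d. fst x k = 0) \<and> snd x = b"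
  proof
    fix b assume "b \<in> B"
    then have "b \<in> snd ` {x \<in> G. \<forall>k<d. fst x k = 0}" using B(1) by (auto simp: N_def)
    then show "\<exists>x. x \<in> G \<and> (\<forall>k<d. fst x k = 0) \<and> snd x = b" by blast
  qed
  then obtain F where F: "\<And>b. b \<in> B \<Longrightarrow> F b \<in> G" "\<And>b k. b \<in> B \<Longrightarrow> k < d \<Longrightarrow> fst (F b) k = 0"
    "\<And>b. b \<in> B \<Longrightarrow> snd (F b) = b" by metis
  define Q where "Q = (\<lambda>k. if k < d then E k else F (bs ! (k - d)))"
  define H where "H = (\<lambda>k. snd (Q k))"
  have bsB: "bs ! j \<in> B" if "j < e" for j using bij that bij_betwE by blast
  have Hb: "H (d + j) = bs ! j" if "j < e" for j using F(3)[OF bsB[OF that]] by (simp add: H_def Q_def)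
  have Q: "Q k \<in> G" "\<And>i. i < d \<Longrightarrow> fst (Q k) i = of_bool (i = k)" if "k < d + e" for k
    using that E F bsB[of "k - d"] by (auto simp: Q_def)
  have span: "\<exists>\<xi>. (\<forall>i<d. \<xi> i = fst x i) \<and> snd x = (\<Sum>k<d + e. \<xi> k *\<^sub>R H k)" if x: "x \<in> G" for x
  proof -
    \<comment> \<open>Subtracting the lifts of the coordinates of \<open>x\<close> leaves an element of the fibre over \<open>0\<close>.\<close>
    define y where "y = x - (\<Sum>k<d. fst x k *\<^sub>R Q k)"
    have "y \<in> G" unfolding y_def
      by (intro real_vector.subspace_diff[OF G x] real_vector.subspace_sum[OF G] real_vector.subspace_scale[OF G] Q) simp
    moreover have "fst y i = 0" if "i < d" for i
    proof -
      have "fst (\<Sum>k<d. fst x k *\<^sub>R Q k) i = (\<Sum>k<d. if k = i then fst x k else 0)"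
        unfolding fst_sum sum_apply
        by (intro sum.cong refl) (use Q that in \<open>simp add: scaleR_apply\<close>)
      then show ?thesis using that by (simp add: y_def)
    qed
    ultimately have "snd y \<in> N" by (auto simp: N_def)
    then obtain u where u: "snd y = (\<Sum>b\<in>B. u b *\<^sub>R b)"
      using B(3) real_vector.span_finite[OF finB] by auto
    have u': "(\<Sum>b\<in>B. u b *\<^sub>R b) = (\<Sum>j<e. u (bs ! j) *\<^sub>R (bs ! j))"
      by (rule sum.reindex_bij_betw[OF bij, symmetric])
    define \<xi> where "\<xi> = (\<lambda>k. if k < d then fst x k else u (bs ! (k - d)))"
    have "snd x = (\<Sum>k<d. fst x k *\<^sub>R H k) + snd y"
      by (simp add: y_def H_def snd_sum)
    also have "\<dots> = (\<Sum>k<d + e. \<xi> k *\<^sub>R H k)"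
      by (simp add: u u' sum_lessThan_add \<xi>_def Hb)
    finally show ?thesis by (intro exI[of _ \<xi>]) (simp add: \<xi>_def)
  qed
  have indep: "\<xi> k = 0" if rel: "(\<Sum>k<d + e. \<xi> k *\<^sub>R H k) = 0" and k: "k < d + e" for \<xi> k
  proof -
    define x where "x = (\<Sum>k<d + e. \<xi> k *\<^sub>R Q k)"
    have "x \<in> G" unfolding x_def
      by (intro real_vector.subspace_sum[OF G] real_vector.subspace_scale[OF G] Q) simp
    moreover have "snd x = 0" using rel by (simp add: x_def H_def snd_sum)
    ultimately have "(fst x, 0) \<in> G" by (metis prod.collapse)
    then have x0: "fst x i = 0" if "i < d" for i using cone_repr_zero[OF C repr _ that] by blast
    have low: "\<xi> i = 0" if "i < d" for i
    proof -
      have "fst x i = (\<Sum>k<d + e. if k = i then \<xi> k else 0)"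
        unfolding x_def fst_sum sum_apply
        by (intro sum.cong refl) (use Q that in \<open>simp add: scaleR_apply\<close>)
      then show ?thesis using x0[OF that] that by simp
    qed
    define u where "u = (\<lambda>b. \<xi> (d + the_inv_into {..<e} ((!) bs) b))"
    have u: "u (bs ! j) = \<xi> (d + j)" if "j < e" for j
      using the_inv_into_f_f[OF bij_betw_imp_inj_on[OF bij]] that by (simp add: u_def)
    have "(\<Sum>b\<in>B. u b *\<^sub>R b) = (\<Sum>j<e. u (bs ! j) *\<^sub>R (bs ! j))"
      by (rule sum.reindex_bij_betw[OF bij, symmetric])
    also have "\<dots> = (\<Sum>j<e. \<xi> (d + j) *\<^sub>R H (d + j))" by (simp add: u Hb)
    also have "\<dots> = 0" using rel by (simp add: sum_lessThan_add low)
    finally have "\<forall>b\<in>B. u b = 0"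
      using B(2) real_vector.dependent_finite[OF finB] by blast
    then have "\<xi> (d + j) = 0" if "j < e" for j using u[OF that] bsB[OF that] by simp
    then show ?thesis using low k by (metis add_diff_inverse_nat nat_add_left_cancel_less)
  qed
  show ?thesis
    by (rule exI[of _ e], rule exI[of _ H], rule exI[of _ "\<lambda>k. fst (Q k)"])
      (use Q span indep in \<open>auto simp: H_def\<close>)
qed

lemma level_one_free_solution_sets:
  assumes M: "M \<in> HerT n r" and x: "x \<in> carrier_vec n"
  shows "embed x \<in> free_solution_sets n r M 1
    \<longleftrightarrow> pos_form r (\<lambda>i j. \<Sum>k<n. of_real (x $ k) * (M ! k) $$ (i, j))"
proof -
  let ?h = "\<lambda>i j. \<Sum>k<n. of_real (x $ k) * (M ! k) $$ (i, j)"
  have eq: "tensor_form n 1 r (embed x) M f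
      = sesq r (\<lambda>i j. \<Sum>k<n. of_real (x $ k) * (M ! k) $$ (i, j)) (f 0) (f 0)" for f
  proof -
    have "tensor_form n 1 r (embed x) M f
        = (\<Sum>k<n. of_real (x $ k) * sesq r (entries (M ! k)) (f 0) (f 0))"
      unfolding tensor_form_def
      by (intro sum.cong refl)
        (simp add: sesq_def embed_nth[OF x] sum_distrib_left mult_ac)
    then show ?thesis by (simp only: sesq_linear)
  qed
  have "(\<forall>f. 0 \<le> Re (tensor_form n 1 r (embed x) M f)) \<longleftrightarrow> pos_form r ?h"
  proof
    assume L: "\<forall>f. 0 \<le> Re (tensor_form n 1 r (embed x) M f)"
    have "0 \<le> Re (sesq r ?h g g)" for g using L[rule_format, of "\<lambda>_. g"] unfolding eq .
    then show "pos_form r ?h" by (simp add: pos_form_def)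
  qed (simp add: eq pos_form_def del: One_nat_def)
  then show ?thesis using embed_HerT[OF x] by (simp only: free_solution_sets_iff[OF M] simp_thms)
qed

text \<open>
  In adapted coordinates the representation is a linearly independent pencil with the identity in its
  span. An element \<open>A\<close> belongs to the shadow if it lifts to a positive semidefinite element of the tensor product
  of the represented space with the Hermitian matrices; \<open>\<Sum> Z x \<otimes> (a x, h x)\<close> is such a lift.
\<close>

lemma free_shadow_of_unital_repr:
  assumes C: "proper_cone d C" and repr: "cone_repr d r G C" and r: "1 \<le> r"
    and unit: "(w, unit_form r) \<in> G"
    and A: "A \<in> HerT d s" and s: "1 \<le> s" and I: "finite I"
    and aG: "\<And>x. x \<in> I \<Longrightarrow> (a x, h x) \<in> G" and Z: "\<And>x. x \<in> I \<Longrightarrow> hermitian s (Z x)"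
    and AZ: "\<And>k p q. k < d \<Longrightarrow> p < s \<Longrightarrow> q < s \<Longrightarrow>
      (A ! k) $$ (p, q) = (\<Sum>x\<in>I. of_real (a x k) * Z x p q)"
    and pos: "\<And>f. 0 \<le> Re (\<Sum>x\<in>I. \<Sum>i<r. \<Sum>j<r. h x i j * sesq s (Z x) (\<lambda>q. f q j) (\<lambda>p. f p i))"
  shows "\<exists>\<D>. free_spectrahedral_shadow d \<D> \<and> over \<D> C \<and> A \<in> \<D> s"
proof -
  have G: "subspace G" and GH: "snd ` G \<subseteq> herm_forms r"
    and CG: "C = (\<lambda>x. vec d (fst x)) ` {x \<in> G. pos_form r (snd x)}"
    using repr by (auto simp: cone_repr_def)
  obtain e H \<beta> where basis: "(\<forall>k<d + e. (\<beta> k, H k) \<in> G \<and> (\<forall>i<d. \<beta> k i = of_bool (i = k))) \<and>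
      (\<forall>x\<in>G. \<exists>\<xi>. (\<forall>i<d. \<xi> i = fst x i) \<and> snd x = (\<Sum>k<d + e. \<xi> k *\<^sub>R H k)) \<and>
      (\<forall>\<xi>. (\<Sum>k<d + e. \<xi> k *\<^sub>R H k) = 0 \<longrightarrow> (\<forall>k<d + e. \<xi> k = 0))"
    using adapted_basis[OF C repr] by (elim exE) (rule that)
  let ?n = "d + e"
  have HG: "(\<beta> k, H k) \<in> G" and \<beta>: "\<And>i. i < d \<Longrightarrow> \<beta> k i = of_bool (i = k)" if "k < ?n" for k
    using basis that by blast+
  have decomp: "\<exists>\<xi>. (\<forall>i<d. \<xi> i = a i) \<and> h = (\<Sum>k<?n. \<xi> k *\<^sub>R H k)" if "(a, h) \<in> G" for a h
    using basis[THEN conjunct2, THEN conjunct1, rule_format, OF that] by simp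
  have HH: "H k \<in> herm_forms r" if "k < ?n" for k using HG[OF that] GH by force
  define M where "M = tuple_of ?n r H"
  have M: "M \<in> HerT ?n r" unfolding M_def by (intro tuple_of_HerT herm_forms_hermitian HH)
  have Mk: "(M ! k) $$ (i, j) = H k i j" if "k < ?n" "i < r" "j < r" for k i j
    using that by (simp add: M_def tuple_of_nth)
  have comb: "(\<Sum>k<?n. \<xi> k *\<^sub>R H k) i j = (\<Sum>k<?n. of_real (\<xi> k) * H k i j)" for \<xi> i j
    by (simp add: sum_apply scaleR_apply scaleR_conv_of_real)
  have "independent_pencil ?n r M"
    unfolding independent_pencil_def
  proof (intro allI impI)
    fix x :: "nat \<Rightarrow> real" and k
    assume rel: "\<forall>i<r. \<forall>j<r. (\<Sum>k<?n. of_real (x k) * (M ! k) $$ (i, j)) = 0" and k: "k < ?n"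
    have "(\<Sum>k<?n. x k *\<^sub>R H k) i j = 0" for i j
    proof (cases "i < r \<and> j < r")
      case True
      then have "(\<Sum>k<?n. of_real (x k) * (M ! k) $$ (i, j)) = 0" using rel by blast
      moreover have "(\<Sum>k<?n. of_real (x k) * (M ! k) $$ (i, j)) = (\<Sum>k<?n. of_real (x k) * H k i j)"
        using True by (intro sum.cong refl) (simp add: Mk)
      ultimately show ?thesis unfolding comb by simp
    next
      case False
      then have "r \<le> i \<or> r \<le> j" by auto
      then have "of_real (x k) * H k i j = 0" if "k < ?n" for k
        using herm_forms_outside[OF HH[OF that]] by simp
      then show ?thesis unfolding comb by (intro sum.neutral) simp
    qed
    then have "(\<Sum>k<?n. x k *\<^sub>R H k) = 0" by (intro ext) simp
    then show "x k = 0" using basis k by blast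
  qed
  moreover
  obtain \<omega> where \<omega>: "unit_form r = (\<Sum>k<?n. \<omega> k *\<^sub>R H k)" using decomp[OF unit] by blast
  have u: "vec ?n \<omega> \<in> carrier_vec ?n" by simp
  have "pencil r M (vec ?n \<omega>) = 1\<^sub>m r"
  proof (rule eq_matI)
    fix i j assume "i < dim_row (1\<^sub>m r :: complex mat)" "j < dim_col (1\<^sub>m r :: complex mat)"
    then have ij: "i < r" "j < r" by auto
    have "pencil r M (vec ?n \<omega>) $$ (i, j) = (\<Sum>k<?n. of_real (\<omega> k) * H k i j)"
      unfolding pencil_index[OF M u ij] by (intro sum.cong refl) (simp add: Mk ij)
    also have "\<dots> = unit_form r i j" unfolding \<omega> comb ..
    finally show "pencil r M (vec ?n \<omega>) $$ (i, j) = 1\<^sub>m r $$ (i, j)"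
      using ij by (simp add: unit_form_def)
  qed (use pencil_carrier[OF M u] in auto)
  ultimately have spec: "free_spectrahedron_by ?n r M"
    using free_spectrahedron_of_independent_pencil[OF r M _ u] by blast
  define \<D> where "\<D> = (\<lambda>t. take d ` free_solution_sets ?n r M t)"
  have "free_spectrahedral_shadow d \<D>"
    unfolding free_spectrahedral_shadow_def \<D>_def using spec by blast
  moreover have "over \<D> C"
    unfolding over_def \<D>_def
  proof (intro equalityI subsetI)
    fix Y assume "Y \<in> take d ` free_solution_sets ?n r M 1"
    then obtain X where X: "X \<in> free_solution_sets ?n r M 1" "Y = take d X" by blast
    then have XH: "X \<in> HerT ?n 1" using free_solution_sets_iff[OF M] by blast
    define x where "x = form_values ?n 1 X (\<lambda>_. 1)"
    have xn: "x \<in> carrier_vec ?n" by (simp add: x_def)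
    have Xx: "X = embed x" unfolding x_def by (rule HerT_level_one[OF XH])
    define y where "y = (\<Sum>k<?n. x $ k *\<^sub>R (\<beta> k, H k))"
    have "y \<in> G" unfolding y_def
      by (intro real_vector.subspace_sum[OF G] real_vector.subspace_scale[OF G] HG) simp
    moreover have "pos_form r (snd y)"
    proof -
      have "sesq r (snd y) f f = sesq r (\<lambda>i j. \<Sum>k<?n. of_real (x $ k) * (M ! k) $$ (i, j)) f f" for f
        by (rule sesq_cong) (auto simp: y_def snd_sum comb Mk intro!: sum.cong)
      then show ?thesis
        using X(1) unfolding Xx level_one_free_solution_sets[OF M xn] by (simp add: pos_form_def)
    qed
    ultimately have "vec d (fst y) \<in> C" unfolding CG by blast
    moreover have "Y = embed (vec d (fst y))"
    proof -
      have "fst y i = x $ i" if "i < d" for i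
      proof -
        have "fst y i = (\<Sum>k<?n. if k = i then x $ k else 0)"
          unfolding y_def fst_sum sum_apply
          by (intro sum.cong refl) (use \<beta> that in \<open>simp add: scaleR_apply\<close>)
        then show ?thesis using that by simp
      qed
      then show ?thesis
        using xn by (auto simp: X(2) Xx embed_def list_of_vec_index intro!: nth_equalityI)
    qed
    ultimately show "Y \<in> embed ` C" by blast
  next
    fix Y assume "Y \<in> embed ` C"
    then obtain b k where bk: "(b, k) \<in> G" "pos_form r k" "Y = embed (vec d b)"
      unfolding CG by auto
    obtain \<xi> where \<xi>: "\<forall>i<d. \<xi> i = b i" "k = (\<Sum>k<?n. \<xi> k *\<^sub>R H k)" using decomp[OF bk(1)] by blast
    have "sesq r (\<lambda>i j. \<Sum>l<?n. of_real (vec ?n \<xi> $ l) * (M ! l) $$ (i, j)) f f = sesq r k f f" for f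
      by (rule sesq_cong) (auto simp: \<xi>(2) comb Mk intro!: sum.cong)
    then have "embed (vec ?n \<xi>) \<in> free_solution_sets ?n r M 1"
      using bk(2) level_one_free_solution_sets[OF M, of "vec ?n \<xi>"] by (simp add: pos_form_def)
    moreover have "Y = take d (embed (vec ?n \<xi>))"
      using \<xi>(1) by (auto simp: bk(3) embed_def list_of_vec_index intro!: nth_equalityI)
    ultimately show "Y \<in> take d ` free_solution_sets ?n r M 1" by blast
  qed
  moreover have "A \<in> \<D> s"
  proof -
    have "\<forall>x\<in>I. \<exists>\<xi>. (\<forall>i<d. \<xi> i = a x i) \<and> h x = (\<Sum>k<?n. \<xi> k *\<^sub>R H k)"
      using decomp[OF aG] by blast
    then obtain \<xi> where \<xi>: "\<And>x i. x \<in> I \<Longrightarrow> i < d \<Longrightarrow> \<xi> x i = a x i"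
      "\<And>x. x \<in> I \<Longrightarrow> h x = (\<Sum>k<?n. \<xi> x k *\<^sub>R H k)" by metis
    define X where "X = tuple_of ?n s (\<lambda>k p q. \<Sum>x\<in>I. of_real (\<xi> x k) * Z x p q)"
    have XH: "X \<in> HerT ?n s"
      unfolding X_def by (intro tuple_of_HerT hermitianI) (simp add: hermitianD[OF Z])
    have "tensor_form ?n s r X M f = (\<Sum>x\<in>I. \<Sum>i<r. \<Sum>j<r. h x i j * sesq s (Z x) (\<lambda>q. f q j) (\<lambda>p. f p i))"
      for f
    proof -
      let ?S = "\<lambda>x i j. sesq s (Z x) (\<lambda>q. f q j) (\<lambda>p. f p i)"
      have sesqX: "sesq s (entries (X ! k)) g g' = (\<Sum>x\<in>I. of_real (\<xi> x k) * sesq s (Z x) g g')"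
        if "k < ?n" for k g g'
      proof -
        have "sesq s (entries (X ! k)) g g' = sesq s (\<lambda>p q. \<Sum>x\<in>I. of_real (\<xi> x k) * Z x p q) g g'"
          by (rule sesq_cong) (simp_all add: X_def tuple_of_nth that)
        then show ?thesis by (simp only: sesq_linear)
      qed
      have "tensor_form ?n s r X M f
          = (\<Sum>k<?n. \<Sum>i<r. \<Sum>j<r. \<Sum>x\<in>I. of_real (\<xi> x k) * H k i j * ?S x i j)"
        unfolding tensor_form_def
        by (intro sum.cong refl) (simp add: sesqX Mk sum_distrib_left mult_ac)
      also have "\<dots> = (\<Sum>x\<in>I. \<Sum>k<?n. \<Sum>i<r. \<Sum>j<r. of_real (\<xi> x k) * H k i j * ?S x i j)"
        by (simp only: sum.swap[of _ I])
      also have "\<dots> = (\<Sum>x\<in>I. \<Sum>i<r. \<Sum>j<r. \<Sum>k<?n. of_real (\<xi> x k) * H k i j * ?S x i j)"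
        by (simp only: sum.swap[of _ "{..<r}" "{..<?n}"])
      also have "\<dots> = (\<Sum>x\<in>I. \<Sum>i<r. \<Sum>j<r. h x i j * ?S x i j)"
        by (intro sum.cong refl) (simp add: \<xi>(2) comb sum_distrib_right)
      finally show ?thesis .
    qed
    then have "X \<in> free_solution_sets ?n r M s"
      using pos XH by (simp add: free_solution_sets_iff[OF M])
    moreover have "A = take d X"
    proof (rule nth_equalityI)
      show "length A = length (take d X)" using HerT_length[OF A] HerT_length[OF XH] by simp
      fix k assume "k < length A"
      then have k: "k < d" using HerT_length[OF A] by simp
      have "A ! k = X ! k"
      proof (rule eq_matI)
        fix p q assume "p < dim_row (X ! k)" "q < dim_col (X ! k)"
        then have pq: "p < s" "q < s" using HerT_carrier[OF XH, of k] k by auto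
        show "(A ! k) $$ (p, q) = (X ! k) $$ (p, q)"
          using k pq \<xi>(1) by (simp add: X_def tuple_of_nth AZ)
      qed (use HerT_carrier[OF A k] HerT_carrier[OF XH, of k] k in auto)
      then show "A ! k = take d X ! k" using k by simp
    qed
    ultimately show ?thesis unfolding \<D>_def by blast
  qed
  ultimately show ?thesis by blast
qed

text \<open>
  The pairing with \<open>F_ab\<close> is the coordinate of \<open>A\<close> at \<open>F_ba\<close>, the transpose of \<open>F_ab\<close>.
\<close>

lemma pairing_expansion:
  assumes A: "A \<in> HerT d s" and k: "k < d" and pq: "p < s" "q < s"
  shows "(\<Sum>a<s. \<Sum>b<s. of_real (pairing s A (herm_basis a b) k) * herm_basis b a p q) = (A ! k) $$ (p, q)"
proof -
  have sym: "herm_basis a b i j = herm_basis i j a b" for a b i j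
    by (auto simp: herm_basis_def)
  have pair: "pairing s A (herm_basis a b) k = Re ((A ! k) $$ (b, a)) + Im ((A ! k) $$ (b, a))"
    if "a < s" "b < s" for a b
  proof -
    have "(\<Sum>p<s. \<Sum>q<s. (A ! k) $$ (p, q) * herm_basis a b p q)
        = (1 + \<i>) / 2 * (A ! k) $$ (a, b) + (1 - \<i>) / 2 * (A ! k) $$ (b, a)"
      unfolding sym[of a b] by (rule sum_herm_basis[OF that])
    moreover have "(A ! k) $$ (a, b) = cnj ((A ! k) $$ (b, a))"
      using hermitianD[OF HerT_hermitian[OF A k] that(2,1)] by simp
    ultimately have "pairing s A (herm_basis a b) k
        = Re ((1 + \<i>) / 2 * cnj ((A ! k) $$ (b, a)) + (1 - \<i>) / 2 * (A ! k) $$ (b, a))"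
      by (simp only: pairing_def)
    then show ?thesis by (simp add: field_simps)
  qed
  have "(\<Sum>a<s. \<Sum>b<s. of_real (pairing s A (herm_basis a b) k) * herm_basis b a p q)
      = (\<Sum>b<s. \<Sum>a<s. of_real (pairing s A (herm_basis a b) k) * herm_basis b a p q)"
    by (rule sum.swap)
  also have "\<dots> = (\<Sum>b<s. \<Sum>a<s. of_real (Re ((A ! k) $$ (b, a)) + Im ((A ! k) $$ (b, a))) * herm_basis b a p q)"
    by (intro sum.cong refl) (simp add: pair)
  also have "\<dots> = (A ! k) $$ (p, q)"
    by (rule hermitian_expansion[OF HerT_hermitian[OF A k] pq, symmetric])
  finally show ?thesis .
qed

text \<open>
  The tensor \<open>\<Sum> F_ba \<otimes> F_ab\<close> is the rank-one matrix of the maximally entangled vector \<open>\<Sum> e_i \<otimes> e_i\<close>,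
  hence positive semidefinite. The transposition in \<open>F_ba\<close> is essential: \<open>\<Sum> F_ab \<otimes> F_ab\<close> is the flip.
\<close>

lemma herm_basis_tensor:
  assumes "i < s" "j < s"
  shows "(\<Sum>a<s. \<Sum>b<s. herm_basis b a p q * herm_basis a b i j) = of_bool (p = i \<and> q = j)"
  unfolding sum_herm_basis[OF assms]
  by (auto simp: herm_basis_def field_simps)

lemma herm_basis_tensor_form:
  "(\<Sum>a<s. \<Sum>b<s. \<Sum>i<s. \<Sum>j<s. herm_basis a b i j * sesq s (herm_basis b a) (f j) (f i))
    = of_real ((cmod (\<Sum>i<s. f i i))\<^sup>2)"
proof -
  let ?F = "\<lambda>a b i j p q. herm_basis b a p q * herm_basis a b i j * f j q * cnj (f i p)"
  have "(\<Sum>a<s. \<Sum>b<s. \<Sum>i<s. \<Sum>j<s. herm_basis a b i j * sesq s (herm_basis b a) (f j) (f i))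
      = (\<Sum>x\<in>{..<s} \<times> {..<s}. \<Sum>i<s. \<Sum>j<s. \<Sum>p<s. \<Sum>q<s. ?F (fst x) (snd x) i j p q)"
    by (simp add: sum.cartesian_product' sesq_def sum_distrib_left mult_ac)
  also have "\<dots> = (\<Sum>i<s. \<Sum>j<s. \<Sum>p<s. \<Sum>q<s. \<Sum>x\<in>{..<s} \<times> {..<s}. ?F (fst x) (snd x) i j p q)"
    by (simp only: sum.swap[of _ _ "{..<s} \<times> {..<s}"])
  also have "\<dots> = (\<Sum>i<s. \<Sum>j<s. \<Sum>p<s. \<Sum>q<s. (\<Sum>a<s. \<Sum>b<s. herm_basis b a p q * herm_basis a b i j) * (f j q * cnj (f i p)))"
    by (simp add: sum.cartesian_product' sum_distrib_left sum_distrib_right mult_ac)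
  also have "\<dots> = (\<Sum>i<s. \<Sum>j<s. \<Sum>p<s. if p = i then \<Sum>q<s. if q = j then f j q * cnj (f i p) else 0 else 0)"
    by (intro sum.cong refl) (auto simp: herm_basis_tensor intro!: sum.cong)
  also have "\<dots> = (\<Sum>i<s. \<Sum>j<s. f j j * cnj (f i i))" by simp
  also have "\<dots> = (\<Sum>i<s. f i i) * cnj (\<Sum>i<s. f i i)"
    by (simp add: sum_distrib_left sum_distrib_right mult_ac)
  also have "\<dots> = of_real ((cmod (\<Sum>i<s. f i i))\<^sup>2)" by (rule complex_norm_square[symmetric])
  finally show ?thesis .
qed

text \<open>
  The lift of \<open>A\<close> lives in the free block only, where it is the tensor \<open>\<Sum> F_ba \<otimes> F_ab\<close>.
\<close>

lemma free_spectrahedral_shadow_through: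
  assumes C: "proper_cone d C" and S: "spectrahedral_shadow d C"
    and s: "1 \<le> s" and A: "A \<in> largest_system d C s"
  shows "\<exists>\<D>. free_spectrahedral_shadow d \<D> \<and> over \<D> C \<and> A \<in> \<D> s"
proof -
  obtain r G w0 U where repr0: "cone_repr d r G C" and UG: "(w0, U) \<in> G" and Upos: "pos_form r U"
    and unit0: "\<forall>x\<in>G. \<exists>c. pos_form r (c *\<^sub>R U - snd x)"
    using spectrahedral_shadow_repr[OF S] by blast
  obtain m G' where repr: "cone_repr d (m + s) G' C" and unit: "\<exists>w. (w, unit_form (m + s)) \<in> G'"
    and block: "\<forall>Z\<in>herm_forms s. (pairing s A Z, block_diag m 0 Z) \<in> G'"
    using unital_repr[OF C repr0 UG Upos unit0[rule_format] A] by blast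
  obtain w where w: "(w, unit_form (m + s)) \<in> G'" using unit by blast
  have AH: "A \<in> HerT d s" using A by (simp add: largest_system_iff)
  let ?I = "{..<s} \<times> {..<s}"
  define a where "a = (\<lambda>x. pairing s A (herm_basis (fst x) (snd x)))"
  define h where "h = (\<lambda>x. block_diag m 0 (herm_basis (fst x) (snd x)))"
  define Z where "Z = (\<lambda>x. herm_basis (snd x) (fst x))"
  show ?thesis
  proof (rule free_shadow_of_unital_repr[OF C repr _ w AH s, of ?I a h Z])
    show "1 \<le> m + s" using s by simp
    show "(a x, h x) \<in> G'" if "x \<in> ?I" for x
      using block that by (auto simp: a_def h_def herm_basis_in_herm_forms)
    show "hermitian s (Z x)" for x by (intro hermitianI) (simp add: Z_def cnj_herm_basis)
    show "(A ! k) $$ (p, q) = (\<Sum>x\<in>?I. of_real (a x k) * Z x p q)" if "k < d" "p < s" "q < s" for k p q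
      using pairing_expansion[OF AH that] by (simp add: a_def Z_def sum.cartesian_product')
    show "0 \<le> Re (\<Sum>x\<in>?I. \<Sum>i<m + s. \<Sum>j<m + s. h x i j * sesq s (Z x) (\<lambda>q. f q j) (\<lambda>p. f p i))" for f
    proof -
      have "(\<Sum>x\<in>?I. \<Sum>i<m + s. \<Sum>j<m + s. h x i j * sesq s (Z x) (\<lambda>q. f q j) (\<lambda>p. f p i))
          = (\<Sum>a<s. \<Sum>b<s. \<Sum>i<s. \<Sum>j<s. herm_basis a b i j *
              sesq s (herm_basis b a) (\<lambda>q. f q (m + j)) (\<lambda>p. f p (m + i)))"
        unfolding h_def sum_block_diag by (simp add: Z_def sum.cartesian_product')
      also have "\<dots> = of_real ((cmod (\<Sum>i<s. f i (m + i)))\<^sup>2)"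
        by (rule herm_basis_tensor_form[of s "\<lambda>j q. f q (m + j)"])
      finally show ?thesis by simp
    qed
  qed simp_all
qed

section \<open>Covering the largest operator system\<close>

theorem theorem3p1:
  fixes d :: nat and C :: "real Matrix.vec set"
  assumes "proper_cone d C"
  shows "(spectrahedron d (dual_cone d C) \<longrightarrow>
           (\<forall>s\<ge>1. \<forall>A \<in> HerT_topology d s interior_of (largest_system d C s).
              \<exists>\<D>. free_numerical_range d \<D> \<and> over \<D> C \<and> A \<in> \<D> s)) \<and>
         (spectrahedral_shadow d C \<longrightarrow>
           (\<forall>s\<ge>1. \<forall>A \<in> HerT_topology d s interior_of (largest_system d C s).
              \<exists>\<D>. free_spectrahedral_shadow d \<D> \<and> over \<D> C \<and> A \<in> \<D> s))"
proof (intro conjI impI allI ballI)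
  fix s A assume s: "1 \<le> s" and "A \<in> HerT_topology d s interior_of (largest_system d C s)"
  then have A: "A \<in> largest_system d C s" using interior_of_subset[of "HerT_topology d s"] by blast
  show "\<exists>\<D>. free_numerical_range d \<D> \<and> over \<D> C \<and> A \<in> \<D> s" if "spectrahedron d (dual_cone d C)"
    by (rule free_numerical_range_through[OF assms that s A])
  show "\<exists>\<D>. free_spectrahedral_shadow d \<D> \<and> over \<D> C \<and> A \<in> \<D> s" if "spectrahedral_shadow d C"
    by (rule free_spectrahedral_shadow_through[OF assms that s A])
qed

end
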